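(* Let $K$ be an algebraically closed field of characteristic zero, let $d\ge 4$, and let $C\subset\mathbb{P}^2(K)$ be a non-singular projective plane curve of degree $d$. Let $G$ be a non-trivial cyclic subgroup of $Aut(C)$ of order $m$. Then, up to $K$-isomorphism (projective change of coordinates), $C$ with the action of $G$ is of one of the following types with the corresponding equation (where $\alpha,\beta_{ji},\gamma_{ji},\alpha_{ji}\in K$ and $\alpha\ne 0$): (1) $C$ is of type $m,(0,1)$ for some $m\mid d-1$, and has the form $Z^{d-1}L_{1,Z}+\sum_{j\in S(2)_m}Z^{d-j}L_{j,Z}+L_{d,Z}=0$. (2) $C$ is of type $m,(0,1)$ for some $m\mid d$, and has the form $Z^d+\sum_{j\in S(1)_m}Z^{d-j}L_{j,Z}+L_{d,Z}=0$. (3) All reference points lie on $C$, which is of type $m,(a,b)$ for some $m\mid d^2-3d+3$ and $(a,b)\in\Gamma_m$ such that $a\equiv(d-1)a+b\equiv(d-1)b \pmod m$, and $C$ is defined by $$X^{d-1}Y+Y^{d-1}Z+\alpha Z^{d-1}X+\sum_{j=2}^{\lfloor d/2\rfloor}\Bigl(X^{d-j}\sum_{i\in S(1)^{j,X}_{m,(a,b)}}\beta_{ji}Y^iZ^{j-i}+Y^{d-j}\sum_{i\in S^{j,Y}_{m,(a,b)}}\alpha_{ji}Z^iX^{j-i}+Z^{d-j}\sum_{i\in S^{j,Z}_{m,(a,b)}}\gamma_{ji}X^{j-i}Y^i\Bigr)=0.$$ (4) Two reference points lie on $C$, which is of type $m,(a,b)$ in one of the following subcases. (4.1) $m\mid d(d-2)$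 and $(a,b)\in\Gamma_m$ with $(d-1)a+b\equiv 0$ and $a+(d-1)b\equiv 0\pmod m$, and $C$ is given by $$X^d+\sum_{j=2}^{d-1}X^{d-j}\sum_{i\in S(2)^{j,X}_{m,(a,b)}}\beta_{ji}Y^iZ^{j-i}+Y^{d-1}Z+\alpha YZ^{d-1}+\sum_{i\in S_2^{d,X}\,m,(a,b)}\beta_{di}Y^iZ^{d-i}=0.$$ (4.2) $m\mid (d-1)^2$ and $(a,b)\in\Gamma_m$ with $(d-1)a+b\equiv 0$ and $(d-1)b\equiv 0\pmod m$, and $C$ is given by $$X^d+\sum_{j=2}^{d-2}X^{d-j}\sum_{i\in S(2)^{j,X}_{m,(a,b)}}\beta_{ji}Y^iZ^{j-i}+X\Bigl(\alpha Z^{d-1}+\sum_{i\in S_1^{d-1,X}\,m,(a,b)}\beta_{(d-1)i}Y^iZ^{d-1-i}\Bigr)+Y^{d-1}Z+\sum_{i\in S_2^{d,X}\,m,(a,b)}\beta_{di}Y^iZ^{d-i}=0.$$ (4.3) $m\mid d-1$ and $(a,b)\in\Gamma_m$ with $(d-1)b\equiv 0$ and $(d-1)a\equiv 0\pmod m$, and $C$ is given by $$X^d+\sum_{j=2}^{d-2}X^{d-j}\sum_{i\in S(2)^{j,X}_{m,(a,b)}}\beta_{ji}Y^iZ^{j-i}+\sum_{i\in S_2^{d,X}\,m,(a,b)}\beta_{di}Y^iZ^{d-i}+X\Bigl(Z^{d-1}+\alpha Y^{d-1}+\sum_{i\in S_2^{d-1,X}\,m,(a,b)}\beta_{(d-1)i}Y^iZ^{d-1-i}\Bigr)=0.$$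 (5) One reference point lies on $C$, which is of type $m,(a,b)$ for some $m\mid d(d-1)$ and $(a,b)\in\Gamma_m$ with $da\equiv 0$ and $(d-1)b\equiv 0\pmod m$, and $C$ is given by $$X^d+Y^d+\sum_{j=2}^{d-2}X^{d-j}\sum_{i\in S(2)^{j,X}_{m,(a,b)}}\beta_{ji}Y^iZ^{j-i}+\sum_{i\in S_1^{d,X}\,m,(a,b)}\beta_{di}Y^iZ^{d-i}+X\Bigl(\alpha Z^{d-1}+\sum_{i\in S_1^{d-1,X}\,m,(a,b)}\beta_{(d-1)i}Y^iZ^{d-1-i}\Bigr)=0.$$ (6) None of the reference points lies on $C$, which is of type $m,(a,b)$ for some $m\mid d$ and $(a,b)\in\Gamma_m$ with $da\equiv 0$ and $db\equiv 0\pmod m$, and $C$ is given by $$X^d+Y^d+Z^d+\sum_{j=2}^{d-1}X^{d-j}\sum_{i\in S(2)^{j,X}_{m,(a,b)}}\beta_{ji}Y^iZ^{j-i}+\sum_{i\in S_1^{d,X}\,m,(a,b)}\beta_{di}Y^iZ^{d-i}=0.$$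
   Context: $Aut(C)$ is the finite subgroup of $PGL_3(K)$ preserving the defining equation of $C$ up to scalar. "$C$ is of type $m,(a,b)$" means that (in the chosen coordinates) $G$ is generated by the automorphism $[X;\zeta_m^aY;\zeta_m^bZ]$, i.e. $(x:y:z)\mapsto(x:\zeta_m^ay:\zeta_m^bz)$, where $\zeta_m$ is a primitive $m$-th root of unity in $K$. The reference points are $(1:0:0)$, $(0:1:0)$, $(0:0:1)$. $L_{i,*}$ denotes a homogeneous polynomial of degree $i$ in $K[X,Y,Z]$ not involving the variable $*\in\{X,Y,Z\}$. For non-negative integers $u,j,m,d,a,b$: $S(u)_m=\{j: u\le j\le d-1,\ d-j\equiv 0 \pmod m\}$; $S_u^{d,X}\,m,(a,b)=\{i: u\le i\le d-u,\ ai+(d-i)b\equiv 0\pmod m\}$; $S_u^{d-1,X}\,m,(a,b)=\{i: 1\le i\le d-u,\ ai+(d-1-i)b\equiv 0\pmod m\}$; $S(1)^{j,X}_{m,(a,b)}=\{i: 0\le i\le j,\ ai+(j-i)b\equiv a\pmod m\}$; $S(2)^{j,X}_{m,(a,b)}=\{i: 0\le i\le j,\ ai+(j-i)b\equiv 0\pmod m\}$; $S^{j,Y}_{m,(a,b)}=\{i: 0\le i\le j,\ bi+(d-j)a\equiv a\pmod m\}$; $S^{j,Z}_{m,(a,b)}=\{i: 0\le i\le j,\ ai+(d-j)b\equiv a\pmod m\}$; $\Gamma_m=\{(a,b)\in\mathbb{Z}^2: \gcd(a,b)=1,\ 1\le a\ne b\le m-1\}$.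
   Formalization: In case (3) the outer sum runs over j = 2,…,⌊2d/3⌋ instead of j = 2,…,⌊d/2⌋; with the printed limit the claim fails, e.g. for X^5Y+Y^5Z+Z^5X+cX^2Y^2Z^2 with d=6, m=7, (a,b)=(1,3) and general c≠0. *)

theory Defs
  imports
    "HOL-Analysis.Finite_Cartesian_Product"
    "HOL-Analysis.Cartesian_Space"
    "HOL-Analysis.Determinants"
    "HOL-Algebra.Elementary_Groups"
    "HOL-Algebra.Coset"
    "HOL-Computational_Algebra.Polynomial"
    "HOL-Library.Poly_Mapping"
    "HOL-Library.Numeral_Type"
    "HOL-Number_Theory.Cong"
begin

text \<open>
  \<open>K[X,Y,Z]\<close> is the ring of finitely supported functions from exponent vectors to \<open>K\<close>.
  The variables \<open>X\<close>, \<open>Y\<close>, \<open>Z\<close> have the indices 1, 2, 3 in the three-element type \<open>3\<close>.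
\<close>

type_synonym 'a poly3 = "(3 \<Rightarrow>\<^sub>0 nat) \<Rightarrow>\<^sub>0 'a"

definition Const :: "'a::zero \<Rightarrow> 'a poly3" where
  "Const c = Poly_Mapping.single 0 c"

definition Var :: "3 \<Rightarrow> 'a::zero_neq_one poly3" where
  "Var i = Poly_Mapping.single (Poly_Mapping.single i 1) 1"

abbreviation VX :: "'a::zero_neq_one poly3" where "VX \<equiv> Var 1"
abbreviation VY :: "'a::zero_neq_one poly3" where "VY \<equiv> Var 2"
abbreviation VZ :: "'a::zero_neq_one poly3" where "VZ \<equiv> Var 3"

text \<open>The zero polynomial is homogeneous of every degree.\<close>

definition homogeneous :: "nat \<Rightarrow> 'a::zero poly3 \<Rightarrow> bool" where
  "homogeneous n F \<longleftrightarrow>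
     (\<forall>e \<in> Poly_Mapping.keys F. (\<Sum>i\<in>UNIV. Poly_Mapping.lookup e i) = n)"

definition not_involving :: "3 \<Rightarrow> 'a::zero poly3 \<Rightarrow> bool" where
  "not_involving i F \<longleftrightarrow> (\<forall>e \<in> Poly_Mapping.keys F. Poly_Mapping.lookup e i = 0)"

definition eval3 :: "'a::comm_semiring_1 poly3 \<Rightarrow> 'a^3 \<Rightarrow> 'a" where
  "eval3 F v = (\<Sum>e \<in> Poly_Mapping.keys F.
     Poly_Mapping.lookup F e * (\<Prod>i\<in>UNIV. v $ i ^ Poly_Mapping.lookup e i))"

definition partial :: "3 \<Rightarrow> 'a::comm_semiring_1 poly3 \<Rightarrow> 'a poly3" where
  "partial i F = (\<Sum>e \<in> Poly_Mapping.keys F.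
     Poly_Mapping.single (e - Poly_Mapping.single i 1)
       (of_nat (Poly_Mapping.lookup e i) * Poly_Mapping.lookup F e))"

text \<open>
  Substitution of the linear forms \<open>A (X, Y, Z)\<^sup>T\<close> for the variables:
  as a function, \<open>lin_subst F A\<close> is \<open>v \<mapsto> F (A v)\<close>.
\<close>

definition lin_subst :: "'a::comm_semiring_1 poly3 \<Rightarrow> 'a^3^3 \<Rightarrow> 'a poly3" where
  "lin_subst F A = (\<Sum>e \<in> Poly_Mapping.keys F.
     Const (Poly_Mapping.lookup F e) *
     (\<Prod>i\<in>UNIV. (\<Sum>j\<in>UNIV. Const (A $ i $ j) * Var j) ^ Poly_Mapping.lookup e i))"

text \<open>
  A plane curve is given by its defining homogeneous polynomial \<open>F\<close>, which matters only up to a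
  nonzero scalar.  Points of the projective plane are represented by nonzero vectors.
  Over an algebraically closed field, the condition below forces \<open>F\<close> to be nonzero and
  irreducible as soon as it is homogeneous of degree at least 2, so that the degree of \<open>F\<close> is the
  degree of the curve.
\<close>

definition nonsingular :: "'a::comm_semiring_1 poly3 \<Rightarrow> bool" where
  "nonsingular F \<longleftrightarrow>
     \<not> (\<exists>v. v \<noteq> 0 \<and> eval3 F v = 0 \<and> (\<forall>i. eval3 (partial i F) v = 0))"

definition defined_by :: "'a::field poly3 \<Rightarrow> 'a poly3 \<Rightarrow> bool" where
  "defined_by F f \<longleftrightarrow> (\<exists>c. c \<noteq> 0 \<and> F = Const c * f)"

text \<open>The indices of the reference points \<open>(1:0:0)\<close>, \<open>(0:1:0)\<close>, \<open>(0:0:1)\<close> that lie on the curve.\<close>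

definition ref_points_on :: "'a::comm_semiring_1 poly3 \<Rightarrow> 3 set" where
  "ref_points_on F = {i. eval3 F (axis i 1) = 0}"

definition GL3 :: "('a::field^3^3) monoid" where
  "GL3 = \<lparr>carrier = {A. invertible A}, mult = (**), one = mat 1\<rparr>"

definition scalars3 :: "('a::field^3^3) set" where
  "scalars3 = {mat c | c. c \<noteq> 0}"

definition PGL3 :: "('a::field^3^3) set monoid" where
  "PGL3 = GL3 Mod scalars3"

definition pgl :: "'a::field^3^3 \<Rightarrow> ('a^3^3) set" where
  "pgl A = scalars3 #>\<^bsub>GL3\<^esub> A"

lemma group_GL3: "group (GL3 :: ('a::field^3^3) monoid)"
proof (rule groupI)
  fix A assume "A \<in> carrier (GL3 :: ('a^3^3) monoid)"
  then obtain B :: "'a^3^3" where B: "A ** B = mat 1" "B ** A = mat 1"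
    by (auto simp: GL3_def invertible_def)
  then have "B \<in> carrier GL3" by (auto simp: GL3_def invertible_def)
  with B show "\<exists>y\<in>carrier GL3. y \<otimes>\<^bsub>GL3\<^esub> A = \<one>\<^bsub>GL3\<^esub>" by (auto simp: GL3_def)
next
  show "\<one>\<^bsub>GL3\<^esub> \<in> carrier (GL3 :: ('a^3^3) monoid)"
    using matrix_mul_lid[of "mat 1 :: 'a^3^3"] by (auto simp: GL3_def invertible_def)
qed (auto simp: GL3_def invertible_mult matrix_mul_assoc)

lemma mat_mult_left: "mat c ** A = (\<chi> i j. c * A $ i $ j)" for A :: "'a::field^3^3"
  by (simp add: vec_eq_iff matrix_matrix_mult_def mat_def if_distrib if_distribR cong: if_cong)

lemma mat_mult_right: "A ** mat c = (\<chi> i j. c * A $ i $ j)" for A :: "'a::field^3^3"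
  by (simp add: vec_eq_iff matrix_matrix_mult_def mat_def if_distrib if_distribR mult.commute
      cong: if_cong)

lemma mat_mult_mat: "mat c ** mat d = (mat (c * d) :: 'a::field^3^3)"
  unfolding mat_mult_left by (simp add: vec_eq_iff mat_def)

lemma invertible_mat: "c \<noteq> 0 \<Longrightarrow> invertible (mat c :: 'a::field^3^3)"
  unfolding invertible_def by (rule exI[of _ "mat (inverse c)"]) (simp add: mat_mult_mat)

lemma normal_scalars3: "scalars3 \<lhd> (GL3 :: ('a::field^3^3) monoid)"
proof -
  interpret group "GL3 :: ('a^3^3) monoid" by (rule group_GL3)
  have inv_mat: "inv\<^bsub>GL3\<^esub> (mat c) = (mat (inverse c) :: 'a^3^3)" if "c \<noteq> 0" for c
    by (rule inv_equality) (use that in \<open>auto simp: GL3_def mat_mult_mat invertible_mat\<close>)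
  have "subgroup scalars3 (GL3 :: ('a^3^3) monoid)"
  proof (rule subgroupI)
    show "scalars3 \<subseteq> carrier (GL3 :: ('a^3^3) monoid)"
      by (auto simp: scalars3_def GL3_def invertible_mat)
    show "scalars3 \<noteq> ({} :: ('a^3^3) set)"
      by (auto simp: scalars3_def intro: exI[of _ 1])
    show "inv\<^bsub>GL3\<^esub> A \<in> scalars3" if "A \<in> scalars3" for A :: "'a^3^3"
      using that inv_mat by (force simp: scalars3_def)
    show "A \<otimes>\<^bsub>GL3\<^esub> B \<in> scalars3" if "A \<in> scalars3" "B \<in> scalars3" for A B :: "'a^3^3"
      using that by (force simp: scalars3_def GL3_def mat_mult_mat)
  qed
  moreover have "scalars3 #>\<^bsub>GL3\<^esub> A = A <#\<^bsub>GL3\<^esub> scalars3" for A :: "'a^3^3"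
    by (auto simp: r_coset_def l_coset_def scalars3_def GL3_def mat_mult_left mat_mult_right)
  ultimately show ?thesis
    by (simp add: normal_def normal_axioms_def group_GL3)
qed

lemma group_PGL3: "group (PGL3 :: ('a::field^3^3) set monoid)"
  unfolding PGL3_def by (rule normal.factorgroup_is_group[OF normal_scalars3])

definition Aut_curve :: "'a::field poly3 \<Rightarrow> ('a^3^3) set set" where
  "Aut_curve F = {g \<in> carrier PGL3. \<forall>A\<in>g. \<exists>c. c \<noteq> 0 \<and> lin_subst F A = Const c * F}"

text \<open>
  In the coordinates \<open>w\<close> given by \<open>v = P w\<close>, a curve \<open>F = 0\<close> becomes \<open>lin_subst F P = 0\<close>
  and a group \<open>G\<close> acting on it becomes \<open>P\<^sup>-\<^sup>1 G P\<close>.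
\<close>

definition conj_by :: "'a::field^3^3 \<Rightarrow> ('a^3^3) set set \<Rightarrow> ('a^3^3) set set" where
  "conj_by P G = (\<lambda>g. inv\<^bsub>PGL3\<^esub> (pgl P) \<otimes>\<^bsub>PGL3\<^esub> g \<otimes>\<^bsub>PGL3\<^esub> pgl P) ` G"

definition primitive_root_of_unity :: "nat \<Rightarrow> 'a::field \<Rightarrow> bool" where
  "primitive_root_of_unity m \<zeta> \<longleftrightarrow> 0 < m \<and> \<zeta> ^ m = 1 \<and> (\<forall>k. 0 < k \<and> k < m \<longrightarrow> \<zeta> ^ k \<noteq> 1)"

definition diag3 :: "'a::zero \<Rightarrow> 'a \<Rightarrow> 'a \<Rightarrow> 'a^3^3" where
  "diag3 x y z = (\<chi> i j. if i = j then (vector [x, y, z] :: 'a^3) $ i else 0)"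

text \<open>
  For a primitive \<open>m\<close>-th root of unity \<open>\<zeta>\<close> this is the type \<open>m, (a,b)\<close>.  The group generated does
  not depend on the choice of \<open>\<zeta>\<close>.
\<close>

definition of_type :: "'a::field \<Rightarrow> nat \<Rightarrow> nat \<Rightarrow> ('a^3^3) set set \<Rightarrow> bool" where
  "of_type \<zeta> a b G \<longleftrightarrow> G = generate PGL3 {pgl (diag3 1 (\<zeta> ^ a) (\<zeta> ^ b))}"

definition Gamma_pairs :: "nat \<Rightarrow> (nat \<times> nat) set" where
  "Gamma_pairs m =
     {(a, b). coprime a b \<and> 1 \<le> a \<and> a \<le> m - 1 \<and> 1 \<le> b \<and> b \<le> m - 1 \<and> a \<noteq> b}"

definition S_hom :: "nat \<Rightarrow> nat \<Rightarrow> nat \<Rightarrow> nat set" where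
  "S_hom u d m = {j. u \<le> j \<and> j \<le> d - 1 \<and> [d - j = 0] (mod m)}"

definition S_d_X :: "nat \<Rightarrow> nat \<Rightarrow> nat \<Rightarrow> nat \<Rightarrow> nat \<Rightarrow> nat set" where
  "S_d_X u d m a b = {i. u \<le> i \<and> i \<le> d - u \<and> [a * i + (d - i) * b = 0] (mod m)}"

text \<open>
  Here the lower bound is 1 for every \<open>u\<close>; the set is used only for \<open>u \<in> {1, 2}\<close>, so that
  \<open>i \<le> d - 1\<close> and the subtraction \<open>d - 1 - i\<close> is not truncated.
\<close>

definition S_d1_X :: "nat \<Rightarrow> nat \<Rightarrow> nat \<Rightarrow> nat \<Rightarrow> nat \<Rightarrow> nat set" where
  "S_d1_X u d m a b = {i. 1 \<le> i \<and> i \<le> d - u \<and> [a * i + (d - 1 - i) * b = 0] (mod m)}"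

definition S1_X :: "nat \<Rightarrow> nat \<Rightarrow> nat \<Rightarrow> nat \<Rightarrow> nat set" where
  "S1_X j m a b = {i. i \<le> j \<and> [a * i + (j - i) * b = a] (mod m)}"

definition S2_X :: "nat \<Rightarrow> nat \<Rightarrow> nat \<Rightarrow> nat \<Rightarrow> nat set" where
  "S2_X j m a b = {i. i \<le> j \<and> [a * i + (j - i) * b = 0] (mod m)}"

definition S_Y :: "nat \<Rightarrow> nat \<Rightarrow> nat \<Rightarrow> nat \<Rightarrow> nat \<Rightarrow> nat set" where
  "S_Y d j m a b = {i. i \<le> j \<and> [b * i + (d - j) * a = a] (mod m)}"

definition S_Z :: "nat \<Rightarrow> nat \<Rightarrow> nat \<Rightarrow> nat \<Rightarrow> nat \<Rightarrow> nat set" where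
  "S_Z d j m a b = {i. i \<le> j \<and> [a * i + (d - j) * b = a] (mod m)}"

text \<open>
  When all three reference points lie on the curve, the monomials beyond
  \<open>X\<^sup>d\<^sup>-\<^sup>1Y\<close>, \<open>Y\<^sup>d\<^sup>-\<^sup>1Z\<close>, \<open>Z\<^sup>d\<^sup>-\<^sup>1X\<close> are sorted by a variable whose exponent \<open>d - j\<close> is largest.
  That exponent is at least \<open>\<lceil>d/3\<rceil>\<close>, so \<open>j\<close> runs up to \<open>\<lfloor>2d/3\<rfloor>\<close>.
  A limit \<open>\<lfloor>d/2\<rfloor>\<close>, as found in the literature, is too small: for \<open>d = 6\<close>, \<open>m = 7\<close>,
  \<open>(a,b) = (1,3)\<close> it omits \<open>X\<^sup>2Y\<^sup>2Z\<^sup>2\<close>, although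
  \<open>X\<^sup>5Y + Y\<^sup>5Z + Z\<^sup>5X + c X\<^sup>2Y\<^sup>2Z\<^sup>2\<close> is invariant under the group of type \<open>7, (1,3)\<close> and
  nonsingular for all but finitely many \<open>c\<close>.
\<close>

end

theory Submission
  imports Defs "HOL-Algebra.Multiplicative_Group"
begin

text \<open>
  A lift of a generator of \<open>G\<close> to \<open>GL\<^sub>3\<close> can be scaled so that its \<open>m\<close>-th power is the identity, and
  is then diagonalisable: in suitable coordinates \<open>G\<close> is generated by
  \<open>diag(\<zeta>\<^sup>w\<^sup>1, \<zeta>\<^sup>w\<^sup>2, \<zeta>\<^sup>w\<^sup>3)\<close>, and all monomials of \<open>F\<close> have the same weight modulo \<open>m\<close>.
  If two of the weights agree modulo \<open>m\<close>, the generator is a homology, and sorting \<open>F\<close> by powers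
  of \<open>Z\<close> gives (1) or (2).  If not, nonsingularity at the \<open>i\<close>-th reference point provides
  a monomial \<open>x\<^sub>i\<^sup>d\<^sup>-\<^sup>1 x\<^sub>k\<close> of \<open>F\<close>, and \<open>k = T i\<close> is unique because the weights are distinct.
  Up to a permutation of the coordinates there are seven maps \<open>T\<close> of the three indices to themselves;
  six of them are the configurations (3) to (6), and the seventh would force \<open>F\<close> to be divisible by
  a coordinate.  Replacing \<open>\<zeta>\<close> by a power and shifting the weights makes them \<open>0, a, b\<close> with
  \<open>a\<close> and \<open>b\<close> coprime, and rescaling the coordinates normalises the coefficients.
\<close>

text \<open>Once \<open>F\<close> is in diagonal coordinates, all conditions are congruences modulo
  \<open>m\<close> between exponents of \<open>\<zeta>\<close>. Nonsingularity enters through two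
  facts only: a leading monomial at each reference point, and indivisibility by each coordinate. The
  seven maps are the functional digraphs on three vertices up to isomorphism. In the excluded one
  every leading monomial contains \<open>X\<close>, and the weights then exclude all monomials free
  of \<open>X\<close>. The arithmetical obstacle is the coprimality of \<open>a\<close> and
  \<open>b\<close>. The group determines the weights only up to a common shift and a common unit
  modulo \<open>m\<close>. If the second weight is made equal to its gcd with \<open>m\<close>, any
  common factor \<open>h\<close> of the weights divides \<open>m\<close>, and the power
  \<open>m / h\<close> of the generator is trivial. The exact order must therefore be carried along,
  which is the purpose of the last clause of \<open>diagonal_action\<close>. Coprimality in turn
  yields the conditions on \<open>m\<close>: the leading monomials give \<open>m dvd x * a\<close>
  and \<open>m dvd x * b\<close>, hence \<open>m dvd x\<close>.\<close>

section \<open>Triples of indices and induction on polynomials\<close>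

lemma UNIV_3_distinct:
  fixes u v t :: 3
  assumes "u \<noteq> v" "v \<noteq> t" "u \<noteq> t"
  shows "UNIV = {u, v, t}"
  using assms exhaust_3[of u] exhaust_3[of v] exhaust_3[of t] by (auto simp: UNIV_3)

lemma sum_prod_UNIV_3_distinct:
  fixes u v t :: 3
  assumes "u \<noteq> v" "v \<noteq> t" "u \<noteq> t"
  shows "sum f UNIV = f u + f v + f t"
    and "prod g UNIV = g u * g v * g t"
  unfolding UNIV_3_distinct[OF assms] using assms by (simp_all add: ac_simps)

lemma other_indices_3:
  fixes i :: 3
  obtains j k where "i \<noteq> j" "j \<noteq> k" "i \<noteq> k"
proof -
  consider "i = 1" | "i = 2" | "i = 3" using exhaust_3 by blast
  then show thesis by cases (rule that[of 2 3] that[of 1 3] that[of 1 2]; simp)+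
qed

lemma third_index_3:
  fixes i j :: 3
  assumes "i \<noteq> j"
  obtains t where "i \<noteq> j" "j \<noteq> t" "i \<noteq> t"
proof -
  obtain p q where "i \<noteq> p" "p \<noteq> q" "i \<noteq> q" by (rule other_indices_3)
  then show thesis using assms that[of p] that[of q] by (cases "j = p") auto
qed

lemma prod_UNIV_3: "prod f (UNIV :: 3 set) = f 1 * f 2 * f 3"
  for f :: "3 \<Rightarrow> 'b::comm_monoid_mult"
  unfolding UNIV_3 by (simp add: mult.assoc)

lemma poly_mapping_sum_single: "F = (\<Sum>e\<in>Poly_Mapping.keys F. Poly_Mapping.single e (Poly_Mapping.lookup F e))"
  for F :: "'k \<Rightarrow>\<^sub>0 'b::comm_monoid_add"
  by (rule poly_mapping_eqI)
     (auto simp: lookup_sum lookup_single when_def in_keys_iff)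

text \<open>Reduces every statement that is additive in \<open>F\<close> to a single monomial. The
  \<open>add\<close> case carries no disjointness condition, so cancellation in the sum never has to
  be discussed.\<close>

lemma poly_mapping_additive_induct [case_names single add]:
  fixes F :: "'k \<Rightarrow>\<^sub>0 'b::comm_monoid_add"
  assumes single: "\<And>e c. P (Poly_Mapping.single e c)"
    and add: "\<And>F G. P F \<Longrightarrow> P G \<Longrightarrow> P (F + G)"
  shows "P F"
proof -
  have "P (\<Sum>e\<in>K. Poly_Mapping.single e (Poly_Mapping.lookup F e))" if "finite K" for K
    using that
  proof (induction K)
    case empty
    \<comment> \<open>The zero polynomial counts as a monomial with coefficient 0.\<close>
    show ?case using single[of undefined 0] by simp
  qed (auto intro: single add)
  then show ?thesis by (metis poly_mapping_sum_single finite_keys)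
qed

section \<open>Evaluation homomorphisms\<close>

text \<open>Common generalisation of \<open>eval3\<close> (identity on coefficients) and
  \<open>lin_subst\<close> (\<open>Const\<close> on coefficients, linear forms for the variables).
  Both inherit the homomorphism laws from the locale below.\<close>

definition evalp :: "('a::comm_semiring_1 \<Rightarrow> 'b::comm_semiring_1) \<Rightarrow> (3 \<Rightarrow> 'b) \<Rightarrow> 'a poly3 \<Rightarrow> 'b" where
  "evalp \<phi> g F = (\<Sum>e \<in> Poly_Mapping.keys F.
     \<phi> (Poly_Mapping.lookup F e) * (\<Prod>i\<in>UNIV. g i ^ Poly_Mapping.lookup e i))"

locale coeff_hom =
  fixes \<phi> :: "'a::comm_semiring_1 \<Rightarrow> 'b::comm_semiring_1"
  assumes hom_0: "\<phi> 0 = 0" and hom_1: "\<phi> 1 = 1"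
    and hom_add: "\<phi> (x + y) = \<phi> x + \<phi> y" and hom_mult: "\<phi> (x * y) = \<phi> x * \<phi> y"
begin

text \<open>Keys may cancel in a sum, so additivity is visible only over a common finite index set;
  the extra terms vanish because \<open>\<phi> 0 = 0\<close>.\<close>

lemma evalp_superset:
  assumes "finite K" "Poly_Mapping.keys F \<subseteq> K"
  shows "evalp \<phi> g F = (\<Sum>e \<in> K. \<phi> (Poly_Mapping.lookup F e) * (\<Prod>i\<in>UNIV. g i ^ Poly_Mapping.lookup e i))"
  unfolding evalp_def
  by (rule sum.mono_neutral_left) (use assms in \<open>auto simp: in_keys_iff hom_0\<close>)

lemma evalp_single: "evalp \<phi> g (Poly_Mapping.single e c) = \<phi> c * (\<Prod>i\<in>UNIV. g i ^ Poly_Mapping.lookup e i)"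
  by (subst evalp_superset[of "{e}"]) auto

lemma evalp_0: "evalp \<phi> g 0 = 0"
  by (simp add: evalp_def)

lemma evalp_add: "evalp \<phi> g (F + H) = evalp \<phi> g F + evalp \<phi> g H"
proof -
  let ?K = "Poly_Mapping.keys F \<union> Poly_Mapping.keys H"
  have "Poly_Mapping.keys (F + H) \<subseteq> ?K" by (rule keys_add)
  then show ?thesis
    by (simp add: evalp_superset[of ?K] lookup_add hom_add distrib_right sum.distrib)
qed

lemma evalp_sum: "evalp \<phi> g (sum f I) = (\<Sum>i\<in>I. evalp \<phi> g (f i))"
  by (induction I rule: infinite_finite_induct) (auto simp: evalp_0 evalp_add)

lemma evalp_mult: "evalp \<phi> g (F * H) = evalp \<phi> g F * evalp \<phi> g H"
proof (induction F rule: poly_mapping_additive_induct)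
  case (single e c)
  show ?case
    by (induction H rule: poly_mapping_additive_induct)
       (simp_all add: mult_single evalp_single evalp_add hom_mult lookup_add power_add
          prod.distrib algebra_simps)
qed (simp add: evalp_add distrib_right)

lemma evalp_Const: "evalp \<phi> g (Const c) = \<phi> c"
  by (simp add: Const_def evalp_single)

lemma evalp_Var: "evalp \<phi> g (Var i) = g i"
proof -
  have "(\<Prod>j\<in>UNIV. g j ^ Poly_Mapping.lookup (Poly_Mapping.single i 1) j) = (\<Prod>j\<in>UNIV. if j = i then g j else 1)"
    by (rule prod.cong) (auto simp: lookup_single when_def)
  then show ?thesis by (simp add: Var_def evalp_single hom_1)
qed

lemma evalp_power: "evalp \<phi> g (F ^ n) = evalp \<phi> g F ^ n"
  using evalp_Const[of g 1] by (induction n) (simp_all add: evalp_mult Const_def hom_1)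

lemma evalp_prod: "evalp \<phi> g (prod f I) = (\<Prod>i\<in>I. evalp \<phi> g (f i))"
  using evalp_Const[of g 1]
  by (induction I rule: infinite_finite_induct) (simp_all add: evalp_mult Const_def hom_1)

end

lemma Const_0 [simp]: "Const 0 = 0" and Const_1 [simp]: "Const (1::'a::comm_semiring_1) = 1"
  by (simp_all add: Const_def)

lemma Const_add: "Const (x + y) = Const x + Const (y::'a::comm_semiring_1)"
  by (simp add: Const_def single_add)

lemma Const_mult: "Const (x * y) = Const x * Const (y::'a::comm_semiring_1)"
  by (simp add: Const_def mult_single)

lemma Const_sum: "Const (sum f I) = (\<Sum>i\<in>I. Const (f i :: 'a::comm_semiring_1))"
  by (induction I rule: infinite_finite_induct) (simp_all add: Const_add)

interpretation id_hom: coeff_hom "\<lambda>x::'a::comm_semiring_1. x"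
  by standard auto

interpretation Const_hom: coeff_hom "Const :: 'a::comm_semiring_1 \<Rightarrow> 'a poly3"
  by standard (auto simp: Const_add Const_mult)

definition linear_form :: "'a::comm_semiring_1^3^3 \<Rightarrow> 3 \<Rightarrow> 'a poly3" where
  "linear_form A i = (\<Sum>j\<in>UNIV. Const (A $ i $ j) * Var j)"

lemma eval3_evalp: "eval3 F v = evalp (\<lambda>x. x) (($) v) F"
  by (simp add: eval3_def evalp_def)

lemma lin_subst_evalp: "lin_subst F A = evalp Const (linear_form A) F"
  by (simp add: lin_subst_def evalp_def linear_form_def)

lemma eval3_linear_form: "eval3 (linear_form A i) v = (A *v v) $ i"
  by (simp add: eval3_evalp linear_form_def id_hom.evalp_sum id_hom.evalp_mult
      id_hom.evalp_Const id_hom.evalp_Var matrix_vector_mult_def)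

lemma eval3_lin_subst: "eval3 (lin_subst F A) v = eval3 F (A *v v)"
proof -
  have "eval3 (lin_subst F A) v = (\<Sum>e \<in> Poly_Mapping.keys F.
     Poly_Mapping.lookup F e * (\<Prod>i\<in>UNIV. eval3 (linear_form A i) v ^ Poly_Mapping.lookup e i))"
    unfolding eval3_evalp lin_subst_def linear_form_def[symmetric]
    by (simp add: id_hom.evalp_sum id_hom.evalp_mult id_hom.evalp_prod id_hom.evalp_power
        id_hom.evalp_Const)
  then show ?thesis unfolding eval3_linear_form by (simp add: eval3_def)
qed

lemma lin_subst_linear_form: "lin_subst (linear_form A i) B = linear_form (A ** B) i"
proof -
  have "lin_subst (linear_form A i) B = (\<Sum>j\<in>UNIV. \<Sum>k\<in>UNIV. Const (A $ i $ j * B $ j $ k) * Var k)"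
    by (simp add: lin_subst_evalp linear_form_def[of A] Const_hom.evalp_sum Const_hom.evalp_mult
      Const_hom.evalp_Const Const_hom.evalp_Var)
      (simp add: linear_form_def sum_distrib_left Const_mult mult_ac)
  also have "\<dots> = (\<Sum>k\<in>UNIV. \<Sum>j\<in>UNIV. Const (A $ i $ j * B $ j $ k) * Var k)"
    by (rule sum.swap)
  finally show ?thesis
    by (simp add: linear_form_def matrix_matrix_mult_def Const_sum sum_distrib_right)
qed

text \<open>Substituting \<open>B\<close> into \<open>v \<mapsto> F (A v)\<close> gives
  \<open>v \<mapsto> F (A (B v))\<close>. This is a right action, which is why successive changes of
  coordinates compose as \<open>P ** Q\<close>.\<close>

lemma lin_subst_lin_subst: "lin_subst (lin_subst F A) B = lin_subst F (A ** B)"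
proof -
  have "lin_subst (lin_subst F A) B = (\<Sum>e \<in> Poly_Mapping.keys F.
     Const (Poly_Mapping.lookup F e) * (\<Prod>i\<in>UNIV. lin_subst (linear_form A i) B ^ Poly_Mapping.lookup e i))"
    unfolding lin_subst_evalp[of _ B]
    unfolding lin_subst_def linear_form_def[symmetric]
    by (simp add: Const_hom.evalp_sum Const_hom.evalp_mult Const_hom.evalp_prod Const_hom.evalp_power
        Const_hom.evalp_Const)
  then show ?thesis unfolding lin_subst_linear_form by (simp add: lin_subst_def linear_form_def)
qed

lemma lin_subst_add: "lin_subst (F + H) A = lin_subst F A + lin_subst H A"
  by (simp add: lin_subst_evalp Const_hom.evalp_add)

lemma lin_subst_mult: "lin_subst (F * H) A = lin_subst F A * lin_subst H A"
  by (simp add: lin_subst_evalp Const_hom.evalp_mult)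

lemma lin_subst_Const: "lin_subst (Const c) A = Const c"
  by (simp add: lin_subst_evalp Const_hom.evalp_Const)

lemma lin_subst_single:
  "lin_subst (Poly_Mapping.single e c) A = Const c * (\<Prod>i\<in>UNIV. linear_form A i ^ Poly_Mapping.lookup e i)"
  by (simp add: lin_subst_evalp Const_hom.evalp_single)

section \<open>Partial derivatives\<close>

lemma partial_superset:
  fixes F :: "'a::comm_semiring_1 poly3"
  assumes "finite K" "Poly_Mapping.keys F \<subseteq> K"
  shows "partial i F = (\<Sum>e \<in> K. Poly_Mapping.single (e - Poly_Mapping.single i 1)
       (of_nat (Poly_Mapping.lookup e i) * Poly_Mapping.lookup F e))"
  unfolding partial_def
  by (rule sum.mono_neutral_left) (use assms in \<open>auto simp: in_keys_iff\<close>)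

lemma partial_single: "partial i (Poly_Mapping.single e c) =
    Poly_Mapping.single (e - Poly_Mapping.single i 1) (of_nat (Poly_Mapping.lookup e i) * c)"
  for c :: "'a::comm_semiring_1"
  by (subst partial_superset[of "{e}"]) auto

lemma partial_add: "partial i (F + H) = partial i F + partial i H"
  for F :: "'a::comm_semiring_1 poly3"
proof -
  let ?K = "Poly_Mapping.keys F \<union> Poly_Mapping.keys H"
  have "Poly_Mapping.keys (F + H) \<subseteq> ?K" by (rule keys_add)
  then show ?thesis
    by (simp add: partial_superset[of ?K] lookup_add distrib_left sum.distrib single_add)
qed

lemma partial_0 [simp]: "partial i 0 = 0"
  by (simp add: partial_def)

lemma partial_sum: "partial i (sum f I) = (\<Sum>j\<in>I. partial i (f j))"
  for f :: "'k \<Rightarrow> 'a::comm_semiring_1 poly3"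
  by (induction I rule: infinite_finite_induct) (simp_all add: partial_add)

text \<open>The coefficientwise form avoids the truncated subtraction in \<open>partial\<close>: the
  exponents that truncation would confuse come with the factor 0.\<close>

lemma lookup_partial: "Poly_Mapping.lookup (partial i F) e =
    of_nat (Suc (Poly_Mapping.lookup e i)) * Poly_Mapping.lookup F (e + Poly_Mapping.single i 1)"
  for F :: "'a::comm_semiring_1 poly3"
proof (induction F rule: poly_mapping_additive_induct)
  case (single e' c)
  show ?case
  proof (cases "Poly_Mapping.lookup e' i = 0")
    case True
    then have "e' \<noteq> e + Poly_Mapping.single i 1"
      by (auto simp: lookup_add)
    with True show ?thesis by (simp add: partial_single lookup_single)
  next
    case False
    then have "e' = e' - Poly_Mapping.single i 1 + Poly_Mapping.single i 1"
      by (intro poly_mapping_eqI) (auto simp: lookup_add lookup_minus lookup_single when_def)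
    then have "e' - Poly_Mapping.single i 1 = e \<longleftrightarrow> e' = e + Poly_Mapping.single i 1"
      by (metis add_diff_cancel_right')
    then show ?thesis by (auto simp: partial_single lookup_single when_def lookup_add)
  qed
qed (simp add: partial_add lookup_add distrib_left)

lemma partial_mult: "partial i (F * H) = partial i F * H + F * partial i H"
  for F :: "'a::comm_semiring_1 poly3"
proof (induction F rule: poly_mapping_additive_induct)
  case (single e c)
  show ?case
  proof (induction H rule: poly_mapping_additive_induct)
    case (single f b)
    \<comment> \<open>Truncation is harmless: the shift is exact for a positive exponent, and for
      exponent 0 the coefficient in front is 0.\<close>
    have shift: "e - Poly_Mapping.single i 1 + f = e + f - Poly_Mapping.single i 1"
      if "Poly_Mapping.lookup e i \<noteq> 0" for e f :: "3 \<Rightarrow>\<^sub>0 nat"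
      using that by (intro poly_mapping_eqI) (auto simp: lookup_add lookup_minus lookup_single when_def)
    have l: "Poly_Mapping.single (e - Poly_Mapping.single i 1 + f) (of_nat (Poly_Mapping.lookup e i) * c * b)
        = Poly_Mapping.single (e + f - Poly_Mapping.single i 1) (of_nat (Poly_Mapping.lookup e i) * c * b)"
      using shift[of e f] by (cases "Poly_Mapping.lookup e i = 0") auto
    have r: "Poly_Mapping.single (e + (f - Poly_Mapping.single i 1)) (c * (of_nat (Poly_Mapping.lookup f i) * b))
        = Poly_Mapping.single (e + f - Poly_Mapping.single i 1) (of_nat (Poly_Mapping.lookup f i) * c * b)"
      using shift[of f e] by (cases "Poly_Mapping.lookup f i = 0") (auto simp: ac_simps)
    show ?case
      unfolding mult_single partial_single l r
      by (simp add: lookup_add algebra_simps flip: single_add)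
  qed (simp add: partial_add algebra_simps)
qed (simp add: partial_add algebra_simps)

lemma partial_Const [simp]: "partial i (Const c) = 0"
  for c :: "'a::comm_semiring_1"
  by (simp add: Const_def partial_single)

lemma partial_Var: "partial i (Var j :: 'a::comm_semiring_1 poly3) = (if i = j then 1 else 0)"
  by (auto simp: Var_def partial_single lookup_single when_def)

lemma partial_power: "partial i (F ^ n) = of_nat n * F ^ (n - 1) * partial i F"
  for F :: "'a::comm_semiring_1 poly3"
proof (induction n)
  case 0
  show ?case using partial_Const[of i "1::'a"] by (simp del: partial_Const)
next
  case (Suc n)
  then show ?case by (cases n) (simp_all add: partial_mult algebra_simps)
qed

lemma partial_linear_form: "partial j (linear_form A i) = Const (A $ i $ j)"
  by (simp add: linear_form_def partial_sum partial_mult partial_Var if_distrib cong: if_cong)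

lemma Const_of_nat: "Const (of_nat n) = (of_nat n :: 'a::comm_semiring_1 poly3)"
  by (simp add: Const_def)

text \<open>The chain rule: the gradient of \<open>v \<mapsto> F (A v)\<close> is the transpose of
  \<open>A\<close> applied to the gradient of \<open>F\<close> at \<open>A v\<close>. For a monomial
  it is the product rule for three powers of linear forms.\<close>

lemma partial_lin_subst:
  "partial j (lin_subst F A) = (\<Sum>i\<in>UNIV. Const (A $ i $ j) * lin_subst (partial i F) A)"
proof (induction F rule: poly_mapping_additive_induct)
  case (single e c)
  show ?case
    by (simp add: lin_subst_single partial_single prod_UNIV_3 sum_3 partial_mult partial_power
      partial_linear_form lookup_minus lookup_single when_def Const_mult Const_of_nat algebra_simps)
qed (simp add: lin_subst_add partial_add distrib_left sum.distrib)

section \<open>Homogeneous polynomials\<close>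

lemma homogeneousD: "homogeneous n F \<Longrightarrow> e \<in> Poly_Mapping.keys F \<Longrightarrow> (\<Sum>i\<in>UNIV. Poly_Mapping.lookup e i) = n"
  by (simp add: homogeneous_def)

lemma homogeneous_0 [simp]: "homogeneous n 0"
  by (simp add: homogeneous_def)

lemma homogeneous_add: "homogeneous n F \<Longrightarrow> homogeneous n H \<Longrightarrow> homogeneous n (F + H)"
  for F :: "'a::comm_semiring_1 poly3"
  unfolding homogeneous_def using keys_add[of F H] by blast

lemma homogeneous_sum: "(\<And>i. i \<in> I \<Longrightarrow> homogeneous n (f i)) \<Longrightarrow> homogeneous n (sum f I)"
  for f :: "'k \<Rightarrow> 'a::comm_semiring_1 poly3"
  by (induction I rule: infinite_finite_induct) (auto intro: homogeneous_add)

lemma homogeneous_mult: "homogeneous n F \<Longrightarrow> homogeneous k H \<Longrightarrow> homogeneous (n + k) (F * H)"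
  for F :: "'a::comm_semiring_1 poly3"
  unfolding homogeneous_def using keys_mult[of F H]
  by (auto simp: lookup_add sum.distrib dest!: subsetD)

lemma homogeneous_Const: "homogeneous 0 (Const c)"
  by (simp add: homogeneous_def Const_def)

lemma homogeneous_Var: "homogeneous 1 (Var i :: 'a::comm_semiring_1 poly3)"
  by (simp add: homogeneous_def Var_def lookup_single when_def)

lemma homogeneous_power: "homogeneous n F \<Longrightarrow> homogeneous (k * n) (F ^ k)"
  for F :: "'a::comm_semiring_1 poly3"
proof (induction k)
  case 0
  show ?case using homogeneous_Const[of "1::'a"] by simp
qed (simp add: homogeneous_mult)

lemma homogeneous_linear_form: "homogeneous 1 (linear_form A i)"
  unfolding linear_form_def
  using homogeneous_mult[OF homogeneous_Const homogeneous_Var] by (intro homogeneous_sum) simp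

lemma homogeneous_lin_subst:
  assumes "homogeneous n F"
  shows "homogeneous n (lin_subst F A)"
  unfolding lin_subst_def linear_form_def[symmetric]
proof (rule homogeneous_sum)
  fix e assume "e \<in> Poly_Mapping.keys F"
  then have n: "Poly_Mapping.lookup e 1 + Poly_Mapping.lookup e 2 + Poly_Mapping.lookup e 3 = n"
    using assms by (auto dest: homogeneousD simp: sum_3)
  have p: "homogeneous k (linear_form A i ^ k)" for i k
    using homogeneous_power[OF homogeneous_linear_form] by (metis mult.right_neutral)
  have "homogeneous (0 + (Poly_Mapping.lookup e 1 + Poly_Mapping.lookup e 2 + Poly_Mapping.lookup e 3))
     (Const (Poly_Mapping.lookup F e) * (\<Prod>i\<in>UNIV. linear_form A i ^ Poly_Mapping.lookup e i))"
    unfolding prod_UNIV_3 by (intro homogeneous_mult homogeneous_Const p)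
  then show "homogeneous n
     (Const (Poly_Mapping.lookup F e) * (\<Prod>i\<in>UNIV. linear_form A i ^ Poly_Mapping.lookup e i))"
    by (simp add: n)
qed

lemma homogeneous_partial:
  fixes F :: "'a::comm_semiring_1 poly3"
  assumes "homogeneous n F"
  shows "homogeneous (n - 1) (partial i F)"
  unfolding homogeneous_def
proof
  fix e assume "e \<in> Poly_Mapping.keys (partial i F)"
  then have "e + Poly_Mapping.single i 1 \<in> Poly_Mapping.keys F"
    by (auto simp: in_keys_iff lookup_partial)
  from homogeneousD[OF assms this] show "(\<Sum>i\<in>UNIV. Poly_Mapping.lookup e i) = n - 1"
    by (auto simp: lookup_add sum.distrib lookup_single when_def)
qed

lemma homogeneous_single_if:
  fixes e :: "3 \<Rightarrow>\<^sub>0 nat"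
  assumes "(\<Sum>l\<in>UNIV. Poly_Mapping.lookup e l) = n" "\<And>l. l \<noteq> i \<Longrightarrow> Poly_Mapping.lookup e l = 0"
  shows "e = Poly_Mapping.single i n"
proof -
  have "n = (\<Sum>l\<in>UNIV. if l = i then Poly_Mapping.lookup e i else 0)"
    unfolding assms(1)[symmetric] by (rule sum.cong) (auto simp: assms(2))
  then have "Poly_Mapping.lookup e i = n" by simp
  then show ?thesis
    by (intro poly_mapping_eqI) (auto simp: lookup_single when_def assms(2))
qed

text \<open>Every other monomial of degree \<open>n\<close> contains a variable that vanishes at the
  \<open>i\<close>-th reference point. Hence that point lies on the curve iff the coefficient of the
  pure power is 0.\<close>

lemma eval3_axis:
  fixes F :: "'a::comm_semiring_1 poly3"
  assumes "homogeneous n F"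
  shows "eval3 F (axis i 1) = Poly_Mapping.lookup F (Poly_Mapping.single i n)"
proof -
  have "Poly_Mapping.lookup F e * (\<Prod>l\<in>UNIV. (axis i 1 :: 'a^3) $ l ^ Poly_Mapping.lookup e l) =
        (if e = Poly_Mapping.single i n then Poly_Mapping.lookup F e else 0)"
    if e: "e \<in> Poly_Mapping.keys F" for e
  proof (cases "e = Poly_Mapping.single i n")
    case True
    then have "(\<Prod>l\<in>UNIV. (axis i 1 :: 'a^3) $ l ^ Poly_Mapping.lookup e l) = 1"
      by (intro prod.neutral) (auto simp: axis_def lookup_single when_def)
    with True show ?thesis by simp
  next
    case False
    then obtain l where "l \<noteq> i" "Poly_Mapping.lookup e l \<noteq> 0"
      using homogeneous_single_if[OF homogeneousD[OF assms e]] by blast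
    then have "(\<Prod>l\<in>UNIV. (axis i 1 :: 'a^3) $ l ^ Poly_Mapping.lookup e l) = 0"
      by (intro prod_zero) (auto simp: axis_def intro!: exI[of _ l] zero_power)
    with False show ?thesis by simp
  qed
  then have "eval3 F (axis i 1) = (\<Sum>e\<in>Poly_Mapping.keys F.
     if e = Poly_Mapping.single i n then Poly_Mapping.lookup F e else 0)"
    unfolding eval3_def by (rule sum.cong[OF refl])
  then show ?thesis by (simp add: in_keys_iff)
qed

text \<open>On the line \<open>F\<close> is a binary form. Either the pure power of the
  \<open>j\<close>-th variable is absent and the \<open>j\<close>-th reference point is a zero, or
  setting the \<open>k\<close>-th variable to 1 leaves a nonconstant polynomial in one variable,
  which has a root.\<close>

lemma homogeneous_zero_on_line:
  fixes F :: "'a::alg_closed_field poly3"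
  assumes hom: "homogeneous n F" and "0 < n"
  obtains v where "v \<noteq> 0" "v $ i = 0" "eval3 F v = 0"
proof -
  obtain j k where jk: "i \<noteq> j" "j \<noteq> k" "i \<noteq> k"
    by (rule other_indices_3)
  note sum_ijk = sum_prod_UNIV_3_distinct(1)[OF jk] and prod_ijk = sum_prod_UNIV_3_distinct(2)[OF jk]
  show thesis
  proof (cases "Poly_Mapping.lookup F (Poly_Mapping.single j n) = 0")
    case True
    then have "eval3 F (axis j 1) = 0" by (simp add: eval3_axis[OF hom])
    with jk show thesis by (intro that[of "axis j 1"]) (auto simp: axis_def vec_eq_iff)
  next
    case False
    let ?l = "Poly_Mapping.lookup"
    define v :: "'a \<Rightarrow> 'a^3" where "v x = (\<chi> l. if l = i then 0 else if l = j then x else 1)" for x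
    define p where "p = (\<Sum>e\<in>{e\<in>Poly_Mapping.keys F. ?l e i = 0}. Polynomial.monom (?l F e) (?l e j))"
    \<comment> \<open>By homogeneity only the pure power of the \<open>j\<close>-th variable
      contributes in degree \<open>n\<close>, so nothing can cancel the top coefficient of
      \<open>p\<close>.\<close>
    have "Polynomial.coeff p n = (\<Sum>e\<in>{e\<in>Poly_Mapping.keys F. ?l e i = 0}. if e = Poly_Mapping.single j n then ?l F e else 0)"
      unfolding p_def coeff_sum
    proof (rule sum.cong[OF refl])
      fix e assume e: "e \<in> {e\<in>Poly_Mapping.keys F. ?l e i = 0}"
      have "?l e j = n \<longleftrightarrow> e = Poly_Mapping.single j n"
      proof (rule iffI)
        assume ej: "?l e j = n"
        show "e = Poly_Mapping.single j n"
        proof (rule homogeneous_single_if)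
          show s: "(\<Sum>l\<in>UNIV. ?l e l) = n" using e homogeneousD[OF hom] by auto
          show "?l e l = 0" if "l \<noteq> j" for l
            using s ej jk that e UNIV_3_distinct[OF jk] by (auto simp: sum_ijk)
        qed
      qed simp
      then show "Polynomial.coeff (Polynomial.monom (?l F e) (?l e j)) n = (if e = Poly_Mapping.single j n then ?l F e else 0)"
        by simp
    qed
    also have "\<dots> \<noteq> 0" using False jk by (simp add: in_keys_iff lookup_single)
    finally have "Polynomial.degree p > 0" using \<open>0 < n\<close> le_degree by fastforce
    then obtain x where x: "poly p x = 0" using alg_closed_imp_poly_has_root by blast
    have "eval3 F (v x) = (\<Sum>e\<in>Poly_Mapping.keys F. if ?l e i = 0 then ?l F e * x ^ ?l e j else 0)"
      unfolding eval3_def by (rule sum.cong) (use jk in \<open>auto simp: v_def prod_ijk zero_power\<close>)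
    also have "\<dots> = (\<Sum>e\<in>{e\<in>Poly_Mapping.keys F. ?l e i = 0}. ?l F e * x ^ ?l e j)"
      by (rule sum.inter_filter[symmetric]) simp
    also have "\<dots> = poly p x" by (simp add: p_def poly_sum poly_monom)
    finally have "eval3 F (v x) = 0" using x by simp
    moreover have "v x $ k = 1" "v x $ i = 0" using jk by (auto simp: v_def)
    then have "v x \<noteq> 0" by auto
    ultimately show thesis using that \<open>v x $ i = 0\<close> by blast
  qed
qed

section \<open>Nonsingularity\<close>

text \<open>A singular point \<open>v\<close> of the transform yields the singular point
  \<open>A *v v\<close>: by the chain rule the gradient at \<open>v\<close> is the transpose of
  \<open>A\<close> applied to the gradient \<open>g\<close> at \<open>A *v v\<close>, and that
  transpose is injective.\<close>

lemma nonsingular_lin_subst: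
  fixes F :: "'a::field poly3"
  assumes "nonsingular F" "invertible A"
  shows "nonsingular (lin_subst F A)"
  unfolding nonsingular_def
proof
  assume "\<exists>v. v \<noteq> 0 \<and> eval3 (lin_subst F A) v = 0 \<and> (\<forall>i. eval3 (partial i (lin_subst F A)) v = 0)"
  then obtain v where v: "v \<noteq> 0" "eval3 F (A *v v) = 0"
    and sing: "\<And>i. eval3 (partial i (lin_subst F A)) v = 0"
    by (auto simp: eval3_lin_subst)
  obtain B where B: "B ** A = mat 1" "A ** B = mat 1"
    using assms(2) by (auto simp: invertible_def)
  have "A *v v \<noteq> 0"
    using B(1) v(1) by (metis matrix_vector_mul_assoc matrix_vector_mul_lid matrix_vector_mult_0_right)
  define g :: "'a^3" where "g = (\<chi> i. eval3 (partial i F) (A *v v))"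
  have "eval3 (partial j (lin_subst F A)) v = (\<Sum>i\<in>UNIV. A $ i $ j * g $ i)" for j
    by (simp add: partial_lin_subst eval3_evalp id_hom.evalp_sum id_hom.evalp_mult
        id_hom.evalp_Const g_def) (simp flip: eval3_evalp add: eval3_lin_subst)
  then have "transpose A *v g = 0"
    using sing by (simp add: vec_eq_iff matrix_vector_mult_def transpose_def)
  moreover have "transpose B ** transpose A = mat 1"
    using B(2) by (metis matrix_transpose_mul transpose_mat)
  ultimately have "g = 0"
    by (metis matrix_vector_mul_assoc matrix_vector_mul_lid matrix_vector_mult_0_right)
  then have "\<forall>i. eval3 (partial i F) (A *v v) = 0"
    by (simp add: g_def vec_eq_iff)
  with \<open>A *v v \<noteq> 0\<close> v(2) assms(1) show False by (auto simp: nonsingular_def)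
qed

text \<open>Up to positive integer factors these coefficients are the partial derivatives of
  \<open>F\<close> at the \<open>i\<close>-th reference point, and the one for \<open>k = i\<close>
  is also the value of \<open>F\<close> there. If all were 0, the point would be singular.\<close>

lemma nonsingular_monomial_at_ref_point:
  fixes F :: "'a::field_char_0 poly3"
  assumes "nonsingular F" "homogeneous d F" "0 < d"
  obtains k where "Poly_Mapping.lookup F (Poly_Mapping.single i (d - 1) + Poly_Mapping.single k 1) \<noteq> 0"
proof (rule ccontr)
  assume c: "\<not> thesis"
  have z: "Poly_Mapping.lookup F (Poly_Mapping.single i (d - 1) + Poly_Mapping.single k 1) = 0" for k
    using c that by blast
  have "eval3 (partial k F) (axis i 1) = 0" for k
    by (simp add: eval3_axis[OF homogeneous_partial[OF assms(2)]] lookup_partial z[simplified])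
  moreover have "eval3 F (axis i 1) = 0"
    using z[of i] \<open>0 < d\<close> by (simp add: eval3_axis[OF assms(2)] flip: single_add)
  moreover have "axis i 1 \<noteq> (0 :: 'a^3)" by (auto simp: axis_def vec_eq_iff)
  ultimately show False using assms(1) by (auto simp: nonsingular_def)
qed

text \<open>If every monomial contained the \<open>i\<close>-th variable, then on the line where it
  vanishes \<open>F\<close> and all derivatives except \<open>partial i F\<close> would be 0. That
  derivative has positive degree \<open>d - 1\<close>, so it has a zero on the line, and this zero
  would be singular.\<close>

lemma nonsingular_not_divisible_by_Var:
  fixes F :: "'a::alg_closed_field poly3"
  assumes "nonsingular F" "homogeneous d F" "2 \<le> d"
  obtains e where "e \<in> Poly_Mapping.keys F" "Poly_Mapping.lookup e i = 0"
proof (rule ccontr)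
  assume c: "\<not> thesis"
  note goal = that
  have pos: "Poly_Mapping.lookup e i \<noteq> 0" if "e \<in> Poly_Mapping.keys F" for e
    using c goal that by blast
  have vanish: "eval3 H v = 0" if "\<And>e. e \<in> Poly_Mapping.keys H \<Longrightarrow> Poly_Mapping.lookup e i \<noteq> 0" "v $ i = 0"
    for H and v :: "'a^3"
    unfolding eval3_def
  proof (rule sum.neutral, rule ballI)
    fix e assume "e \<in> Poly_Mapping.keys H"
    then have "v $ i ^ Poly_Mapping.lookup e i = 0"
      using that by (simp add: zero_power)
    then have "(\<Prod>l\<in>UNIV. v $ l ^ Poly_Mapping.lookup e l) = 0"
      by (intro prod_zero bexI[of _ i]) auto
    then show "Poly_Mapping.lookup H e * (\<Prod>l\<in>UNIV. v $ l ^ Poly_Mapping.lookup e l) = 0" by simp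
  qed
  obtain v where v: "v \<noteq> 0" "v $ i = 0" "eval3 (partial i F) v = 0"
    using homogeneous_zero_on_line[OF homogeneous_partial[OF assms(2), of i], of i] assms(3) by auto
  have "eval3 (partial k F) v = 0" for k
  proof (cases "k = i")
    case False
    show ?thesis
    proof (rule vanish)
      fix e assume "e \<in> Poly_Mapping.keys (partial k F)"
      then have "e + Poly_Mapping.single k 1 \<in> Poly_Mapping.keys F"
        by (auto simp: in_keys_iff lookup_partial)
      from pos[OF this] False show "Poly_Mapping.lookup e i \<noteq> 0"
        by (simp add: lookup_add lookup_single)
    qed fact
  qed (use v in simp)
  moreover have "eval3 F v = 0" by (rule vanish) (use pos v in auto)
  ultimately show False using assms(1) v(1) by (auto simp: nonsingular_def)
qed

section \<open>Monomial changes of coordinates\<close>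

text \<open>As a substitution it replaces the variable \<open>i\<close> by \<open>s i\<close> times
  the variable \<open>\<tau> i\<close>. Permutations, rescalings and diagonal matrices all have this
  form, so one coefficient formula serves them all.\<close>

definition monomial_matrix :: "(3 \<Rightarrow> 3) \<Rightarrow> (3 \<Rightarrow> 'a::zero) \<Rightarrow> 'a^3^3" where
  "monomial_matrix \<tau> s = (\<chi> i j. if j = \<tau> i then s i else 0)"

lemma linear_form_monomial_matrix:
  "linear_form (monomial_matrix \<tau> s) i = Poly_Mapping.single (Poly_Mapping.single (\<tau> i) 1) (s i)"
proof -
  have "linear_form (monomial_matrix \<tau> s) i = (\<Sum>j\<in>UNIV. if j = \<tau> i then Const (s i) * Var j else 0)"
    unfolding linear_form_def by (rule sum.cong) (auto simp: monomial_matrix_def)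
  then show ?thesis by (simp add: Const_def Var_def mult_single)
qed

lemma single_power: "Poly_Mapping.single (Poly_Mapping.single i k) x ^ n =
    Poly_Mapping.single (Poly_Mapping.single i (n * k)) (x ^ n)"
  for x :: "'a::comm_semiring_1" and k :: nat
  by (induction n) (simp_all add: mult_single add.commute flip: single_add)

text \<open>Monomials go to multiples of monomials. The exponent vector \<open>f\<close> is carried
  to the \<open>e\<close> with \<open>e (\<tau> i) = f i\<close>, so the source of \<open>e\<close>
  is its composition with \<open>\<tau>\<close>, that is \<open>map_key \<tau> e\<close>.\<close>

lemma lookup_lin_subst_monomial_matrix:
  assumes "inj \<tau>"
  shows "Poly_Mapping.lookup (lin_subst F (monomial_matrix \<tau> s)) e =
    (\<Prod>i\<in>UNIV. s i ^ Poly_Mapping.lookup e (\<tau> i)) * Poly_Mapping.lookup F (Poly_Mapping.map_key \<tau> e)"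
proof (induction F rule: poly_mapping_additive_induct)
  case (single f c)
  let ?l = "Poly_Mapping.lookup"
  let ?f = "Poly_Mapping.single (\<tau> 1) (?l f 1) + Poly_Mapping.single (\<tau> 2) (?l f 2) + Poly_Mapping.single (\<tau> 3) (?l f 3)"
  have b: "bij \<tau>" using assms by (simp add: finite_UNIV_inj_surj bij_def)
  have lf: "?l ?f (\<tau> i) = ?l f i" for i
    using exhaust_3[of i] assms by (auto simp: lookup_add lookup_single when_def inj_eq)
  have iff: "?f = e \<longleftrightarrow> f = Poly_Mapping.map_key \<tau> e"
  proof
    assume "?f = e"
    then have "?l f i = ?l e (\<tau> i)" for i using lf by metis
    then show "f = Poly_Mapping.map_key \<tau> e"
      by (intro poly_mapping_eqI) (simp add: map_key.rep_eq assms)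
  next
    assume f: "f = Poly_Mapping.map_key \<tau> e"
    have "?l ?f (\<tau> i) = ?l e (\<tau> i)" for i
      unfolding lf by (simp add: map_key.rep_eq assms f)
    then show "?f = e"
      by (intro poly_mapping_eqI) (metis b bij_is_surj surjD)
  qed
  have "lin_subst (Poly_Mapping.single f c) (monomial_matrix \<tau> s) =
     Poly_Mapping.single ?f (c * (\<Prod>i\<in>UNIV. s i ^ ?l f i))"
    by (simp add: lin_subst_single linear_form_monomial_matrix single_power prod_UNIV_3 mult_single
        Const_def ac_simps)
  then show ?case
    by (cases "?f = e") (auto simp: lookup_single iff mult.commute map_key.rep_eq assms)
qed (simp add: lin_subst_add lookup_add distrib_left)

section \<open>The projective linear group\<close>

lemma pgl_mem_iff: "B \<in> pgl A \<longleftrightarrow> (\<exists>c. c \<noteq> 0 \<and> B = mat c ** A)"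
  for A :: "'a::field^3^3"
  by (auto simp: pgl_def r_coset_def scalars3_def GL3_def)

lemma pgl_self: "A \<in> pgl A"
  for A :: "'a::field^3^3"
  unfolding pgl_mem_iff by (intro exI[of _ 1]) simp

lemma pgl_closed: "invertible A \<Longrightarrow> pgl A \<in> carrier PGL3"
  by (auto simp: PGL3_def carrier_FactGroup pgl_def GL3_def)

lemma PGL3_carrierE:
  assumes "g \<in> carrier PGL3"
  obtains A where "invertible A" "g = pgl A"
  using assms by (auto simp: PGL3_def carrier_FactGroup pgl_def GL3_def)

lemma pgl_mult: "invertible A \<Longrightarrow> invertible B \<Longrightarrow> pgl A \<otimes>\<^bsub>PGL3\<^esub> pgl B = pgl (A ** B)"
  using normal.rcos_sum[OF normal_scalars3, of A B]
  by (simp add: PGL3_def pgl_def GL3_def)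

lemma pgl_scalar_mult:
  fixes A :: "'a::field^3^3"
  assumes "c \<noteq> 0"
  shows "pgl (mat c ** A) = pgl A"
proof -
  have "B \<in> pgl (mat c ** A) \<longleftrightarrow> B \<in> pgl A" for B
  proof -
    have "mat x ** (mat c ** A) = mat (x * c) ** A" "mat x ** A = mat (x / c) ** (mat c ** A)" for x
      using assms by (simp_all add: matrix_mul_assoc mat_mult_mat)
    with assms show ?thesis unfolding pgl_mem_iff
      by (metis divide_eq_0_iff mult_eq_0_iff)
  qed
  then show ?thesis by blast
qed

lemma pgl_mat_1: "pgl (mat 1) = \<one>\<^bsub>PGL3\<^esub>"
  unfolding PGL3_def by (auto simp: pgl_def r_coset_def GL3_def)

lemma pgl_eq_one_iff:
  fixes A :: "'a::field^3^3"
  shows "pgl A = \<one>\<^bsub>PGL3\<^esub> \<longleftrightarrow> (\<exists>c. c \<noteq> 0 \<and> A = mat c)"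
proof
  assume "pgl A = \<one>\<^bsub>PGL3\<^esub>"
  then show "\<exists>c. c \<noteq> 0 \<and> A = mat c"
    using pgl_self[of A] by (auto simp: pgl_mem_iff simp flip: pgl_mat_1)
next
  assume "\<exists>c. c \<noteq> 0 \<and> A = mat c"
  then show "pgl A = \<one>\<^bsub>PGL3\<^esub>"
    using pgl_scalar_mult[of _ "mat 1 :: 'a^3^3"] by (auto simp: pgl_mat_1)
qed

primrec mat_power :: "'a::semiring_1^'n^'n \<Rightarrow> nat \<Rightarrow> 'a^'n^'n" where
  "mat_power A 0 = mat 1"
| "mat_power A (Suc n) = A ** mat_power A n"

lemma invertible_mat_power: "invertible A \<Longrightarrow> invertible (mat_power A n)"
  for A :: "'a::field^3^3"
  by (induction n) (simp_all add: invertible_mult invertible_mat)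

lemma pgl_power:
  assumes "invertible A"
  shows "pgl A [^]\<^bsub>PGL3\<^esub> (n::nat) = pgl (mat_power A n)"
proof (induction n)
  case 0
  show ?case by (simp add: pgl_mat_1 nat_pow_def)
next
  case (Suc n)
  interpret group "PGL3 :: ('a^3^3) set monoid" by (rule group_PGL3)
  show ?case
    unfolding nat_pow_Suc2[OF pgl_closed[OF assms]] Suc
    by (simp add: pgl_mult assms invertible_mat_power)
qed

lemma mat_power_scalar_mult: "mat_power (mat z ** A) n = mat (z ^ n) ** mat_power A n"
  for A :: "'a::field^3^3"
proof (induction n)
  case (Suc n)
  have "mat_power (mat z ** A) (Suc n) = mat z ** (A ** mat (z ^ n)) ** mat_power A n"
    by (simp add: Suc matrix_mul_assoc)
  also have "A ** mat (z ^ n) = mat (z ^ n) ** A"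
    by (simp only: mat_mult_left mat_mult_right)
  finally show ?case by (simp add: matrix_mul_assoc mat_mult_mat)
qed simp

lemma conj_by_generate:
  fixes x :: "('a::field^3^3) set"
  assumes "invertible P" "x \<in> carrier PGL3"
  shows "conj_by P (generate PGL3 {x}) =
    generate PGL3 {inv\<^bsub>PGL3\<^esub> (pgl P) \<otimes>\<^bsub>PGL3\<^esub> x \<otimes>\<^bsub>PGL3\<^esub> pgl P}"
proof -
  interpret group "PGL3 :: ('a^3^3) set monoid" by (rule group_PGL3)
  note p = pgl_closed[OF assms(1)]
  let ?h = "\<lambda>g. inv\<^bsub>PGL3\<^esub> (pgl P) \<otimes>\<^bsub>PGL3\<^esub> g \<otimes>\<^bsub>PGL3\<^esub> pgl P"
  have "?h \<in> hom PGL3 PGL3"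
  proof (rule homI)
    fix g h :: "('a^3^3) set" assume g: "g \<in> carrier PGL3" and h: "h \<in> carrier PGL3"
    show "?h g \<in> carrier PGL3" using p g by simp
    have "pgl P \<otimes>\<^bsub>PGL3\<^esub> (inv\<^bsub>PGL3\<^esub> pgl P \<otimes>\<^bsub>PGL3\<^esub> y) = y" if "y \<in> carrier PGL3" for y
      using p that by (simp flip: m_assoc)
    then show "?h (g \<otimes>\<^bsub>PGL3\<^esub> h) = ?h g \<otimes>\<^bsub>PGL3\<^esub> ?h h"
      using p g h by (simp add: m_assoc)
  qed
  then interpret group_hom PGL3 PGL3 ?h
    by unfold_locales
  show ?thesis
    using generate_img[of "{x}"] assms(2) by (simp add: conj_by_def)
qed

lemma conj_by_conj_by:
  fixes G :: "('a::field^3^3) set set"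
  assumes "invertible P" "invertible Q" "G \<subseteq> carrier PGL3"
  shows "conj_by Q (conj_by P G) = conj_by (P ** Q) G"
proof -
  interpret group "PGL3 :: ('a^3^3) set monoid" by (rule group_PGL3)
  note p = pgl_closed[OF assms(1)] and q = pgl_closed[OF assms(2)]
  show ?thesis
    unfolding conj_by_def image_image
  proof (rule image_cong[OF refl])
    fix g assume "g \<in> G"
    then have "g \<in> carrier PGL3" using assms(3) by blast
    then show "inv\<^bsub>PGL3\<^esub> pgl Q \<otimes>\<^bsub>PGL3\<^esub> (inv\<^bsub>PGL3\<^esub> pgl P \<otimes>\<^bsub>PGL3\<^esub> g \<otimes>\<^bsub>PGL3\<^esub> pgl P) \<otimes>\<^bsub>PGL3\<^esub> pgl Q
      = inv\<^bsub>PGL3\<^esub> pgl (P ** Q) \<otimes>\<^bsub>PGL3\<^esub> g \<otimes>\<^bsub>PGL3\<^esub> pgl (P ** Q)"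
      using p q by (simp add: inv_mult_group m_assoc flip: pgl_mult[OF assms(1,2)])
  qed
qed

lemma card_conj_by:
  fixes G :: "('a::field^3^3) set set"
  assumes "invertible P" "G \<subseteq> carrier PGL3"
  shows "card (conj_by P G) = card G"
proof -
  interpret group "PGL3 :: ('a^3^3) set monoid" by (rule group_PGL3)
  note p = pgl_closed[OF assms(1)]
  have "inj_on (\<lambda>g. inv\<^bsub>PGL3\<^esub> (pgl P) \<otimes>\<^bsub>PGL3\<^esub> g \<otimes>\<^bsub>PGL3\<^esub> pgl P) G"
  proof (rule inj_onI)
    fix g h assume "g \<in> G" "h \<in> G"
      and e: "inv\<^bsub>PGL3\<^esub> (pgl P) \<otimes>\<^bsub>PGL3\<^esub> g \<otimes>\<^bsub>PGL3\<^esub> pgl P = inv\<^bsub>PGL3\<^esub> (pgl P) \<otimes>\<^bsub>PGL3\<^esub> h \<otimes>\<^bsub>PGL3\<^esub> pgl P"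
    then have "g \<in> carrier PGL3" "h \<in> carrier PGL3" using assms(2) by auto
    with e p show "g = h" by simp
  qed
  then show ?thesis by (simp add: conj_by_def card_image)
qed

lemma conj_pgl:
  fixes A :: "'a::field^3^3"
  assumes "invertible P" "invertible A" "invertible D" "A ** P = P ** D"
  shows "inv\<^bsub>PGL3\<^esub> (pgl P) \<otimes>\<^bsub>PGL3\<^esub> pgl A \<otimes>\<^bsub>PGL3\<^esub> pgl P = pgl D"
proof -
  interpret group "PGL3 :: ('a^3^3) set monoid" by (rule group_PGL3)
  note p = pgl_closed[OF assms(1)] and a = pgl_closed[OF assms(2)] and d = pgl_closed[OF assms(3)]
  have "pgl A \<otimes>\<^bsub>PGL3\<^esub> pgl P = pgl P \<otimes>\<^bsub>PGL3\<^esub> pgl D"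
    using assms by (simp add: pgl_mult)
  then have "inv\<^bsub>PGL3\<^esub> (pgl P) \<otimes>\<^bsub>PGL3\<^esub> pgl A \<otimes>\<^bsub>PGL3\<^esub> pgl P
      = inv\<^bsub>PGL3\<^esub> (pgl P) \<otimes>\<^bsub>PGL3\<^esub> (pgl P \<otimes>\<^bsub>PGL3\<^esub> pgl D)"
    using p a by (simp add: m_assoc)
  also have "\<dots> = pgl D" using p d by (simp flip: m_assoc)
  finally show ?thesis .
qed

section \<open>Roots of unity and diagonalisation\<close>

lemma primitive_root_nonzero: "primitive_root_of_unity m \<zeta> \<Longrightarrow> \<zeta> \<noteq> 0"
  by (auto simp: primitive_root_of_unity_def power_0_left)

text \<open>Translates equations between powers of \<open>\<zeta>\<close> into congruences between
  exponents, the form in which the action is handled afterwards.\<close>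

lemma primitive_root_power_eq_iff:
  fixes \<zeta> :: "'a::field"
  assumes "primitive_root_of_unity m \<zeta>"
  shows "\<zeta> ^ x = \<zeta> ^ y \<longleftrightarrow> [x = y] (mod m)"
proof -
  have m: "0 < m" "\<zeta> ^ m = 1" and prim: "\<And>k. 0 < k \<Longrightarrow> k < m \<Longrightarrow> \<zeta> ^ k \<noteq> 1"
    using assms by (auto simp: primitive_root_of_unity_def)
  note nz = primitive_root_nonzero[OF assms]
  have red: "\<zeta> ^ x = \<zeta> ^ (x mod m)" for x
  proof -
    have "\<zeta> ^ x = \<zeta> ^ (m * (x div m) + x mod m)" by simp
    also have "\<dots> = \<zeta> ^ (x mod m)" unfolding power_add power_mult m(2) by simp
    finally show ?thesis .
  qed
  have inj: "x = y" if "\<zeta> ^ x = \<zeta> ^ y" "x \<le> y" "y < m" for x y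
  proof (rule ccontr)
    assume "x \<noteq> y"
    have "\<zeta> ^ y = \<zeta> ^ x * \<zeta> ^ (y - x)"
      unfolding power_add[symmetric] using that(2) by simp
    then have "\<zeta> ^ (y - x) = 1" using that nz by simp
    moreover have "0 < y - x" "y - x < m" using \<open>x \<noteq> y\<close> that by linarith+
    ultimately show False using prim by blast
  qed
  show ?thesis
  proof
    assume "\<zeta> ^ x = \<zeta> ^ y"
    then have "\<zeta> ^ (x mod m) = \<zeta> ^ (y mod m)" using red by metis
    then show "[x = y] (mod m)"
      unfolding cong_def
      using inj[of "x mod m" "y mod m"] inj[of "y mod m" "x mod m"] \<open>0 < m\<close>
      by (cases "x mod m \<le> y mod m") auto
  next
    assume "[x = y] (mod m)"
    then show "\<zeta> ^ x = \<zeta> ^ y" using red[of x] red[of y] by (simp add: cong_def)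
  qed
qed

text \<open>Orthogonality of the characters of the cyclic group of order \<open>m\<close>, summed as
  a geometric series.\<close>

lemma sum_powers_root_of_unity:
  fixes \<zeta> :: "'a::field"
  assumes "primitive_root_of_unity m \<zeta>" "i < m"
  shows "(\<Sum>k<m. \<zeta> ^ (k * i)) = (if i = 0 then of_nat m else 0)"
proof (cases "i = 0")
  case False
  then have "\<zeta> ^ i \<noteq> 1" using assms by (auto simp: primitive_root_of_unity_def)
  moreover have "(\<zeta> ^ i) ^ m = 1"
    using assms(1) by (metis mult.commute power_mult power_one primitive_root_of_unity_def)
  ultimately have "(\<Sum>k<m. (\<zeta> ^ i) ^ k) = 0" by (simp add: geometric_sum)
  with False show ?thesis by (simp add: mult.commute flip: power_mult)
qed simp

lemma mat_power_vector_Suc: "A *v (mat_power A n *v v) = mat_power A (Suc n) *v v"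
  by (simp add: matrix_vector_mul_assoc)

text \<open>The vector \<open>v\<close> is the average of the vectors \<open>\<Sum>i<m. \<zeta>\<^sup>k\<^sup>i A\<^sup>i v\<close>, and these are eigenvectors.\<close>

lemma span_eigenvectors:
  fixes A :: "'a::field_char_0^'n^'n"
  assumes "primitive_root_of_unity m \<zeta>" "mat_power A m = mat 1"
  shows "vec.span {v. \<exists>k. A *v v = \<zeta> ^ k *s v} = UNIV"
proof -
  have m: "0 < m" "\<zeta> ^ m = 1" using assms(1) by (auto simp: primitive_root_of_unity_def)
  note nz = primitive_root_nonzero[OF assms(1)]
  let ?S = "{v. \<exists>k. A *v v = \<zeta> ^ k *s v}"
  have "v \<in> vec.span ?S" for v
  proof -
    define f where "f k i = \<zeta> ^ (k * i) *s (mat_power A i *v v)" for k i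
    define u where "u k = (\<Sum>i<m. f k i)" for k
    have "\<zeta> ^ k *s (A *v u k) = u k" for k
    proof -
      have "\<zeta> ^ k *s (A *v u k) = (\<Sum>i<m. f k (Suc i))"
        by (simp add: u_def f_def vec.sum vec.scale mat_power_vector_Suc vec.scale_sum_right power_add
            del: mat_power.simps)
      also have "\<dots> = (\<Sum>i<m. f k i) + f k m - f k 0"
        using sum.lessThan_Suc_shift[of "f k" m] by simp
      also have "f k m = f k 0"
      proof -
        have "\<zeta> ^ (k * m) = 1" using m(2) by (metis mult.commute power_mult power_one)
        then show ?thesis by (simp add: f_def assms(2))
      qed
      finally show ?thesis by (simp add: u_def)
    qed
    \<comment> \<open>The eigenvalue of \<open>u k\<close> is the inverse of
      \<open>\<zeta> ^ k\<close>, written with a natural exponent.\<close>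
    moreover have "\<zeta> ^ ((m - 1) * k) * \<zeta> ^ k = 1" for k
    proof -
      have "(m - 1) * k + k = m * k" using m(1) by (cases m) auto
      then show ?thesis using m(2) by (metis power_add power_mult power_one)
    qed
    ultimately have eig: "u k \<in> ?S" for k
      by (metis (mono_tags, lifting) mem_Collect_eq vector_smult_assoc vector_smult_lid)
    have "(\<Sum>k<m. u k) = (\<Sum>i<m. (\<Sum>k<m. \<zeta> ^ (k * i)) *s (mat_power A i *v v))"
      unfolding u_def f_def by (subst sum.swap) (simp add: vec.scale_sum_left)
    also have "\<dots> = (\<Sum>i<m. if i = 0 then of_nat m *s v else 0)"
      by (rule sum.cong) (auto simp: sum_powers_root_of_unity[OF assms(1)])
    also have "\<dots> = of_nat m *s v" using m(1) by simp
    finally have v: "(1 / of_nat m) *s (\<Sum>k<m. u k) = v"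
      using m(1) by (simp add: vector_smult_assoc)
    have "(\<Sum>k<m. u k) \<in> vec.span ?S"
      using eig by (intro vec.span_sum vec.span_base)
    then have "(1 / of_nat m) *s (\<Sum>k<m. u k) \<in> vec.span ?S"
      by (rule vec.span_scale)
    then show ?thesis unfolding v .
  qed
  then show ?thesis by blast
qed

section \<open>Products of monomial matrices and the eigenbasis\<close>

lemma monomial_matrix_mult:
  "monomial_matrix \<tau> s ** monomial_matrix \<sigma> r = monomial_matrix (\<sigma> \<circ> \<tau>) (\<lambda>i. s i * r (\<tau> i))"
  for s :: "3 \<Rightarrow> 'a::semiring_1"
proof -
  have "(\<Sum>k\<in>UNIV. (if k = \<tau> i then s i else 0) * (if j = \<sigma> k then r k else 0)) =
     (\<Sum>k\<in>UNIV. if k = \<tau> i then s i * (if j = \<sigma> k then r k else 0) else 0)" for i j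
    by (rule sum.cong) auto
  then show ?thesis
    by (auto simp: monomial_matrix_def matrix_matrix_mult_def vec_eq_iff)
qed

abbreviation diagonal_matrix :: "(3 \<Rightarrow> 'a::zero) \<Rightarrow> 'a^3^3" where
  "diagonal_matrix \<equiv> monomial_matrix (\<lambda>i. i)"

lemma mat_eq_diagonal_matrix: "mat c = diagonal_matrix (\<lambda>_. c)"
  by (auto simp: monomial_matrix_def mat_def vec_eq_iff)

lemma diag3_eq_diagonal_matrix: "diag3 (s 1) (s 2) (s 3) = diagonal_matrix s"
  by (simp add: monomial_matrix_def diag3_def vec_eq_iff forall_3)

lemma invertible_monomial_matrix:
  fixes s :: "3 \<Rightarrow> 'a::field"
  assumes "inj \<tau>" "\<And>i. s i \<noteq> 0"
  shows "invertible (monomial_matrix \<tau> s)"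
proof -
  have "bij \<tau>" using assms(1) by (simp add: finite_UNIV_inj_surj bij_def)
  then have i: "inv_into UNIV \<tau> (\<tau> x) = x" "\<tau> (inv_into UNIV \<tau> x) = x" for x
    by (simp_all add: bij_is_inj bij_is_surj surj_f_inv_f)
  show ?thesis
    unfolding invertible_def
    by (rule exI[of _ "monomial_matrix (inv_into UNIV \<tau>) (\<lambda>j. 1 / s (inv_into UNIV \<tau> j))"])
       (simp add: monomial_matrix_mult mat_eq_diagonal_matrix o_def i assms(2))
qed

lemma mat_power_diagonal_matrix: "mat_power (diagonal_matrix s) n = diagonal_matrix (\<lambda>i. s i ^ n)"
  for s :: "3 \<Rightarrow> 'a::semiring_1"
  by (induction n) (simp_all add: mat_eq_diagonal_matrix monomial_matrix_mult o_def)

text \<open>Eigenvectors whose eigenvalues are powers of \<open>\<zeta>\<close> span, so a maximal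
  independent set of them is a basis. Put into the columns of \<open>P\<close>, their eigenvalue
  equations become one matrix equation.\<close>

lemma diagonalisation:
  fixes A :: "'a::field_char_0^3^3"
  assumes "primitive_root_of_unity m \<zeta>" "mat_power A m = mat 1"
  obtains P w where "invertible P" "A ** P = P ** diagonal_matrix (\<lambda>i. \<zeta> ^ w i)"
proof -
  let ?S = "{v. \<exists>k. A *v v = \<zeta> ^ k *s v}"
  obtain B where B: "B \<subseteq> ?S" "vec.independent B" "?S \<subseteq> vec.span B"
    using vec.maximal_independent_subset[of ?S] by blast
  have span: "vec.span B = UNIV"
    using vec.span_minimal[OF B(3) vec.subspace_span] span_eigenvectors[OF assms] by blast
  have "card B = 3"
    using vec.basis_card_eq_dim[of B UNIV] B(2) span vec_dim_card[where 'a='a and 'n=3] by simp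
  then have "\<exists>f. bij_betw f (UNIV :: 3 set) B"
    by (intro finite_same_card_bij) (auto intro: card_ge_0_finite)
  then obtain f :: "3 \<Rightarrow> 'a^3" where f: "bij_betw f UNIV B" by blast
  then have "\<exists>k. A *v f i = \<zeta> ^ k *s f i" for i
    using B(1) by (auto simp: bij_betw_def)
  then obtain w where w: "\<And>i. A *v f i = \<zeta> ^ w i *s f i" by metis
  define P :: "'a^3^3" where "P = (\<chi> i j. f j $ i)"
  have col: "column j P = f j" for j
    by (simp add: column_def P_def vec_eq_iff)
  have "\<forall>i. c i = 0" if "(\<Sum>i\<in>UNIV. c i *s column i P) = 0" for c
  proof -
    have inj: "inj f" using f by (simp add: bij_betw_def)
    \<comment> \<open>Injectivity of \<open>f\<close> lets the sum over columns be read as a sum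
      over the set \<open>B\<close>; repeated columns, which a set would not notice, are thereby
      excluded.\<close>
    have "(\<Sum>b\<in>f ` UNIV. c (inv_into UNIV f b) *s b) = 0"
      using that inj by (simp add: sum.reindex col)
    then have comb: "(\<Sum>b\<in>B. c (inv_into UNIV f b) *s b) = 0" using f by (simp add: bij_betw_def)
    have "finite B" using bij_betw_finite[OF f] by simp
    then have "\<forall>b\<in>B. c (inv_into UNIV f b) = 0"
      using vec.independentD[OF B(2) _ order_refl comb] by blast
    then show ?thesis using f inj by (auto simp: bij_betw_def)
  qed
  then have "invertible P"
    unfolding invertible_left_inverse matrix_left_invertible_independent_columns by blast
  moreover have "A ** P = P ** diagonal_matrix (\<lambda>i. \<zeta> ^ w i)"
  proof -
    have "(\<Sum>k\<in>UNIV. f k $ i * (if j = k then \<zeta> ^ w k else 0)) = (\<Sum>k\<in>UNIV. if k = j then f j $ i * \<zeta> ^ w j else 0)" for i j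
      by (rule sum.cong) auto
    moreover have "(\<Sum>k\<in>UNIV. A $ i $ k * f j $ k) = \<zeta> ^ w j * f j $ i" for i j
      using arg_cong[OF w[of j], of "\<lambda>v. v $ i"] by (simp add: matrix_vector_mult_def)
    ultimately show ?thesis
      by (simp add: vec_eq_iff matrix_matrix_mult_def P_def monomial_matrix_def mult.commute)
  qed
  ultimately show thesis by (rule that)
qed

section \<open>Curves with a diagonal cyclic group\<close>

text \<open>
  The last condition says that the order of \<open>G\<close> is a multiple of \<open>m\<close>.
\<close>

definition diagonal_action ::
    "nat \<Rightarrow> nat \<Rightarrow> 'a::field \<Rightarrow> 'a poly3 \<Rightarrow> ('a^3^3) set set \<Rightarrow> (3 \<Rightarrow> nat) \<Rightarrow> bool" where
  "diagonal_action d m \<zeta> F G w \<longleftrightarrow>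
     homogeneous d F \<and> nonsingular F \<and>
     G = generate PGL3 {pgl (diagonal_matrix (\<lambda>i. \<zeta> ^ w i))} \<and>
     (\<exists>c. \<forall>e\<in>Poly_Mapping.keys F. [(\<Sum>i\<in>UNIV. w i * Poly_Mapping.lookup e i) = c] (mod m)) \<and>
     (\<forall>k. (\<forall>i j. [k * w i = k * w j] (mod m)) \<longrightarrow> m dvd k)"

lemma invertible_diagonal_root:
  assumes "primitive_root_of_unity m \<zeta>"
  shows "invertible (diagonal_matrix (\<lambda>i. \<zeta> ^ w i))"
  using primitive_root_nonzero[OF assms] by (intro invertible_monomial_matrix) auto

lemma diagonal_action_carrier:
  assumes "primitive_root_of_unity m \<zeta>" "diagonal_action d m \<zeta> F G w"
  shows "G \<subseteq> carrier PGL3"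
proof -
  have "{pgl (diagonal_matrix (\<lambda>i. \<zeta> ^ w i))} \<subseteq> carrier PGL3"
    using pgl_closed[OF invertible_diagonal_root[OF assms(1)]] by blast
  from group.generate_incl[OF group_PGL3 this] show ?thesis
    using assms(2) by (simp add: diagonal_action_def)
qed

lemma cyclic_subgroup_generator:
  assumes "group M" "subgroup G M" "cyclic_group (M\<lparr>carrier := G\<rparr>)"
  obtains x where "x \<in> G" "G = generate M {x}"
proof -
  interpret group M by fact
  obtain x where x: "x \<in> G" "subgroup_generated (M\<lparr>carrier := G\<rparr>) {x} = M\<lparr>carrier := G\<rparr>"
    using assms(3) by (auto simp: cyclic_group_def)
  then have "generate (M\<lparr>carrier := G\<rparr>) {x} = G"
    using carrier_subgroup_generated[of "M\<lparr>carrier := G\<rparr>" "{x}"] by simp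
  then have "G = generate M {x}"
    using generate_consistent[of "{x}" G] x(1) assms(2) by simp
  with x(1) show thesis by (rule that)
qed

lemma Const_times_lookup: "Poly_Mapping.lookup (Const c * F) e = c * Poly_Mapping.lookup F e"
  for F :: "'a::comm_semiring_1 poly3"
proof (induction F rule: poly_mapping_additive_induct)
  case (single f b)
  show ?case by (simp add: Const_def mult_single lookup_single when_def)
qed (simp add: distrib_left lookup_add)

lemma diagonal_action_exists:
  fixes F :: "'a::{alg_closed_field,field_char_0} poly3"
  assumes "homogeneous d F" "nonsingular F" "subgroup G PGL3" "G \<subseteq> Aut_curve F"
    and "cyclic_group (PGL3\<lparr>carrier := G\<rparr>)" "finite G" "card G = m" "primitive_root_of_unity m \<zeta>"
  obtains P w where "invertible P" "diagonal_action d m \<zeta> (lin_subst F P) (conj_by P G) w"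
proof -
  interpret group "PGL3 :: ('a^3^3) set monoid" by (rule group_PGL3)
  note prim = assms(8)
  have m0: "0 < m" using prim by (simp add: primitive_root_of_unity_def)
  obtain x where x: "x \<in> G" "G = generate PGL3 {x}"
    using cyclic_subgroup_generator[OF group_PGL3 assms(3,5)] by blast
  have Gc: "G \<subseteq> carrier PGL3" using assms(3) by (rule subgroup.subset)
  obtain A where A: "invertible A" "x = pgl A" using PGL3_carrierE x(1) Gc by blast
  have ordx: "ord x = m" using generate_pow_card[of x] x Gc assms(7) by auto
  have "pgl (mat_power A m) = \<one>\<^bsub>PGL3\<^esub>"
    using pow_ord_eq_1[of x] x Gc A pgl_power[OF A(1), of m] ordx by auto
  then obtain c where c: "c \<noteq> 0" "mat_power A m = mat c" using pgl_eq_one_iff by blast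
  obtain z where z: "z ^ m = c" using nth_root_exists[OF m0, of c] by blast
  have z0: "z \<noteq> 0" using z c m0 by (metis zero_power)
  define A' where "A' = mat (1 / z) ** A"
  have A'x: "pgl A' = x" using z0 by (simp add: A'_def A pgl_scalar_mult)
  have invA': "invertible A'" unfolding A'_def using z0 A by (intro invertible_mult invertible_mat) auto
  have "mat_power A' m = mat 1"
    unfolding A'_def mat_power_scalar_mult c(2) mat_mult_mat using z0 z c by (simp add: power_one_over)
  from diagonalisation[OF prim this] obtain P w where
    P: "invertible P" "A' ** P = P ** diagonal_matrix (\<lambda>i. \<zeta> ^ w i)" .
  define D where "D = diagonal_matrix (\<lambda>i. \<zeta> ^ w i)"
  have invD: "invertible D" unfolding D_def by (rule invertible_diagonal_root[OF prim])
  note PD = P(2)[folded D_def]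
  define F' where "F' = lin_subst F P"
  have gen: "conj_by P G = generate PGL3 {pgl D}"
    using conj_by_generate[OF P(1), of x] conj_pgl[OF P(1) invA' invD PD] x Gc A'x by auto
  have "A' \<in> x" using pgl_self[of A'] A'x by simp
  then obtain c where c: "lin_subst F A' = Const c * F" "c \<noteq> 0"
    using x(1) assms(4) by (force simp: Aut_curve_def)
  have "lin_subst F' D = Const c * F'"
    by (simp add: F'_def lin_subst_lin_subst PD[symmetric])
       (simp add: lin_subst_lin_subst[symmetric] c lin_subst_mult lin_subst_Const)
  then have scaled: "(\<Prod>i\<in>UNIV. (\<zeta> ^ w i) ^ Poly_Mapping.lookup e i) * Poly_Mapping.lookup F' e = c * Poly_Mapping.lookup F' e" for e
    using lookup_lin_subst_monomial_matrix[of "\<lambda>i. i" F' "\<lambda>i. \<zeta> ^ w i" e]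
    by (auto simp: D_def Const_times_lookup map_key_id)
  \<comment> \<open>Each monomial is an eigenvector of the diagonal substitution. Invariance of
    \<open>F'\<close> up to the scalar \<open>c\<close> forces the same eigenvalue on all that
    occur.\<close>
  have char: "\<zeta> ^ (\<Sum>i\<in>UNIV. w i * Poly_Mapping.lookup e i) = c" if "e \<in> Poly_Mapping.keys F'" for e
    using that scaled[of e] by (simp add: in_keys_iff power_sum power_mult)
  have "\<exists>c. \<forall>e\<in>Poly_Mapping.keys F'. [(\<Sum>i\<in>UNIV. w i * Poly_Mapping.lookup e i) = c] (mod m)"
  proof (cases "Poly_Mapping.keys F' = {}")
    case False
    then obtain e0 where "e0 \<in> Poly_Mapping.keys F'" by blast
    with char show ?thesis by (metis primitive_root_power_eq_iff[OF prim])
  qed simp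
  \<comment> \<open>If \<open>k\<close> makes all weights congruent, the \<open>k\<close>-th power
    of \<open>D\<close> is scalar, so the order \<open>m\<close> of its class divides
    \<open>k\<close>.\<close>
  moreover have "m dvd k" if "\<forall>i j. [k * w i = k * w j] (mod m)" for k
  proof -
    have "(\<lambda>i. (\<zeta> ^ w i) ^ k) = (\<lambda>i. \<zeta> ^ (k * w 1))"
      using that by (auto simp: primitive_root_power_eq_iff[OF prim] mult.commute simp flip: power_mult)
    then have "mat_power D k = mat (\<zeta> ^ (k * w 1))"
      by (simp add: D_def mat_power_diagonal_matrix mat_eq_diagonal_matrix)
    then have "pgl D [^]\<^bsub>PGL3\<^esub> k = \<one>\<^bsub>PGL3\<^esub>"
      using primitive_root_nonzero[OF prim] by (auto simp: pgl_power[OF invD] pgl_eq_one_iff intro!: exI[of _ "\<zeta> ^ (k * w 1)"])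
    then have "ord (pgl D) dvd k" using pow_eq_id[OF pgl_closed[OF invD]] by blast
    moreover have "ord (pgl D) = m"
      using generate_pow_card[OF pgl_closed[OF invD]] card_conj_by[OF P(1) Gc] gen assms(7) by simp
    ultimately show ?thesis by simp
  qed
  ultimately have "diagonal_action d m \<zeta> F' (conj_by P G) w"
    unfolding diagonal_action_def F'_def gen D_def
    using homogeneous_lin_subst[OF assms(1)] nonsingular_lin_subst[OF assms(2) P(1)] by blast
  with P(1) show thesis unfolding F'_def by (rule that)
qed

text \<open>If \<open>t * r\<close> is 1 modulo \<open>m\<close>, raising to the power
  \<open>r\<close> takes the \<open>t\<close>-th power of \<open>x\<close> back to \<open>x\<close>.
  This is what permits multiplying all weights by a unit modulo \<open>m\<close>.\<close>

lemma generate_coprime_power: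
  fixes t m :: nat
  assumes "group M" "x \<in> carrier M" "x [^]\<^bsub>M\<^esub> m = \<one>\<^bsub>M\<^esub>" "coprime t m"
  shows "generate M {x [^]\<^bsub>M\<^esub> t} = generate M {x}"
proof -
  interpret group M by fact
  obtain r where r: "[t * r = 1] (mod m)" using cong_solve_coprime_nat[OF assms(4)] by auto
  have "x [^]\<^bsub>M\<^esub> (1::int) = x [^]\<^bsub>M\<^esub> int (t * r)"
  proof -
    have "int (ord x) dvd int m" using pow_eq_id assms(2,3) by auto
    also have "int m dvd int (t * r) - 1"
      using r by (metis cong_iff_dvd_diff cong_int_iff of_nat_1)
    finally show ?thesis unfolding int_pow_eq[OF assms(2)] .
  qed
  then have "(x [^]\<^bsub>M\<^esub> t) [^]\<^bsub>M\<^esub> r = x"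
    using assms(2) by (simp add: nat_pow_pow int_pow_int del: of_nat_mult)
  then have "x = (x [^]\<^bsub>M\<^esub> t) [^]\<^bsub>M\<^esub> (int r)" using assms(2) by (simp add: int_pow_int)
  then have "x \<in> generate M {x [^]\<^bsub>M\<^esub> t}"
    using generate_pow[of "x [^]\<^bsub>M\<^esub> t"] assms(2) by blast
  moreover have "x [^]\<^bsub>M\<^esub> t \<in> generate M {x}"
    using generate_pow[OF assms(2)] by (metis (mono_tags, lifting) UNIV_I int_pow_int mem_Collect_eq)
  moreover have "{x [^]\<^bsub>M\<^esub> t} \<subseteq> carrier M" "{x} \<subseteq> carrier M" using assms(2) by auto
  ultimately show ?thesis
    by (intro subset_antisym generate_subgroup_incl generate_is_subgroup) simp_all
qed

text \<open>Adding \<open>s\<close> to all weights multiplies the generator by a scalar, invisible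
  in \<open>PGL3\<close>, and by homogeneity shifts the weight of every monomial by the same
  \<open>s * d\<close>. Multiplying by the unit \<open>t\<close> replaces the generator by its
  \<open>t\<close>-th power.\<close>

lemma diagonal_action_change_weights:
  assumes prim: "primitive_root_of_unity m \<zeta>" and act: "diagonal_action d m \<zeta> F G w"
    and "coprime t m" and w': "\<And>i. [w' i = t * (w i + s)] (mod m)"
  shows "diagonal_action d m \<zeta> F G w'"
proof -
  define D where "D = diagonal_matrix (\<lambda>i. \<zeta> ^ w i)"
  have invD: "invertible D" unfolding D_def by (rule invertible_diagonal_root[OF prim])
  have hom: "homogeneous d F" and "nonsingular F" and G: "G = generate PGL3 {pgl D}"
    and ord: "\<And>k. (\<forall>i j. [k * w i = k * w j] (mod m)) \<Longrightarrow> m dvd k"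
    using act by (auto simp: diagonal_action_def D_def)
  obtain c where c: "\<And>e. e \<in> Poly_Mapping.keys F \<Longrightarrow> [(\<Sum>i\<in>UNIV. w i * Poly_Mapping.lookup e i) = c] (mod m)"
    using act by (auto simp: diagonal_action_def)
  have "\<zeta> ^ m = 1" using prim by (simp add: primitive_root_of_unity_def)
  then have "(\<zeta> ^ k) ^ m = 1" for k by (metis mult.commute power_mult power_one)
  then have "mat_power D m = mat 1"
    by (simp add: D_def mat_power_diagonal_matrix mat_eq_diagonal_matrix)
  then have Dm: "pgl D [^]\<^bsub>PGL3\<^esub> m = \<one>\<^bsub>PGL3\<^esub>" by (simp add: pgl_power[OF invD] pgl_mat_1)
  have "(\<zeta> ^ w' i) = \<zeta> ^ (t * s) * (\<zeta> ^ w i) ^ t" for i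
  proof -
    have "\<zeta> ^ w' i = \<zeta> ^ (t * (w i + s))" using w' primitive_root_power_eq_iff[OF prim] by blast
    then show ?thesis by (simp add: algebra_simps flip: power_mult power_add)
  qed
  then have "diagonal_matrix (\<lambda>i. \<zeta> ^ w' i) = mat (\<zeta> ^ (t * s)) ** mat_power D t"
    by (simp add: D_def mat_power_diagonal_matrix mat_eq_diagonal_matrix monomial_matrix_mult o_def)
  then have "pgl (diagonal_matrix (\<lambda>i. \<zeta> ^ w' i)) = pgl D [^]\<^bsub>PGL3\<^esub> t"
    using primitive_root_nonzero[OF prim] by (simp add: pgl_scalar_mult pgl_power[OF invD])
  then have "G = generate PGL3 {pgl (diagonal_matrix (\<lambda>i. \<zeta> ^ w' i))}"
    using generate_coprime_power[OF group_PGL3 pgl_closed[OF invD] Dm \<open>coprime t m\<close>] G by simp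
  moreover have "[(\<Sum>i\<in>UNIV. w' i * Poly_Mapping.lookup e i) = t * c + t * s * d] (mod m)"
    if e: "e \<in> Poly_Mapping.keys F" for e
  proof -
    have "[(\<Sum>i\<in>UNIV. w' i * Poly_Mapping.lookup e i) = (\<Sum>i\<in>UNIV. t * (w i + s) * Poly_Mapping.lookup e i)] (mod m)"
      by (intro cong_sum cong_mult w' cong_refl)
    also have "(\<Sum>i\<in>UNIV. t * (w i + s) * Poly_Mapping.lookup e i) =
        t * (\<Sum>i\<in>UNIV. w i * Poly_Mapping.lookup e i) + t * s * (\<Sum>i\<in>UNIV. Poly_Mapping.lookup e i)"
      by (simp add: algebra_simps sum.distrib sum_distrib_left)
    also have "[\<dots> = t * c + t * s * d] (mod m)"
      unfolding homogeneousD[OF hom e] by (intro cong_add cong_mult c e cong_refl)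
    finally show ?thesis .
  qed
  moreover have "m dvd k" if "\<forall>i j. [k * w' i = k * w' j] (mod m)" for k
  proof (rule ord, intro allI)
    fix i j
    have "[k * (t * (w i + s)) = k * w' i] (mod m)" by (intro cong_mult cong_refl cong_sym[OF w'])
    also have "[k * w' i = k * w' j] (mod m)" using that by blast
    also have "[k * w' j = k * (t * (w j + s))] (mod m)" by (intro cong_mult cong_refl w')
    finally have "[t * (k * w i + k * s) = t * (k * w j + k * s)] (mod m)"
      by (simp add: algebra_simps)
    then show "[k * w i = k * w j] (mod m)"
      using \<open>coprime t m\<close> by (simp add: cong_mult_lcancel_nat cong_add_rcancel_nat)
  qed
  ultimately show ?thesis
    using hom \<open>nonsingular F\<close> unfolding diagonal_action_def by blast
qed

text \<open>Conjugation by a monomial matrix permutes the diagonal entries of the generator,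
  carrying the weight at \<open>i\<close> to position \<open>\<tau> i\<close>; the scalars
  \<open>s\<close> drop out because \<open>D ** N = N ** D'\<close> holds entry by entry.\<close>

lemma diagonal_action_monomial_change:
  assumes prim: "primitive_root_of_unity m \<zeta>" and act: "diagonal_action d m \<zeta> F G w"
    and "inj \<tau>" and s: "\<And>i. s i \<noteq> 0" and w': "\<And>i. w' (\<tau> i) = w i"
  shows "diagonal_action d m \<zeta> (lin_subst F (monomial_matrix \<tau> s)) (conj_by (monomial_matrix \<tau> s) G) w'"
proof -
  define N where "N = monomial_matrix \<tau> s"
  have bij: "bij \<tau>" using \<open>inj \<tau>\<close> by (simp add: finite_UNIV_inj_surj bij_def)
  have invN: "invertible N" unfolding N_def by (rule invertible_monomial_matrix[OF \<open>inj \<tau>\<close> s])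
  define D where "D = diagonal_matrix (\<lambda>i. \<zeta> ^ w i)"
  define D' where "D' = diagonal_matrix (\<lambda>i. \<zeta> ^ w' i)"
  have invD: "invertible D" "invertible D'"
    unfolding D_def D'_def by (rule invertible_diagonal_root[OF prim])+
  have hom: "homogeneous d F" and ns: "nonsingular F" and G: "G = generate PGL3 {pgl D}"
    and ord: "\<And>k. (\<forall>i j. [k * w i = k * w j] (mod m)) \<Longrightarrow> m dvd k"
    using act by (auto simp: diagonal_action_def D_def)
  obtain c where c: "\<And>e. e \<in> Poly_Mapping.keys F \<Longrightarrow> [(\<Sum>i\<in>UNIV. w i * Poly_Mapping.lookup e i) = c] (mod m)"
    using act by (auto simp: diagonal_action_def)
  have "D ** N = N ** D'"
    by (simp add: D_def D'_def N_def monomial_matrix_mult w' mult.commute o_def)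
  then have "conj_by N G = generate PGL3 {pgl D'}"
    using conj_by_generate[OF invN, of "pgl D"] conj_pgl[OF invN invD] pgl_closed[OF invD(1)] G by simp
  moreover have "[(\<Sum>i\<in>UNIV. w' i * Poly_Mapping.lookup e i) = c] (mod m)"
    if "e \<in> Poly_Mapping.keys (lin_subst F N)" for e
  proof -
    have k: "Poly_Mapping.map_key \<tau> e \<in> Poly_Mapping.keys F"
      using that by (auto simp: in_keys_iff N_def lookup_lin_subst_monomial_matrix[OF \<open>inj \<tau>\<close>])
    have "(\<Sum>i\<in>UNIV. w' i * Poly_Mapping.lookup e i) = (\<Sum>i\<in>UNIV. w' (\<tau> i) * Poly_Mapping.lookup e (\<tau> i))"
      using sum.reindex_bij_betw[OF bij, of "\<lambda>i. w' i * Poly_Mapping.lookup e i"] by simp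
    also have "\<dots> = (\<Sum>i\<in>UNIV. w i * Poly_Mapping.lookup (Poly_Mapping.map_key \<tau> e) i)"
      by (simp add: w' map_key.rep_eq[OF \<open>inj \<tau>\<close>])
    finally show ?thesis using c[OF k] by simp
  qed
  moreover have "m dvd k" if "\<forall>i j. [k * w' i = k * w' j] (mod m)" for k
    using that ord[of k] w' by metis
  ultimately show ?thesis
    using homogeneous_lin_subst[OF hom] nonsingular_lin_subst[OF ns invN]
    unfolding diagonal_action_def N_def[symmetric] D'_def by blast
qed

section \<open>Expansion in monomials\<close>

lemma Var_power: "Var i ^ n = Poly_Mapping.single (Poly_Mapping.single i n) (1::'a::comm_semiring_1)"
  by (simp add: Var_def single_power)

text \<open>Sorted by the variable \<open>u\<close>, with \<open>j\<close> the total degree in the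
  other two. The three variables are arbitrary because forms (1) and (2) sort by \<open>Z\<close>,
  forms (4) to (6) by \<open>X\<close>, and form (3) by each variable in turn.\<close>

lemma homogeneous_expansion:
  fixes F :: "'a::comm_semiring_1 poly3"
  assumes "homogeneous d F" and distinct: "u \<noteq> v" "v \<noteq> t" "u \<noteq> t"
  shows "F = (\<Sum>j\<le>d. Var u ^ (d - j) * (\<Sum>i\<le>j. Const (Poly_Mapping.lookup F
      (Poly_Mapping.single u (d - j) + Poly_Mapping.single v i + Poly_Mapping.single t (j - i)))
      * Var v ^ i * Var t ^ (j - i)))"
proof -
  let ?l = "Poly_Mapping.lookup"
  define e where "e j i = Poly_Mapping.single u (d - j) + Poly_Mapping.single v i + Poly_Mapping.single t (j - i)"
    for j i
  have le: "?l (e j i) u = d - j" "?l (e j i) v = i" "?l (e j i) t = j - i" for j i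
    using distinct by (auto simp: e_def lookup_add lookup_single when_def)
  let ?I = "Sigma {..d} (\<lambda>j. {..j})"
  have inj: "inj_on (\<lambda>(j, i). e j i) ?I"
  proof (rule inj_onI, clarsimp)
    fix j i j' i' assume *: "j \<le> d" "i \<le> j" "j' \<le> d" "i' \<le> j'" "e j i = e j' i'"
    then have "d - j = d - j'" "i = i'" using le by metis+
    then show "j = j' \<and> i = i'" using * by simp
  qed
  have keys: "Poly_Mapping.keys F \<subseteq> (\<lambda>(j, i). e j i) ` ?I"
  proof
    fix f assume "f \<in> Poly_Mapping.keys F"
    with assms have sum: "?l f u + ?l f v + ?l f t = d"
      using homogeneousD sum_prod_UNIV_3_distinct(1)[OF distinct] by metis
    have "f = e (?l f v + ?l f t) (?l f v)"
    proof (rule poly_mapping_eqI)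
      fix x
      have "x = u \<or> x = v \<or> x = t" using UNIV_3_distinct[OF distinct] by auto
      then show "?l f x = ?l (e (?l f v + ?l f t) (?l f v)) x"
        using sum by (elim disjE) (simp_all add: le)
    qed
    then show "f \<in> (\<lambda>(j, i). e j i) ` ?I"
      using sum by (intro image_eqI[of _ _ "(?l f v + ?l f t, ?l f v)"]) auto
  qed
  have "(\<Sum>j\<le>d. Var u ^ (d - j) * (\<Sum>i\<le>j. Const (?l F (e j i)) * Var v ^ i * Var t ^ (j - i)))
      = (\<Sum>j\<le>d. \<Sum>i\<le>j. Poly_Mapping.single (e j i) (?l F (e j i)))"
    by (simp add: Var_power Const_def mult_single sum_distrib_left e_def add.assoc)
  also have "\<dots> = (\<Sum>(j, i)\<in>?I. Poly_Mapping.single (e j i) (?l F (e j i)))"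
    by (subst sum.Sigma) auto
  also have "\<dots> = (\<Sum>f\<in>(\<lambda>(j, i). e j i) ` ?I. Poly_Mapping.single f (?l F f))"
    by (subst sum.reindex[OF inj]) (auto intro!: sum.cong)
  also have "\<dots> = (\<Sum>f\<in>Poly_Mapping.keys F. Poly_Mapping.single f (?l F f))"
    by (rule sum.mono_neutral_right) (use keys in \<open>auto simp: in_keys_iff\<close>)
  also have "\<dots> = F" by (rule poly_mapping_sum_single[symmetric])
  finally show ?thesis by (simp add: e_def)
qed

lemma homogeneous_expansion_restricted:
  fixes F :: "'a::comm_semiring_1 poly3"
  assumes "homogeneous d F" and "u \<noteq> v" "v \<noteq> t" "u \<noteq> t"
    and supp: "\<And>i j. j \<le> d \<Longrightarrow> i \<le> j \<Longrightarrow>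
      Poly_Mapping.lookup F (Poly_Mapping.single u (d - j) + Poly_Mapping.single v i
        + Poly_Mapping.single t (j - i)) \<noteq> 0 \<Longrightarrow> j \<in> J \<and> i \<in> S j"
    and "J \<subseteq> {..d}" and S: "\<And>j. S j \<subseteq> {..j}"
  shows "F = (\<Sum>j\<in>J. Var u ^ (d - j) * (\<Sum>i\<in>S j. Const (Poly_Mapping.lookup F
      (Poly_Mapping.single u (d - j) + Poly_Mapping.single v i + Poly_Mapping.single t (j - i)))
      * Var v ^ i * Var t ^ (j - i)))"
proof -
  let ?c = "\<lambda>j i. Poly_Mapping.lookup F
      (Poly_Mapping.single u (d - j) + Poly_Mapping.single v i + Poly_Mapping.single t (j - i))"
  have "F = (\<Sum>j\<le>d. Var u ^ (d - j) * (\<Sum>i\<le>j. Const (?c j i) * Var v ^ i * Var t ^ (j - i)))"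
    by (rule homogeneous_expansion) fact+
  also have "\<dots> = (\<Sum>j\<in>J. Var u ^ (d - j) * (\<Sum>i\<le>j. Const (?c j i) * Var v ^ i * Var t ^ (j - i)))"
  proof (rule sum.mono_neutral_right)
    show "\<forall>j\<in>{..d} - J. Var u ^ (d - j) * (\<Sum>i\<le>j. Const (?c j i) * Var v ^ i * Var t ^ (j - i)) = 0"
    proof
      fix j assume "j \<in> {..d} - J"
      then have "?c j i = 0" if "i \<le> j" for i using supp that by blast
      then show "Var u ^ (d - j) * (\<Sum>i\<le>j. Const (?c j i) * Var v ^ i * Var t ^ (j - i)) = 0" by simp
    qed
  qed (use assms in auto)
  also have "\<dots> = (\<Sum>j\<in>J. Var u ^ (d - j) * (\<Sum>i\<in>S j. Const (?c j i) * Var v ^ i * Var t ^ (j - i)))"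
  proof (rule sum.cong[OF refl])
    fix j assume "j \<in> J"
    then have "j \<le> d" using \<open>J \<subseteq> {..d}\<close> by auto
    then have "?c j i = 0" if "i \<in> {..j} - S j" for i using supp that by blast
    then have "(\<Sum>i\<le>j. Const (?c j i) * Var v ^ i * Var t ^ (j - i)) =
        (\<Sum>i\<in>S j. Const (?c j i) * Var v ^ i * Var t ^ (j - i))"
      by (intro sum.mono_neutral_right S) auto
    then show "Var u ^ (d - j) * (\<Sum>i\<le>j. Const (?c j i) * Var v ^ i * Var t ^ (j - i)) =
        Var u ^ (d - j) * (\<Sum>i\<in>S j. Const (?c j i) * Var v ^ i * Var t ^ (j - i))" by simp
  qed
  finally show ?thesis .
qed

text \<open>Projection onto the span of the monomials satisfying \<open>P\<close>. It cuts
  \<open>F\<close> into pieces according to the dominant variable, for form (3).\<close>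

definition restrict_monomials :: "((3 \<Rightarrow>\<^sub>0 nat) \<Rightarrow> bool) \<Rightarrow> 'a::comm_monoid_add poly3 \<Rightarrow> 'a poly3" where
  "restrict_monomials P F = (\<Sum>e\<in>{e\<in>Poly_Mapping.keys F. P e}. Poly_Mapping.single e (Poly_Mapping.lookup F e))"

lemma lookup_restrict_monomials:
  "Poly_Mapping.lookup (restrict_monomials P F) e = (if P e then Poly_Mapping.lookup F e else 0)"
  by (auto simp: restrict_monomials_def lookup_sum lookup_single when_def in_keys_iff)

lemma homogeneous_restrict_monomials: "homogeneous d F \<Longrightarrow> homogeneous d (restrict_monomials P F)"
  unfolding homogeneous_def by (metis in_keys_iff lookup_restrict_monomials)

section \<open>The equations\<close>

definition cf :: "'a::zero poly3 \<Rightarrow> nat \<Rightarrow> nat \<Rightarrow> nat \<Rightarrow> 'a" where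
  "cf F i j k = Poly_Mapping.lookup F
     (Poly_Mapping.single 1 i + Poly_Mapping.single 2 j + Poly_Mapping.single 3 k)"

text \<open>The weight of \<open>X\<close> is 0, so only the exponents of \<open>Y\<close> and
  \<open>Z\<close> enter the congruence; \<open>c\<close> is the weight common to all
  monomials.\<close>

locale weighted_curve =
  fixes d m a b c :: nat and F :: "'a::field poly3"
  assumes d4: "4 \<le> d" and homog: "homogeneous d F" and gamma: "(a, b) \<in> Gamma_pairs m"
    and wt: "cf F i j k \<noteq> 0 \<Longrightarrow> [a * j + b * k = c] (mod m)"
begin

lemma weights_distinct: "\<not> [a = 0] (mod m)" "\<not> [b = 0] (mod m)" "\<not> [a = b] (mod m)"
  using gamma by (auto simp: Gamma_pairs_def cong_def)

definition \<beta> :: "nat \<Rightarrow> nat \<Rightarrow> 'a" where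
  "\<beta> j i = cf F (d - j) i (j - i)"

abbreviation monomial_YZ :: "nat \<Rightarrow> nat \<Rightarrow> 'a poly3" where
  "monomial_YZ j i \<equiv> Const (\<beta> j i) * VY ^ i * VZ ^ (j - i)"

lemma \<beta>_weight: "\<beta> j i \<noteq> 0 \<Longrightarrow> [a * i + (j - i) * b = c] (mod m)"
  unfolding \<beta>_def by (metis wt mult.commute)

lemma sum_mono_restrict:
  assumes "\<And>i. i \<le> j \<Longrightarrow> \<beta> j i \<noteq> 0 \<Longrightarrow> i \<in> S" "S \<subseteq> {..j}"
  shows "(\<Sum>i\<le>j. monomial_YZ j i) = (\<Sum>i\<in>S. monomial_YZ j i)"
proof (rule sum.mono_neutral_right)
  show "\<forall>i\<in>{..j} - S. monomial_YZ j i = 0"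
  proof
    fix i assume "i \<in> {..j} - S"
    then have "\<beta> j i = 0" using assms(1) by blast
    then show "monomial_YZ j i = 0" by simp
  qed
qed (use assms(2) in auto)

lemma S_sets_finite [simp]: "finite (S_d_X u d m a b)" "finite (S_d1_X u d m a b)"
  by (auto simp: S_d_X_def S_d1_X_def intro: finite_subset[of _ "{..d}"])

end

section \<open>Expansions when \<open>X^d\<close> occurs\<close>

text \<open>The first reference point is off the curve. The monomial \<open>X^d\<close> has weight
  0, which forces the common weight to be 0 modulo \<open>m\<close>.\<close>

locale weighted_curve_X = weighted_curve +
  assumes X: "cf F d 0 0 = 1"
begin

lemma weight_0: "[0 = c] (mod m)"
  using wt[of d 0 0] X by simp

lemma \<beta>_weight_0: "\<beta> j i \<noteq> 0 \<Longrightarrow> [a * i + (j - i) * b = 0] (mod m)"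
  using \<beta>_weight weight_0 by (metis cong_sym cong_trans)

lemma sum_mono_S2_X: "(\<Sum>i\<le>j. monomial_YZ j i) = (\<Sum>i\<in>S2_X j m a b. monomial_YZ j i)"
  by (rule sum_mono_restrict) (auto simp: S2_X_def intro: \<beta>_weight_0)

text \<open>The layers \<open>j = d - 1\<close> and \<open>j = d\<close> keep their full range
  because the forms (4) to (6) differ only there. For \<open>4 \<le> d\<close> the layers 0, 1,
  \<open>d - 1\<close> and \<open>d\<close> are distinct and lie outside
  \<open>2..d-2\<close>.\<close>

lemma expansion_X:
  "F = VX ^ d + (\<Sum>j=2..d-2. VX ^ (d - j) * (\<Sum>i\<in>S2_X j m a b. monomial_YZ j i))
     + VX * (\<Sum>i\<le>d-1. monomial_YZ (d - 1) i) + (\<Sum>i\<le>d. monomial_YZ d i)"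
proof -
  let ?T = "\<lambda>j. VX ^ (d - j) * (\<Sum>i\<le>j. monomial_YZ j i)"
  have "F = (\<Sum>j\<le>d. ?T j)"
    using homogeneous_expansion[OF homog, of 1 2 3] by (simp add: \<beta>_def cf_def)
  also have "{..d} = insert 0 (insert 1 (insert (d - 1) (insert d {2..d-2})))"
    using d4 by auto
  also have "(\<Sum>j\<in>\<dots>. ?T j) = ?T 0 + (?T 1 + (?T (d - 1) + (?T d + (\<Sum>j=2..d-2. ?T j))))"
    using d4 by (subst sum.insert, simp, force)+ simp
  also have "?T 0 = VX ^ d" using X by (simp add: \<beta>_def)
  \<comment> \<open>The monomials of this layer have weights \<open>b\<close> and \<open>a\<close>,
    neither of which is 0 modulo \<open>m\<close>.\<close>
  also have "?T 1 = 0"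
  proof -
    have "\<beta> 1 0 = 0" "\<beta> 1 1 = 0"
      using weights_distinct \<beta>_weight_0[of 1 0] \<beta>_weight_0[of 1 1] by fastforce+
    then show ?thesis by (simp add: atMost_Suc)
  qed
  also have "?T (d - 1) = VX * (\<Sum>i\<le>d-1. monomial_YZ (d - 1) i)" using d4 by simp
  also have "?T d = (\<Sum>i\<le>d. monomial_YZ d i)" by simp
  also have "(\<Sum>j=2..d-2. ?T j) = (\<Sum>j=2..d-2. VX ^ (d - j) * (\<Sum>i\<in>S2_X j m a b. monomial_YZ j i))"
    by (simp add: sum_mono_S2_X)
  finally show ?thesis by (simp add: algebra_simps)
qed

lemma expansion_X':
  "F = VX ^ d + (\<Sum>j=2..d-1. VX ^ (d - j) * (\<Sum>i\<in>S2_X j m a b. monomial_YZ j i)) + (\<Sum>i\<le>d. monomial_YZ d i)"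
proof -
  have "{2..d-1} = insert (d - 1) {2..d-2}" using d4 by auto
  then have "(\<Sum>j=2..d-1. VX ^ (d - j) * (\<Sum>i\<in>S2_X j m a b. monomial_YZ j i)) =
    VX ^ (d - (d - 1)) * (\<Sum>i\<le>d-1. monomial_YZ (d - 1) i)
      + (\<Sum>j=2..d-2. VX ^ (d - j) * (\<Sum>i\<in>S2_X j m a b. monomial_YZ j i))"
    unfolding sum_mono_S2_X using d4 by (simp only:) (subst sum.insert, simp, force, simp)
  also have "d - (d - 1) = 1" using d4 by simp
  finally have "(\<Sum>j=2..d-1. VX ^ (d - j) * (\<Sum>i\<in>S2_X j m a b. monomial_YZ j i)) =
    VX * (\<Sum>i\<le>d-1. monomial_YZ (d - 1) i)
      + (\<Sum>j=2..d-2. VX ^ (d - j) * (\<Sum>i\<in>S2_X j m a b. monomial_YZ j i))" by simp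
  then show ?thesis using expansion_X by (simp add: algebra_simps)
qed

text \<open>In the layer without \<open>X\<close> the extreme indices 0 and \<open>d\<close> belong
  to \<open>Z^d\<close> and \<open>Y^d\<close>; they are split off, and the weight condition puts
  the others into \<open>S_d_X 1 d m a b\<close>.\<close>

lemma equation_6:
  assumes "cf F 0 d 0 = 1" "cf F 0 0 d = 1"
  shows "F = VX^d + VY^d + VZ^d
     + (\<Sum>j=2..d-1. VX^(d-j) * (\<Sum>i\<in>S2_X j m a b. monomial_YZ j i))
     + (\<Sum>i\<in>S_d_X 1 d m a b. monomial_YZ d i)"
proof -
  have "(\<Sum>i\<le>d. monomial_YZ d i) = (\<Sum>i\<in>insert 0 (insert d (S_d_X 1 d m a b)). monomial_YZ d i)"
  proof (rule sum_mono_restrict)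
    fix i assume "i \<le> d" "\<beta> d i \<noteq> 0"
    then show "i \<in> insert 0 (insert d (S_d_X 1 d m a b))" using \<beta>_weight_0[of d i] by (auto simp: S_d_X_def)
  qed (auto simp: S_d_X_def)
  also have "\<dots> = monomial_YZ d 0 + (monomial_YZ d d + (\<Sum>i\<in>S_d_X 1 d m a b. monomial_YZ d i))"
    using d4 by (subst sum.insert, simp, force simp: S_d_X_def)+ simp
  also have "monomial_YZ d 0 = VZ ^ d" using assms by (simp add: \<beta>_def)
  also have "monomial_YZ d d = VY ^ d" using assms by (simp add: \<beta>_def)
  finally show ?thesis using expansion_X' by (simp add: algebra_simps)
qed

lemma equation_5:
  assumes "cf F 0 d 0 = 1" "cf F 0 0 d = 0" "cf F 1 0 (d - 1) = \<alpha>"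
  shows "F = VX^d + VY^d
     + (\<Sum>j=2..d-2. VX^(d-j) * (\<Sum>i\<in>S2_X j m a b. monomial_YZ j i))
     + (\<Sum>i\<in>S_d_X 1 d m a b. monomial_YZ d i)
     + VX * (Const \<alpha> * VZ^(d-1) + (\<Sum>i\<in>S_d1_X 1 d m a b. monomial_YZ (d - 1) i))"
proof -
  have "(\<Sum>i\<le>d. monomial_YZ d i) = (\<Sum>i\<in>insert d (S_d_X 1 d m a b). monomial_YZ d i)"
  proof (rule sum_mono_restrict)
    fix i assume "i \<le> d" "\<beta> d i \<noteq> 0"
    then show "i \<in> insert d (S_d_X 1 d m a b)"
      using \<beta>_weight_0[of d i] assms by (cases "i = 0") (auto simp: S_d_X_def \<beta>_def)
  qed (auto simp: S_d_X_def)
  also have "\<dots> = monomial_YZ d d + (\<Sum>i\<in>S_d_X 1 d m a b. monomial_YZ d i)"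
    using d4 by (subst sum.insert, simp, force simp: S_d_X_def) simp
  also have "monomial_YZ d d = VY ^ d" using assms by (simp add: \<beta>_def)
  finally have 1: "(\<Sum>i\<le>d. monomial_YZ d i) = VY ^ d + (\<Sum>i\<in>S_d_X 1 d m a b. monomial_YZ d i)" .
  have "(\<Sum>i\<le>d-1. monomial_YZ (d-1) i) = (\<Sum>i\<in>insert 0 (S_d1_X 1 d m a b). monomial_YZ (d-1) i)"
  proof (rule sum_mono_restrict)
    fix i assume "i \<le> d - 1" "\<beta> (d - 1) i \<noteq> 0"
    then show "i \<in> insert 0 (S_d1_X 1 d m a b)" using \<beta>_weight_0[of "d - 1" i] by (auto simp: S_d1_X_def)
  qed (auto simp: S_d1_X_def)
  also have "\<dots> = monomial_YZ (d - 1) 0 + (\<Sum>i\<in>S_d1_X 1 d m a b. monomial_YZ (d - 1) i)"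
    by (subst sum.insert, simp, force simp: S_d1_X_def) simp
  also have "monomial_YZ (d - 1) 0 = Const \<alpha> * VZ ^ (d - 1)" using assms d4 by (simp add: \<beta>_def)
  finally show ?thesis using expansion_X 1 by (simp add: algebra_simps)
qed

text \<open>With \<open>Y^d\<close> and \<open>Z^d\<close> absent, the layer without
  \<open>X\<close> runs from index 1 to index \<open>d - 1\<close>. Its two ends are the leading
  monomials, and \<open>S_d_X 2 d m a b\<close> covers what lies strictly between.\<close>

lemma equation_4_1:
  assumes "cf F 0 d 0 = 0" "cf F 0 0 d = 0" "cf F 0 (d - 1) 1 = 1" "cf F 0 1 (d - 1) = \<alpha>"
  shows "F = VX^d
     + (\<Sum>j=2..d-1. VX^(d-j) * (\<Sum>i\<in>S2_X j m a b. monomial_YZ j i))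
     + VY^(d-1) * VZ + Const \<alpha> * VY * VZ^(d-1)
     + (\<Sum>i\<in>S_d_X 2 d m a b. monomial_YZ d i)"
proof -
  have "(\<Sum>i\<le>d. monomial_YZ d i) = (\<Sum>i\<in>insert 1 (insert (d - 1) (S_d_X 2 d m a b)). monomial_YZ d i)"
  proof (rule sum_mono_restrict)
    fix i assume i: "i \<le> d" "\<beta> d i \<noteq> 0"
    have "\<beta> d 0 = 0" "\<beta> d d = 0" using assms by (simp_all add: \<beta>_def)
    with i have "i \<noteq> 0" "i \<noteq> d" by metis+
    with i show "i \<in> insert 1 (insert (d - 1) (S_d_X 2 d m a b))"
      using \<beta>_weight_0[of d i] by (auto simp: S_d_X_def)
  qed (use d4 in \<open>auto simp: S_d_X_def\<close>)
  also have "\<dots> = monomial_YZ d 1 + (monomial_YZ d (d - 1) + (\<Sum>i\<in>S_d_X 2 d m a b. monomial_YZ d i))"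
    using d4 by (subst sum.insert, simp, force simp: S_d_X_def)+ simp
  also have "monomial_YZ d 1 = Const \<alpha> * VY * VZ ^ (d - 1)"
    using assms d4 by (simp add: \<beta>_def)
  also have "monomial_YZ d (d - 1) = VY ^ (d - 1) * VZ"
    using assms d4 by (simp add: \<beta>_def)
  finally show ?thesis using expansion_X' by (simp add: algebra_simps)
qed

lemma equation_4_2:
  assumes "cf F 0 d 0 = 0" "cf F 0 0 d = 0" "cf F 0 (d - 1) 1 = 1" "cf F 0 1 (d - 1) = 0"
    and "cf F 1 0 (d - 1) = \<alpha>"
  shows "F = VX^d
     + (\<Sum>j=2..d-2. VX^(d-j) * (\<Sum>i\<in>S2_X j m a b. monomial_YZ j i))
     + VX * (Const \<alpha> * VZ^(d-1) + (\<Sum>i\<in>S_d1_X 1 d m a b. monomial_YZ (d - 1) i))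
     + VY^(d-1) * VZ
     + (\<Sum>i\<in>S_d_X 2 d m a b. monomial_YZ d i)"
proof -
  have "(\<Sum>i\<le>d. monomial_YZ d i) = (\<Sum>i\<in>insert (d - 1) (S_d_X 2 d m a b). monomial_YZ d i)"
  proof (rule sum_mono_restrict)
    fix i assume i: "i \<le> d" "\<beta> d i \<noteq> 0"
    have "\<beta> d 0 = 0" "\<beta> d d = 0" "\<beta> d 1 = 0" using assms by (simp_all add: \<beta>_def)
    with i have "i \<noteq> 0" "i \<noteq> d" "i \<noteq> 1" by metis+
    with i show "i \<in> insert (d - 1) (S_d_X 2 d m a b)"
      using \<beta>_weight_0[of d i] by (auto simp: S_d_X_def)
  qed (use d4 in \<open>auto simp: S_d_X_def\<close>)
  also have "\<dots> = monomial_YZ d (d - 1) + (\<Sum>i\<in>S_d_X 2 d m a b. monomial_YZ d i)"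
    using d4 by (subst sum.insert, simp, force simp: S_d_X_def) simp
  also have "monomial_YZ d (d - 1) = VY ^ (d - 1) * VZ"
    using assms d4 by (simp add: \<beta>_def)
  finally have 1: "(\<Sum>i\<le>d. monomial_YZ d i) = VY ^ (d - 1) * VZ + (\<Sum>i\<in>S_d_X 2 d m a b. monomial_YZ d i)" .
  have "(\<Sum>i\<le>d-1. monomial_YZ (d-1) i) = (\<Sum>i\<in>insert 0 (S_d1_X 1 d m a b). monomial_YZ (d-1) i)"
  proof (rule sum_mono_restrict)
    fix i assume "i \<le> d - 1" "\<beta> (d - 1) i \<noteq> 0"
    then show "i \<in> insert 0 (S_d1_X 1 d m a b)" using \<beta>_weight_0[of "d - 1" i] by (auto simp: S_d1_X_def)
  qed (auto simp: S_d1_X_def)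
  also have "\<dots> = monomial_YZ (d - 1) 0 + (\<Sum>i\<in>S_d1_X 1 d m a b. monomial_YZ (d - 1) i)"
    by (subst sum.insert, simp, force simp: S_d1_X_def) simp
  also have "monomial_YZ (d - 1) 0 = Const \<alpha> * VZ ^ (d - 1)" using assms d4 by (simp add: \<beta>_def)
  finally show ?thesis using expansion_X 1 by (simp add: algebra_simps)
qed

text \<open>Both leading monomials besides \<open>X^d\<close> lie in the layer
  \<open>j = d - 1\<close>, at its ends 0 and \<open>d - 1\<close>. Splitting them off leaves
  \<open>1 \<le> i \<le> d - 2\<close>, which is why \<open>S_d1_X\<close> appears with parameter
  2.\<close>

lemma equation_4_3:
  assumes "cf F 0 d 0 = 0" "cf F 0 0 d = 0" "cf F 0 (d - 1) 1 = 0" "cf F 0 1 (d - 1) = 0"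
    and "cf F 1 0 (d - 1) = 1" "cf F 1 (d - 1) 0 = \<alpha>"
  shows "F = VX^d
     + (\<Sum>j=2..d-2. VX^(d-j) * (\<Sum>i\<in>S2_X j m a b. monomial_YZ j i))
     + (\<Sum>i\<in>S_d_X 2 d m a b. monomial_YZ d i)
     + VX * (VZ^(d-1) + Const \<alpha> * VY^(d-1) + (\<Sum>i\<in>S_d1_X 2 d m a b. monomial_YZ (d - 1) i))"
proof -
  have 1: "(\<Sum>i\<le>d. monomial_YZ d i) = (\<Sum>i\<in>S_d_X 2 d m a b. monomial_YZ d i)"
  proof (rule sum_mono_restrict)
    fix i assume i: "i \<le> d" "\<beta> d i \<noteq> 0"
    have "d - (d - 1) = 1" using d4 by simp
    then have "\<beta> d 0 = 0" "\<beta> d d = 0" "\<beta> d 1 = 0" "\<beta> d (d - 1) = 0"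
      using assms by (simp_all add: \<beta>_def)
    with i have "i \<noteq> 0" "i \<noteq> d" "i \<noteq> 1" "i \<noteq> d - 1" by metis+
    with i show "i \<in> S_d_X 2 d m a b"
      using \<beta>_weight_0[of d i] by (auto simp: S_d_X_def)
  qed (use d4 in \<open>auto simp: S_d_X_def\<close>)
  have "(\<Sum>i\<le>d-1. monomial_YZ (d-1) i) = (\<Sum>i\<in>insert 0 (insert (d - 1) (S_d1_X 2 d m a b)). monomial_YZ (d-1) i)"
  proof (rule sum_mono_restrict)
    fix i assume "i \<le> d - 1" "\<beta> (d - 1) i \<noteq> 0"
    then show "i \<in> insert 0 (insert (d - 1) (S_d1_X 2 d m a b))"
      using \<beta>_weight_0[of "d - 1" i] by (auto simp: S_d1_X_def)
  qed (auto simp: S_d1_X_def)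
  also have "\<dots> = monomial_YZ (d - 1) 0 + (monomial_YZ (d - 1) (d - 1) + (\<Sum>i\<in>S_d1_X 2 d m a b. monomial_YZ (d - 1) i))"
    using d4 by (subst sum.insert, simp, force simp: S_d1_X_def)+ simp
  also have "monomial_YZ (d - 1) 0 = VZ ^ (d - 1)"
    using assms d4 by (simp add: \<beta>_def)
  also have "monomial_YZ (d - 1) (d - 1) = Const \<alpha> * VY ^ (d - 1)"
    using assms d4 by (simp add: \<beta>_def)
  finally show ?thesis using expansion_X 1 by (simp add: algebra_simps)
qed

end

text \<open>The monomials are sorted by a dominant variable. By the assumptions on the coefficients,
  any monomial besides the three leading ones has dominant exponent at most \<open>d - 2\<close>,
  hence \<open>2 \<le> j\<close>.\<close>

lemma (in weighted_curve) equation_3: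
  assumes c: "cf F d 0 0 = 0" "cf F 0 d 0 = 0" "cf F 0 0 d = 0"
    and xy: "cf F (d - 1) 1 0 = 1" "cf F (d - 1) 0 1 = 0"
    and yz: "cf F 0 (d - 1) 1 = 1" "cf F 1 (d - 1) 0 = 0"
    and zx: "cf F 1 0 (d - 1) = \<alpha>" "cf F 0 1 (d - 1) = 0"
  shows "\<exists>\<beta> \<alpha>' \<gamma>. F = VX^(d-1) * VY + VY^(d-1) * VZ + Const \<alpha> * VZ^(d-1) * VX
     + (\<Sum>j=2..(2*d) div 3.
          VX^(d-j) * (\<Sum>i\<in>S1_X j m a b. Const (\<beta> j i) * VY^i * VZ^(j-i))
        + VY^(d-j) * (\<Sum>i\<in>S_Y d j m a b. Const (\<alpha>' j i) * VZ^i * VX^(j-i))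
        + VZ^(d-j) * (\<Sum>i\<in>S_Z d j m a b. Const (\<gamma> j i) * VX^(j-i) * VY^i))"
proof -
  let ?l = "Poly_Mapping.lookup"
  define e where "e i j k = Poly_Mapping.single (1::3) i + Poly_Mapping.single 2 j + Poly_Mapping.single 3 k"
    for i j k :: nat
  have le: "?l (e i j k) 1 = i" "?l (e i j k) 2 = j" "?l (e i j k) 3 = k" for i j k
    by (simp_all add: e_def lookup_add lookup_single)
  have e_inj: "e i j k = e i' j' k' \<longleftrightarrow> i = i' \<and> j = j' \<and> k = k'" for i j k i' j' k'
    using le by metis
  have cf_e: "?l F (e i j k) = cf F i j k" for i j k by (simp add: cf_def e_def)
  \<comment> \<open>The monomial \<open>X^(d-1) * Y\<close> has weight \<open>a\<close>, so
    \<open>a\<close> is the common weight.\<close>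
  have wa: "[c = a] (mod m)" using wt[of "d - 1" 1 0] xy by (auto intro: cong_sym)
  \<comment> \<open>Ties between exponents go to \<open>X\<close> first and to \<open>Y\<close>
    next, so the three pieces are disjoint and together exhaust the remaining monomials.\<close>
  let ?special = "{e (d - 1) 1 0, e 0 (d - 1) 1, e 1 0 (d - 1)}"
  let ?PX = "\<lambda>f. ?l f 2 \<le> ?l f 1 \<and> ?l f 3 \<le> ?l f 1"
  let ?PY = "\<lambda>f. \<not> ?PX f \<and> ?l f 3 \<le> ?l f 2"
  let ?PZ = "\<lambda>f. \<not> ?PX f \<and> \<not> ?PY f"
  define HX where "HX = restrict_monomials (\<lambda>f. f \<notin> ?special \<and> ?PX f) F"
  define HY where "HY = restrict_monomials (\<lambda>f. f \<notin> ?special \<and> ?PY f) F"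
  define HZ where "HZ = restrict_monomials (\<lambda>f. f \<notin> ?special \<and> ?PZ f) F"
  define bX where "bX j i = ?l HX (Poly_Mapping.single 1 (d - j) + Poly_Mapping.single 2 i + Poly_Mapping.single 3 (j - i))" for j i
  define bY where "bY j i = ?l HY (Poly_Mapping.single 2 (d - j) + Poly_Mapping.single 3 i + Poly_Mapping.single 1 (j - i))" for j i
  define bZ where "bZ j i = ?l HZ (Poly_Mapping.single 3 (d - j) + Poly_Mapping.single 2 i + Poly_Mapping.single 1 (j - i))" for j i
  have distinct: "e (d - 1) 1 0 \<noteq> e 0 (d - 1) 1" "e (d - 1) 1 0 \<noteq> e 1 0 (d - 1)" "e 0 (d - 1) 1 \<noteq> e 1 0 (d - 1)"
    using d4 by (auto simp: e_inj)
  have "F = Poly_Mapping.single (e (d - 1) 1 0) 1 + Poly_Mapping.single (e 0 (d - 1) 1) 1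
      + Poly_Mapping.single (e 1 0 (d - 1)) \<alpha> + HX + HY + HZ" (is "F = ?R")
  proof (rule poly_mapping_eqI)
    fix f
    have "?l F (e (d - 1) 1 0) = 1" "?l F (e 0 (d - 1) 1) = 1" "?l F (e 1 0 (d - 1)) = \<alpha>"
      using xy yz zx by (simp_all add: cf_e)
    then show "?l F f = ?l ?R f"
      using distinct
      by (auto simp: lookup_add lookup_single when_def HX_def HY_def HZ_def lookup_restrict_monomials)
  qed
  also have "Poly_Mapping.single (e (d - 1) 1 0) 1 = (VX^(d-1) * VY :: 'a poly3)"
    unfolding Var_power unfolding Var_def by (simp add: mult_single e_def)
  also have "Poly_Mapping.single (e 0 (d - 1) 1) 1 = (VY^(d-1) * VZ :: 'a poly3)"
    unfolding Var_power unfolding Var_def by (simp add: mult_single e_def)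
  also have "Poly_Mapping.single (e 1 0 (d - 1)) \<alpha> = Const \<alpha> * VZ^(d-1) * VX"
    unfolding Var_power unfolding Var_def by (simp add: mult_single e_def Const_def add.commute)
  also have "HX = (\<Sum>j=2..(2*d) div 3. VX^(d-j) * (\<Sum>i\<in>S1_X j m a b.
      Const (?l HX (Poly_Mapping.single 1 (d - j) + Poly_Mapping.single 2 i + Poly_Mapping.single 3 (j - i))) * VY^i * VZ^(j-i)))"
  proof (rule homogeneous_expansion_restricted)
    show "homogeneous d HX" unfolding HX_def by (rule homogeneous_restrict_monomials[OF homog])
    fix i j assume ij: "j \<le> d" "i \<le> j"
      and nz: "?l HX (Poly_Mapping.single 1 (d - j) + Poly_Mapping.single 2 i + Poly_Mapping.single 3 (j - i)) \<noteq> 0"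
    then have nz: "?l HX (e (d - j) i (j - i)) \<noteq> 0" by (simp add: e_def)
    then have ns: "e (d - j) i (j - i) \<notin> ?special" and max: "?PX (e (d - j) i (j - i))"
      and cf: "cf F (d - j) i (j - i) \<noteq> 0"
      by (auto simp: HX_def lookup_restrict_monomials cf_e split: if_splits)
    have "j \<noteq> 0" using cf c ij by (intro notI) auto
    moreover have "j \<noteq> 1"
    proof
      assume "j = 1"
      then have "i = 0 \<or> i = 1" using ij by auto
      then show False using \<open>j = 1\<close> ns cf xy by auto
    qed
    \<comment> \<open>The two other exponents add up to \<open>j\<close> and are each at most
      \<open>d - j\<close>, so \<open>j \<le> 2 * (d - j)\<close>.\<close>
    moreover have "j \<le> (2 * d) div 3" using max ij by (auto simp: le less_eq_div_iff_mult_less_eq)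
    moreover have "[a * i + (j - i) * b = a] (mod m)"
      using cong_trans[OF wt[OF cf] wa] by (simp add: mult.commute)
    ultimately show "j \<in> {2..(2*d) div 3} \<and> i \<in> S1_X j m a b" using ij by (simp add: S1_X_def)
  qed (auto simp: S1_X_def)
  also have "HY = (\<Sum>j=2..(2*d) div 3. VY^(d-j) * (\<Sum>i\<in>S_Y d j m a b.
      Const (?l HY (Poly_Mapping.single 2 (d - j) + Poly_Mapping.single 3 i + Poly_Mapping.single 1 (j - i))) * VZ^i * VX^(j-i)))"
  proof (rule homogeneous_expansion_restricted)
    show "homogeneous d HY" unfolding HY_def by (rule homogeneous_restrict_monomials[OF homog])
    fix i j assume ij: "j \<le> d" "i \<le> j"
      and nz: "?l HY (Poly_Mapping.single 2 (d - j) + Poly_Mapping.single 3 i + Poly_Mapping.single 1 (j - i)) \<noteq> 0"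
    then have nz: "?l HY (e (j - i) (d - j) i) \<noteq> 0" by (simp add: e_def ac_simps)
    then have ns: "e (j - i) (d - j) i \<notin> ?special" and max: "?PY (e (j - i) (d - j) i)"
      and cf: "cf F (j - i) (d - j) i \<noteq> 0"
      by (auto simp: HY_def lookup_restrict_monomials cf_e split: if_splits)
    have "j \<noteq> 0" using cf c ij by (intro notI) auto
    moreover have "j \<noteq> 1"
    proof
      assume "j = 1"
      then have "i = 0 \<or> i = 1" using ij by auto
      then show False using \<open>j = 1\<close> ns cf yz by auto
    qed
    \<comment> \<open>As before: if \<open>?PX\<close> fails and the exponent of \<open>Y\<close> is
      at least that of \<open>Z\<close>, then the exponent of \<open>Y\<close> also exceeds that of
      \<open>X\<close>.\<close>
    moreover have "j \<le> (2 * d) div 3" using max ij by (auto simp: le less_eq_div_iff_mult_less_eq)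
    moreover have "[b * i + (d - j) * a = a] (mod m)"
      using cong_trans[OF wt[OF cf] wa] by (simp add: mult.commute add.commute)
    ultimately show "j \<in> {2..(2*d) div 3} \<and> i \<in> S_Y d j m a b" using ij by (simp add: S_Y_def)
  qed (auto simp: S_Y_def)
  also have "HZ = (\<Sum>j=2..(2*d) div 3. VZ^(d-j) * (\<Sum>i\<in>S_Z d j m a b.
      Const (?l HZ (Poly_Mapping.single 3 (d - j) + Poly_Mapping.single 2 i + Poly_Mapping.single 1 (j - i))) * VY^i * VX^(j-i)))"
  proof (rule homogeneous_expansion_restricted)
    show "homogeneous d HZ" unfolding HZ_def by (rule homogeneous_restrict_monomials[OF homog])
    fix i j assume ij: "j \<le> d" "i \<le> j"
      and nz: "?l HZ (Poly_Mapping.single 3 (d - j) + Poly_Mapping.single 2 i + Poly_Mapping.single 1 (j - i)) \<noteq> 0"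
    then have nz: "?l HZ (e (j - i) i (d - j)) \<noteq> 0" by (simp add: e_def ac_simps)
    then have ns: "e (j - i) i (d - j) \<notin> ?special" and max: "?PZ (e (j - i) i (d - j))"
      and cf: "cf F (j - i) i (d - j) \<noteq> 0"
      by (auto simp: HZ_def lookup_restrict_monomials cf_e split: if_splits)
    have "j \<noteq> 0" using cf c ij by (intro notI) auto
    moreover have "j \<noteq> 1"
    proof
      assume "j = 1"
      then have "i = 0 \<or> i = 1" using ij by auto
      then show False using \<open>j = 1\<close> ns cf zx by auto
    qed
    moreover have "j \<le> (2 * d) div 3" using max ij by (auto simp: le less_eq_div_iff_mult_less_eq)
    moreover have "[a * i + (d - j) * b = a] (mod m)"
      using cong_trans[OF wt[OF cf] wa] by (simp add: mult.commute)
    ultimately show "j \<in> {2..(2*d) div 3} \<and> i \<in> S_Z d j m a b" using ij by (simp add: S_Z_def)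
  qed (auto simp: S_Z_def)
  finally have "F = VX^(d-1) * VY + VY^(d-1) * VZ + Const \<alpha> * VZ^(d-1) * VX
     + (\<Sum>j=2..(2*d) div 3.
          VX^(d-j) * (\<Sum>i\<in>S1_X j m a b. Const (bX j i) * VY^i * VZ^(j-i))
        + VY^(d-j) * (\<Sum>i\<in>S_Y d j m a b. Const (bY j i) * VZ^i * VX^(j-i))
        + VZ^(d-j) * (\<Sum>i\<in>S_Z d j m a b. Const (bZ j i) * VX^(j-i) * VY^i))"
    by (simp add: bX_def bY_def bZ_def sum.distrib mult_ac add_ac)
  then show ?thesis by (intro exI[of _ bX] exI[of _ bY] exI[of _ bZ])
qed

section \<open>Choosing the weights\<close>

text \<open>Units modulo a divisor \<open>m'\<close> of \<open>m\<close> lift to units modulo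
  \<open>m\<close>. In the witness \<open>r + k * m'\<close>, \<open>k\<close> is the product of the
  primes of \<open>m\<close> that do not divide \<open>r\<close>. A prime of \<open>m\<close>
  dividing \<open>r\<close> divides neither \<open>k\<close> nor \<open>m'\<close>; one not dividing
  \<open>r\<close> divides \<open>k\<close>. In both cases it divides exactly one summand.\<close>

lemma coprime_lift:
  fixes r m m' :: nat
  assumes "0 < m" "m' dvd m" "coprime r m'"
  obtains t where "[t = r] (mod m')" "coprime t m"
proof
  define k where "k = \<Prod>{p \<in> prime_factors m. \<not> p dvd r}"
  show "[r + k * m' = r] (mod m')" by (simp add: cong_def)
  have fin: "finite {p \<in> prime_factors m. \<not> p dvd r}" by simp
  show "coprime (r + k * m') m"
  proof (rule ccontr)
    assume "\<not> coprime (r + k * m') m"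
    then have "gcd (r + k * m') m \<noteq> 1" by (simp add: coprime_iff_gcd_eq_1)
    then obtain p where p: "prime p" "p dvd r + k * m'" "p dvd m"
      using prime_factor_nat by (metis gcd_nat.bounded_iff)
    show False
    proof (cases "p dvd r")
      case True
      then have "p dvd k * m'" using p(2) by (simp add: dvd_add_right_iff)
      moreover have "\<not> p dvd m'"
        using True assms(3) p(1) by (metis coprime_common_divisor not_prime_unit)
      ultimately have "p dvd k" using p(1) by (simp add: prime_dvd_mult_iff)
      then obtain q where q: "q \<in> prime_factors m" "\<not> q dvd r" "p dvd q"
        using prime_dvd_prod_iff[OF fin p(1), of "\<lambda>q. q"] by (auto simp: k_def)
      then have "p = q" using p(1) by (metis in_prime_factors_imp_prime primes_dvd_imp_eq)
      with q True show False by blast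
    next
      case False
      then have "p \<in> {p \<in> prime_factors m. \<not> p dvd r}"
        using p assms(1) by (simp add: in_prime_factors_iff)
      then have "p dvd k" unfolding k_def using dvd_prodI[OF fin, of p "\<lambda>q. q"] by simp
      then have "p dvd r" using p(2) by (metis dvd_add_left_iff dvd_mult2)
      with False show False by blast
    qed
  qed
qed

lemma factor_eq_1:
  fixes m h k :: nat
  assumes "0 < m" "m = h * k" "m dvd k"
  shows "h = 1"
proof -
  have "0 < k" using assms(1,2) by (cases k) auto
  moreover have "h * k dvd k" using assms(2,3) by simp
  ultimately show ?thesis by simp
qed

text \<open>With \<open>g = gcd A m\<close>, an inverse of \<open>A / g\<close> modulo
  \<open>m / g\<close> does the job, except that it may share factors with \<open>m\<close>. Hence
  the lift to a unit modulo \<open>m\<close>.\<close>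

lemma unit_multiple_eq_gcd:
  fixes A m :: nat
  assumes "0 < m"
  obtains t where "coprime t m" "[t * A = gcd A m] (mod m)"
proof -
  define g where "g = gcd A m"
  have "0 < g" using assms by (simp add: g_def)
  obtain A' m' where A': "A = A' * g" "m = m' * g" "coprime A' m'"
    using gcd_coprime_exists[of A m] assms by (metis g_def gcd_eq_0_iff less_numeral_extra(3))
  obtain r where r: "[A' * r = 1] (mod m')"
    using cong_solve_coprime_nat[OF A'(3)] by auto
  then have "[r * A' = Suc 0] (mod m')" by (simp add: mult.commute)
  then have "coprime r m'" unfolding coprime_iff_invertible_nat by blast
  then obtain t where t: "[t = r] (mod m')" "coprime t m"
    using coprime_lift[OF assms, of m' r] A'(2) by auto
  have "[t * A' = 1] (mod m')"
    using cong_trans[OF cong_mult[OF t(1) cong_refl] r[unfolded mult.commute[of A']]] .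
  then have "[t * A' * g = 1 * g] (mod (m' * g))"
    by (simp add: cong_def mult_mod_left flip: mod_mult_mult2)
  then have "[t * A = g] (mod m)"
    by (simp only: mult.assoc A'(1)[symmetric] A'(2)[symmetric] mult_1)
  then show thesis using that[OF t(2)] by (simp only: g_def)
qed

abbreviation standard_weights :: "nat \<Rightarrow> nat \<Rightarrow> 3 \<Rightarrow> nat" where
  "standard_weights a b \<equiv> \<lambda>i. if i = 1 then 0 else if i = 2 then a else b"

text \<open>Making the second weight equal to \<open>gcd A m\<close> ensures that the gcd
  \<open>h\<close> of the two nonzero weights divides \<open>m\<close>. Then \<open>m / h\<close>
  annihilates all weights modulo \<open>m\<close>, so the order condition gives
  \<open>m dvd m / h\<close> and \<open>h = 1\<close>.\<close>

lemma diagonal_action_weights_Gamma: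
  assumes prim: "primitive_root_of_unity m \<zeta>" and act: "diagonal_action d m \<zeta> F G w"
    and w: "\<And>i j. i \<noteq> j \<Longrightarrow> \<not> [w i = w j] (mod m)"
  obtains a b where "(a, b) \<in> Gamma_pairs m" "diagonal_action d m \<zeta> F G (standard_weights a b)"
proof -
  have m: "0 < m" using prim by (simp add: primitive_root_of_unity_def)
  \<comment> \<open>Adding this amount subtracts \<open>w 1\<close> modulo \<open>m\<close> while
    staying in the natural numbers.\<close>
  define s where "s = (m - 1) * w 1"
  have shift1: "w 1 + s = m * w 1" using m by (cases m) (simp_all add: s_def)
  define A B where "A = w 2 + s" and "B = w 3 + s"
  have cancel: "[w i + s = w j + s] (mod m) \<longleftrightarrow> i = j" for i j
    using w[of i j] by (auto simp: cong_add_rcancel_nat)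
  obtain t where t: "coprime t m" "[t * A = gcd A m] (mod m)"
    using unit_multiple_eq_gcd[OF m] by blast
  define w' where "w' i = (t * (w i + s)) mod m" for i
  have w'_cong: "[w' i = t * (w i + s)] (mod m)" for i by (simp add: w'_def)
  have w'_eq: "w' i = w' j \<longleftrightarrow> i = j" for i j
  proof -
    have "w' i = w' j \<longleftrightarrow> [t * (w i + s) = t * (w j + s)] (mod m)"
      by (simp add: w'_def cong_def)
    also have "\<dots> \<longleftrightarrow> i = j" using cong_mult_lcancel_nat[OF t(1)] cancel by simp
    finally show ?thesis .
  qed
  have w'1: "w' 1 = 0" unfolding w'_def shift1 by simp
  have w'_less: "w' i < m" for i using m by (simp add: w'_def)
  have act': "diagonal_action d m \<zeta> F G w'"
    by (rule diagonal_action_change_weights[OF prim act t(1) w'_cong])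
  have pos: "0 < w' 2" "0 < w' 3" using w'_eq[of 2 1] w'_eq[of 3 1] w'1 by auto
  have "w' 2 = gcd A m"
  proof -
    have "[w' 2 = gcd A m] (mod m)" using cong_trans[OF w'_cong[of 2, folded A_def] t(2)] .
    \<comment> \<open>Equality would make the first two weights congruent. Being below
      \<open>m\<close>, the gcd is the reduced residue itself.\<close>
    moreover have "gcd A m < m"
    proof (rule ccontr)
      assume "\<not> gcd A m < m"
      then have "gcd A m = m" using m by (meson dvd_imp_le gcd_dvd2 le_neq_implies_less)
      then have "m dvd A" by (metis gcd_dvd1)
      then have "[w 2 + s = w 1 + s] (mod m)" unfolding shift1 A_def[symmetric] by (simp add: cong_def)
      then show False by (simp add: cancel)
    qed
    ultimately show ?thesis using w'_less[of 2] by (simp add: cong_def)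
  qed
  define h where "h = gcd (w' 2) (w' 3)"
  have h: "h dvd w' 2" "h dvd w' 3" by (simp_all add: h_def)
  then have "h dvd m" using \<open>w' 2 = gcd A m\<close> by (metis dvd_trans gcd_dvd2)
  then obtain k where k: "m = h * k" by blast
  have "m dvd k"
  proof -
    have "[k * w' i = 0] (mod m)" for i
    proof -
      have "h dvd w' i" using exhaust_3[of i] h w'1 by auto
      then show ?thesis unfolding cong_0_iff k by (metis mult.commute mult_dvd_mono dvd_refl)
    qed
    then have "\<forall>i j. [k * w' i = k * w' j] (mod m)" by (meson cong_sym cong_trans)
    then show ?thesis using act' unfolding diagonal_action_def by blast
  qed
  then have "h = 1" by (rule factor_eq_1[OF m k])
  then have "coprime (w' 2) (w' 3)" by (simp add: h_def coprime_iff_gcd_eq_1)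
  then have "(w' 2, w' 3) \<in> Gamma_pairs m"
    using pos w'_less[of 2] w'_less[of 3] w'_eq[of 2 3] by (auto simp: Gamma_pairs_def)
  moreover have "standard_weights (w' 2) (w' 3) = w'"
  proof
    fix i show "standard_weights (w' 2) (w' 3) i = w' i" using exhaust_3[of i] w'1 by auto
  qed
  ultimately show thesis using that[of "w' 2" "w' 3"] act' by simp
qed

text \<open>After the shift the first two weights are 0 and the third is \<open>B\<close>. The order
  condition makes \<open>B\<close> a unit modulo \<open>m\<close>, and multiplying by its inverse
  turns it into 1.\<close>

lemma diagonal_action_weights_homology:
  assumes prim: "primitive_root_of_unity m \<zeta>" and act: "diagonal_action d m \<zeta> F G w"
    and w: "[w 1 = w 2] (mod m)"
  shows "diagonal_action d m \<zeta> F G (standard_weights 0 1)"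
proof -
  have m: "0 < m" using prim by (simp add: primitive_root_of_unity_def)
  define s where "s = (m - 1) * w 1"
  have shift1: "w 1 + s = m * w 1" using m by (cases m) (simp_all add: s_def)
  define B where "B = w 3 + s"
  obtain k where k: "m = gcd B m * k" by (rule dvdE[OF gcd_dvd2])
  have "m dvd k"
  proof -
    have 3: "[k * w 3 = k * w 1] (mod m)"
    proof -
      have "m dvd k * B" using k by (metis dvd_refl gcd_dvd1 mult.commute mult_dvd_mono)
      then have "[k * w 3 + k * s = k * w 1 + k * s] (mod m)"
        unfolding distrib_left[symmetric] B_def[symmetric] shift1 by (simp add: cong_def)
      then show ?thesis by (simp add: cong_add_rcancel_nat)
    qed
    have 2: "[k * w 2 = k * w 1] (mod m)" by (rule cong_mult[OF cong_refl cong_sym[OF w]])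
    have "[k * w i = k * w 1] (mod m)" for i
      using exhaust_3[of i] 2 3 by auto
    then have "\<forall>i j. [k * w i = k * w j] (mod m)" by (meson cong_sym cong_trans)
    then show ?thesis using act unfolding diagonal_action_def by blast
  qed
  then have "gcd B m = 1" by (rule factor_eq_1[OF m k])
  then have "coprime B m" by (simp add: coprime_iff_gcd_eq_1)
  then obtain t where t: "[B * t = 1] (mod m)" using cong_solve_coprime_nat by auto
  then have "[t * B = Suc 0] (mod m)" by (simp add: mult.commute)
  then have "coprime t m" unfolding coprime_iff_invertible_nat by blast
  show ?thesis
  proof (rule diagonal_action_change_weights[OF prim act \<open>coprime t m\<close>])
    fix i :: 3
    have 1: "[0 = t * (w 1 + s)] (mod m)" unfolding shift1 by (simp add: cong_def)
    have 2: "[0 = t * (w 2 + s)] (mod m)"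
      by (rule cong_trans[OF 1]) (intro cong_mult cong_add cong_refl w)
    have 3: "[1 = t * (w 3 + s)] (mod m)" using cong_sym[OF t] by (simp add: B_def mult.commute)
    show "[standard_weights 0 1 i = t * (w i + s)] (mod m)"
      using exhaust_3[of i] 1 2 3 by auto
  qed
qed

text \<open>The change of coordinates is a permutation matrix, so coefficients are only relabelled.
  The last conclusion, with exponents \<open>d - 1\<close> and 1, transports the leading monomials
  and hence the map \<open>T\<close>.\<close>

lemma diagonal_action_reorder:
  fixes F :: "'a::field poly3"
  assumes prim: "primitive_root_of_unity m \<zeta>" and act: "diagonal_action d m \<zeta> F G w"
    and distinct: "u \<noteq> v" "v \<noteq> t" "u \<noteq> t"
  obtains Q \<tau> where "invertible Q" "inj \<tau>" "\<tau> u = 1" "\<tau> v = 2" "\<tau> t = 3"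
    "diagonal_action d m \<zeta> (lin_subst F Q) (conj_by Q G) (\<lambda>i. if i = 1 then w u else if i = 2 then w v else w t)"
    "\<And>i k p q. Poly_Mapping.lookup (lin_subst F Q) (Poly_Mapping.single (\<tau> i) p + Poly_Mapping.single (\<tau> k) q) =
        Poly_Mapping.lookup F (Poly_Mapping.single i p + Poly_Mapping.single k q)"
proof -
  define \<tau> :: "3 \<Rightarrow> 3" where "\<tau> x = (if x = u then 1 else if x = v then 2 else 3)" for x
  have \<tau>: "\<tau> u = 1" "\<tau> v = 2" "\<tau> t = 3" using distinct by (auto simp: \<tau>_def)
  have uvt: "x = u \<or> x = v \<or> x = t" for x using UNIV_3_distinct[OF distinct] by auto
  have "inj \<tau>"
  proof (rule injI)
    fix x y assume "\<tau> x = \<tau> y"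
    then show "x = y" using uvt[of x] uvt[of y] \<tau> by auto
  qed
  let ?Q = "monomial_matrix \<tau> (\<lambda>_. 1 :: 'a)"
  let ?w = "\<lambda>i::3. if i = 1 then w u else if i = 2 then w v else w t"
  have "?w (\<tau> i) = w i" for i using uvt[of i] \<tau> by auto
  then have "diagonal_action d m \<zeta> (lin_subst F ?Q) (conj_by ?Q G) ?w"
    by (intro diagonal_action_monomial_change[OF prim act \<open>inj \<tau>\<close>]) auto
  moreover have "invertible ?Q" by (rule invertible_monomial_matrix[OF \<open>inj \<tau>\<close>]) simp
  moreover have "Poly_Mapping.lookup (lin_subst F ?Q) (Poly_Mapping.single (\<tau> i) p + Poly_Mapping.single (\<tau> k) q) =
        Poly_Mapping.lookup F (Poly_Mapping.single i p + Poly_Mapping.single k q)" for i k p q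
    by (simp add: lookup_lin_subst_monomial_matrix[OF \<open>inj \<tau>\<close>] map_key_plus[OF \<open>inj \<tau>\<close>]
        map_key_single[OF \<open>inj \<tau>\<close>])
  ultimately show thesis using that \<open>inj \<tau>\<close> \<tau> by blast
qed

section \<open>The normal forms\<close>

text \<open>The eight predicates repeat the disjuncts of the theorem literally, so that it is
  recovered from them by unfolding.\<close>

definition type_1 :: "nat \<Rightarrow> nat \<Rightarrow> 'a::field \<Rightarrow> 'a poly3 \<Rightarrow> ('a^3^3) set set \<Rightarrow> bool" where
  "type_1 d m \<zeta> F' G' \<longleftrightarrow>
    m dvd d - 1 \<and> of_type \<zeta> 0 1 G' \<and>
    (\<exists>L. (\<forall>j. homogeneous j (L j) \<and> not_involving 3 (L j)) \<and>
      defined_by F'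
        (VZ^(d-1) * L 1 + (\<Sum>j\<in>S_hom 2 d m. VZ^(d-j) * L j) + L d))"

definition type_2 :: "nat \<Rightarrow> nat \<Rightarrow> 'a::field \<Rightarrow> 'a poly3 \<Rightarrow> ('a^3^3) set set \<Rightarrow> bool" where
  "type_2 d m \<zeta> F' G' \<longleftrightarrow>
    m dvd d \<and> of_type \<zeta> 0 1 G' \<and>
    (\<exists>L. (\<forall>j. homogeneous j (L j) \<and> not_involving 3 (L j)) \<and>
      defined_by F'
        (VZ^d + (\<Sum>j\<in>S_hom 1 d m. VZ^(d-j) * L j) + L d))"

definition type_3 :: "nat \<Rightarrow> nat \<Rightarrow> 'a::field \<Rightarrow> 'a poly3 \<Rightarrow> ('a^3^3) set set \<Rightarrow> bool" where
  "type_3 d m \<zeta> F' G' \<longleftrightarrow>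
    card (ref_points_on F') = 3 \<and> m dvd d^2 - 3*d + 3 \<and>
    (\<exists>a b. (a, b) \<in> Gamma_pairs m \<and> of_type \<zeta> a b G' \<and>
      [a = (d-1)*a + b] (mod m) \<and> [(d-1)*a + b = (d-1)*b] (mod m) \<and>
      (\<exists>\<alpha> \<beta> \<alpha>' \<gamma>. \<alpha> \<noteq> 0 \<and>
        defined_by F'
          (VX^(d-1) * VY + VY^(d-1) * VZ + Const \<alpha> * VZ^(d-1) * VX
           + (\<Sum>j=2..(2*d) div 3.
                VX^(d-j) * (\<Sum>i\<in>S1_X j m a b. Const (\<beta> j i) * VY^i * VZ^(j-i))
              + VY^(d-j) * (\<Sum>i\<in>S_Y d j m a b. Const (\<alpha>' j i) * VZ^i * VX^(j-i))
              + VZ^(d-j) * (\<Sum>i\<in>S_Z d j m a b. Const (\<gamma> j i) * VX^(j-i) * VY^i)))))"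

definition type_4_1 :: "nat \<Rightarrow> nat \<Rightarrow> 'a::field \<Rightarrow> 'a poly3 \<Rightarrow> ('a^3^3) set set \<Rightarrow> bool" where
  "type_4_1 d m \<zeta> F' G' \<longleftrightarrow>
    card (ref_points_on F') = 2 \<and> m dvd d * (d-2) \<and>
    (\<exists>a b. (a, b) \<in> Gamma_pairs m \<and> of_type \<zeta> a b G' \<and>
      [(d-1)*a + b = 0] (mod m) \<and> [a + (d-1)*b = 0] (mod m) \<and>
      (\<exists>\<alpha> \<beta>. \<alpha> \<noteq> 0 \<and>
        defined_by F'
          (VX^d
           + (\<Sum>j=2..d-1. VX^(d-j) * (\<Sum>i\<in>S2_X j m a b. Const (\<beta> j i) * VY^i * VZ^(j-i)))
           + VY^(d-1) * VZ + Const \<alpha> * VY * VZ^(d-1)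
           + (\<Sum>i\<in>S_d_X 2 d m a b. Const (\<beta> d i) * VY^i * VZ^(d-i)))))"

definition type_4_2 :: "nat \<Rightarrow> nat \<Rightarrow> 'a::field \<Rightarrow> 'a poly3 \<Rightarrow> ('a^3^3) set set \<Rightarrow> bool" where
  "type_4_2 d m \<zeta> F' G' \<longleftrightarrow>
    card (ref_points_on F') = 2 \<and> m dvd (d-1)^2 \<and>
    (\<exists>a b. (a, b) \<in> Gamma_pairs m \<and> of_type \<zeta> a b G' \<and>
      [(d-1)*a + b = 0] (mod m) \<and> [(d-1)*b = 0] (mod m) \<and>
      (\<exists>\<alpha> \<beta>. \<alpha> \<noteq> 0 \<and>
        defined_by F'
          (VX^d
           + (\<Sum>j=2..d-2. VX^(d-j) * (\<Sum>i\<in>S2_X j m a b. Const (\<beta> j i) * VY^i * VZ^(j-i)))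
           + VX * (Const \<alpha> * VZ^(d-1)
              + (\<Sum>i\<in>S_d1_X 1 d m a b. Const (\<beta> (d-1) i) * VY^i * VZ^(d-1-i)))
           + VY^(d-1) * VZ
           + (\<Sum>i\<in>S_d_X 2 d m a b. Const (\<beta> d i) * VY^i * VZ^(d-i)))))"

definition type_4_3 :: "nat \<Rightarrow> nat \<Rightarrow> 'a::field \<Rightarrow> 'a poly3 \<Rightarrow> ('a^3^3) set set \<Rightarrow> bool" where
  "type_4_3 d m \<zeta> F' G' \<longleftrightarrow>
    card (ref_points_on F') = 2 \<and> m dvd d - 1 \<and>
    (\<exists>a b. (a, b) \<in> Gamma_pairs m \<and> of_type \<zeta> a b G' \<and>
      [(d-1)*b = 0] (mod m) \<and> [(d-1)*a = 0] (mod m) \<and>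
      (\<exists>\<alpha> \<beta>. \<alpha> \<noteq> 0 \<and>
        defined_by F'
          (VX^d
           + (\<Sum>j=2..d-2. VX^(d-j) * (\<Sum>i\<in>S2_X j m a b. Const (\<beta> j i) * VY^i * VZ^(j-i)))
           + (\<Sum>i\<in>S_d_X 2 d m a b. Const (\<beta> d i) * VY^i * VZ^(d-i))
           + VX * (VZ^(d-1) + Const \<alpha> * VY^(d-1)
              + (\<Sum>i\<in>S_d1_X 2 d m a b. Const (\<beta> (d-1) i) * VY^i * VZ^(d-1-i))))))"

definition type_5 :: "nat \<Rightarrow> nat \<Rightarrow> 'a::field \<Rightarrow> 'a poly3 \<Rightarrow> ('a^3^3) set set \<Rightarrow> bool" where
  "type_5 d m \<zeta> F' G' \<longleftrightarrow>
    card (ref_points_on F') = 1 \<and> m dvd d * (d-1) \<and>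
    (\<exists>a b. (a, b) \<in> Gamma_pairs m \<and> of_type \<zeta> a b G' \<and>
      [d*a = 0] (mod m) \<and> [(d-1)*b = 0] (mod m) \<and>
      (\<exists>\<alpha> \<beta>. \<alpha> \<noteq> 0 \<and>
        defined_by F'
          (VX^d + VY^d
           + (\<Sum>j=2..d-2. VX^(d-j) * (\<Sum>i\<in>S2_X j m a b. Const (\<beta> j i) * VY^i * VZ^(j-i)))
           + (\<Sum>i\<in>S_d_X 1 d m a b. Const (\<beta> d i) * VY^i * VZ^(d-i))
           + VX * (Const \<alpha> * VZ^(d-1)
              + (\<Sum>i\<in>S_d1_X 1 d m a b. Const (\<beta> (d-1) i) * VY^i * VZ^(d-1-i))))))"

definition type_6 :: "nat \<Rightarrow> nat \<Rightarrow> 'a::field \<Rightarrow> 'a poly3 \<Rightarrow> ('a^3^3) set set \<Rightarrow> bool" where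
  "type_6 d m \<zeta> F' G' \<longleftrightarrow>
    card (ref_points_on F') = 0 \<and> m dvd d \<and>
    (\<exists>a b. (a, b) \<in> Gamma_pairs m \<and> of_type \<zeta> a b G' \<and>
      [d*a = 0] (mod m) \<and> [d*b = 0] (mod m) \<and>
      (\<exists>\<beta>.
        defined_by F'
          (VX^d + VY^d + VZ^d
           + (\<Sum>j=2..d-1. VX^(d-j) * (\<Sum>i\<in>S2_X j m a b. Const (\<beta> j i) * VY^i * VZ^(j-i)))
           + (\<Sum>i\<in>S_d_X 1 d m a b. Const (\<beta> d i) * VY^i * VZ^(d-i)))))"

definition classified :: "nat \<Rightarrow> nat \<Rightarrow> 'a::field \<Rightarrow> 'a poly3 \<Rightarrow> ('a^3^3) set set \<Rightarrow> bool" where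
  "classified d m \<zeta> F G \<longleftrightarrow> (\<exists>P. invertible P \<and>
    (type_1 d m \<zeta> (lin_subst F P) (conj_by P G) \<or>
     type_2 d m \<zeta> (lin_subst F P) (conj_by P G) \<or>
     type_3 d m \<zeta> (lin_subst F P) (conj_by P G) \<or>
     type_4_1 d m \<zeta> (lin_subst F P) (conj_by P G) \<or>
     type_4_2 d m \<zeta> (lin_subst F P) (conj_by P G) \<or>
     type_4_3 d m \<zeta> (lin_subst F P) (conj_by P G) \<or>
     type_5 d m \<zeta> (lin_subst F P) (conj_by P G) \<or>
     type_6 d m \<zeta> (lin_subst F P) (conj_by P G)))"

text \<open>Changes of coordinates compose, so the classification may be carried out after any
  preliminary change.\<close>

lemma classified_transport:
  assumes "G \<subseteq> carrier PGL3" "invertible Q" "classified d m \<zeta> (lin_subst F Q) (conj_by Q G)"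
  shows "classified d m \<zeta> F G"
proof -
  obtain P where "invertible P" and "type_1 d m \<zeta> (lin_subst F (Q ** P)) (conj_by (Q ** P) G) \<or>
     type_2 d m \<zeta> (lin_subst F (Q ** P)) (conj_by (Q ** P) G) \<or>
     type_3 d m \<zeta> (lin_subst F (Q ** P)) (conj_by (Q ** P) G) \<or>
     type_4_1 d m \<zeta> (lin_subst F (Q ** P)) (conj_by (Q ** P) G) \<or>
     type_4_2 d m \<zeta> (lin_subst F (Q ** P)) (conj_by (Q ** P) G) \<or>
     type_4_3 d m \<zeta> (lin_subst F (Q ** P)) (conj_by (Q ** P) G) \<or>
     type_5 d m \<zeta> (lin_subst F (Q ** P)) (conj_by (Q ** P) G) \<or>
     type_6 d m \<zeta> (lin_subst F (Q ** P)) (conj_by (Q ** P) G)"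
    using assms(3) conj_by_conj_by[OF assms(2) _ assms(1)] unfolding classified_def lin_subst_lin_subst by metis
  then show ?thesis
    unfolding classified_def using invertible_mult[OF assms(2)] by blast
qed

section \<open>Curves in standard position\<close>

text \<open>\<open>m\<close> divides the gcd of the two multiples, which is \<open>x\<close> times
  the gcd of \<open>a\<close> and \<open>b\<close>. All divisibility conditions on \<open>m\<close>
  in (3) to (6) are obtained in this way.\<close>

lemma dvd_of_dvd_mult_coprime:
  fixes a b m x :: nat
  assumes "m dvd x * a" "m dvd x * b" "coprime a b"
  shows "m dvd x"
proof -
  have "m dvd gcd (x * a) (x * b)" using assms by simp
  then show ?thesis using assms(3) by (simp add: gcd_mult_distrib_nat[symmetric] coprime_iff_gcd_eq_1)
qed

text \<open>
  The map \<open>T\<close> sends \<open>i\<close> to the index \<open>k\<close> of the unique monomial \<open>x\<^sub>i\<^sup>d\<^sup>-\<^sup>1 x\<^sub>k\<close> that occurs in \<open>F\<close>;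
  its fixed points are the reference points off the curve.
\<close>

locale standard_position =
  fixes d m a b :: nat and \<zeta> :: "'a::{alg_closed_field,field_char_0}"
    and F :: "'a poly3" and G :: "('a^3^3) set set" and T :: "3 \<Rightarrow> 3"
  assumes d4: "4 \<le> d" and prim: "primitive_root_of_unity m \<zeta>"
    and act: "diagonal_action d m \<zeta> F G (standard_weights a b)"
    and gamma: "(a, b) \<in> Gamma_pairs m"
    and T: "Poly_Mapping.lookup F (Poly_Mapping.single i (d - 1) + Poly_Mapping.single k 1) \<noteq> 0 \<longleftrightarrow> k = T i"
begin

lemma homog: "homogeneous d F" and nonsing: "nonsingular F"
  using act by (auto simp: diagonal_action_def)

lemma coprime_ab: "coprime a b" using gamma by (simp add: Gamma_pairs_def)

lemma weights: obtains c where "\<And>i j k. cf F i j k \<noteq> 0 \<Longrightarrow> [a * j + b * k = c] (mod m)"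
proof -
  obtain c where c: "\<And>e. e \<in> Poly_Mapping.keys F \<Longrightarrow>
      [(\<Sum>i\<in>UNIV. standard_weights a b i * Poly_Mapping.lookup e i) = c] (mod m)"
    using act by (auto simp: diagonal_action_def)
  have "[a * j + b * k = c] (mod m)" if "cf F i j k \<noteq> 0" for i j k
    using c[of "Poly_Mapping.single 1 i + Poly_Mapping.single 2 j + Poly_Mapping.single 3 k"] that
    by (simp add: in_keys_iff cf_def sum_3 lookup_add lookup_single)
  then show thesis by (rule that)
qed

lemma lookup_power: "Poly_Mapping.lookup F (Poly_Mapping.single i d) \<noteq> 0 \<longleftrightarrow> T i = i"
  using T[of i i] d4 by (auto simp flip: single_add)

lemma cf_power: "cf F d 0 0 \<noteq> 0 \<longleftrightarrow> T 1 = 1" "cf F 0 d 0 \<noteq> 0 \<longleftrightarrow> T 2 = 2" "cf F 0 0 d \<noteq> 0 \<longleftrightarrow> T 3 = 3"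
  using lookup_power by (auto simp: cf_def)

lemma cf_T:
  "cf F (d - 1) 1 0 \<noteq> 0 \<longleftrightarrow> T 1 = 2" "cf F (d - 1) 0 1 \<noteq> 0 \<longleftrightarrow> T 1 = 3"
  "cf F 1 (d - 1) 0 \<noteq> 0 \<longleftrightarrow> T 2 = 1" "cf F 0 (d - 1) 1 \<noteq> 0 \<longleftrightarrow> T 2 = 3"
  "cf F 1 0 (d - 1) \<noteq> 0 \<longleftrightarrow> T 3 = 1" "cf F 0 1 (d - 1) \<noteq> 0 \<longleftrightarrow> T 3 = 2"
  using T[of 1 2] T[of 1 3] T[of 2 1] T[of 2 3] T[of 3 1] T[of 3 2]
  by (auto simp: cf_def add.commute)

text \<open>The free parameters are the scalings \<open>y\<close> and \<open>z\<close> of two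
  coordinates and the overall factor \<open>\<kappa>\<close> absorbed by \<open>defined_by\<close>.
  A diagonal change commutes with the generator and fixes the reference points, so type and position
  are preserved.\<close>

lemma normalise:
  assumes "y \<noteq> 0" "z \<noteq> 0" "\<kappa> \<noteq> 0"
    and c: "\<forall>i j k. cf F i j k \<noteq> 0 \<longrightarrow> [a * j + b * k = c] (mod m)"
  obtains N H where "invertible N" "weighted_curve d m a b c H" "defined_by (lin_subst F N) H"
    "of_type \<zeta> a b (conj_by N G)" "ref_points_on (lin_subst F N) = {i. T i \<noteq> i}"
    "\<And>i j k. cf H i j k = y ^ j * z ^ k * cf F i j k / \<kappa>"
proof -
  define s where "s i = (if i = 1 then 1 else if i = 2 then y else z)" for i :: 3
  have s0: "s i \<noteq> 0" for i using assms by (simp add: s_def)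
  define N where "N = diagonal_matrix s"
  define H where "H = Const (1 / \<kappa>) * lin_subst F N"
  have act': "diagonal_action d m \<zeta> (lin_subst F N) (conj_by N G) (standard_weights a b)"
    unfolding N_def by (rule diagonal_action_monomial_change[OF prim act _ s0]) auto
  have inv: "invertible N" unfolding N_def by (rule invertible_monomial_matrix[OF _ s0]) simp
  have lookupN: "Poly_Mapping.lookup (lin_subst F N) e = (\<Prod>i\<in>UNIV. s i ^ Poly_Mapping.lookup e i) * Poly_Mapping.lookup F e" for e
    using lookup_lin_subst_monomial_matrix[of "\<lambda>i. i" F s e] by (simp add: N_def map_key_id)
  have cfH: "cf H i j k = y ^ j * z ^ k * cf F i j k / \<kappa>" for i j k
    by (simp add: cf_def H_def Const_times_lookup lookupN prod_UNIV_3 lookup_add lookup_single s_def)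
  have homN: "homogeneous d (lin_subst F N)" using act' by (simp add: diagonal_action_def)
  have "homogeneous d H"
    using homogeneous_mult[OF homogeneous_Const homN] by (simp add: H_def)
  then have "weighted_curve d m a b c H"
    using d4 gamma c cfH by unfold_locales auto
  moreover have "lin_subst F N = Const \<kappa> * H"
    using assms(3) by (simp add: H_def flip: mult.assoc Const_mult)
  then have "defined_by (lin_subst F N) H" using assms(3) by (auto simp: defined_by_def)
  moreover have "of_type \<zeta> a b (conj_by N G)"
    using act' diag3_eq_diagonal_matrix[of "\<lambda>i. \<zeta> ^ standard_weights a b i"]
    by (simp add: of_type_def diagonal_action_def)
  moreover have "ref_points_on (lin_subst F N) = {i. T i \<noteq> i}"
    using lookup_power s0 by (auto simp: ref_points_on_def eval3_axis[OF homN] lookupN)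
  ultimately show thesis using that inv cfH by blast
qed

lemma not_fixed_points: "{i. T i \<noteq> i} = (if T 1 = 1 then {} else {1}) \<union> (if T 2 = 2 then {} else {2})
    \<union> (if T 3 = 3 then {} else {3})" (is "_ = ?R")
proof -
  have "x \<in> {i. T i \<noteq> i} \<longleftrightarrow> x \<in> ?R" for x using exhaust_3[of x] by (elim disjE) auto
  then show ?thesis by blast
qed

lemma classifiedI:
  assumes "invertible P"
    and "type_3 d m \<zeta> (lin_subst F P) (conj_by P G) \<or>
     type_4_1 d m \<zeta> (lin_subst F P) (conj_by P G) \<or>
     type_4_2 d m \<zeta> (lin_subst F P) (conj_by P G) \<or>
     type_4_3 d m \<zeta> (lin_subst F P) (conj_by P G) \<or>
     type_5 d m \<zeta> (lin_subst F P) (conj_by P G) \<or>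
     type_6 d m \<zeta> (lin_subst F P) (conj_by P G)"
  shows "classified d m \<zeta> F G"
  unfolding classified_def using assms by blast

lemma weights_X:
  assumes "T 1 = 1" "cf F i j k \<noteq> 0"
  shows "[a * j + b * k = 0] (mod m)"
proof -
  obtain c where c: "\<And>i j k. cf F i j k \<noteq> 0 \<Longrightarrow> [a * j + b * k = c] (mod m)" using weights by blast
  have "[0 = c] (mod m)" using c[of d 0 0] cf_power(1) assms(1) by simp
  then show ?thesis using c[OF assms(2)] by (metis cong_sym cong_trans)
qed

lemma normalise_X:
  assumes "T 1 = 1" "y \<noteq> 0" "z \<noteq> 0"
  obtains N H where "invertible N" "weighted_curve_X d m a b 0 H" "defined_by (lin_subst F N) H"
    "of_type \<zeta> a b (conj_by N G)" "ref_points_on (lin_subst F N) = {i. T i \<noteq> i}"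
    "\<And>i j k. cf H i j k = y ^ j * z ^ k * cf F i j k / cf F d 0 0"
proof -
  have X: "cf F d 0 0 \<noteq> 0" using cf_power(1) assms(1) by simp
  have "\<forall>i j k. cf F i j k \<noteq> 0 \<longrightarrow> [a * j + b * k = 0] (mod m)"
    using weights_X[OF assms(1)] by blast
  from normalise[OF assms(2,3) X this] obtain N H where N: "invertible N" "weighted_curve d m a b 0 H"
    "defined_by (lin_subst F N) H" "of_type \<zeta> a b (conj_by N G)"
    "ref_points_on (lin_subst F N) = {i. T i \<noteq> i}"
    and H: "\<And>i j k. cf H i j k = y ^ j * z ^ k * cf F i j k / cf F d 0 0" by blast
  have "weighted_curve_X d m a b 0 H"
    using N(2) X by (intro weighted_curve_X.intro weighted_curve_X_axioms.intro) (simp_all add: H)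
  with N H show thesis using that by blast
qed

lemma nth_root:
  assumes "0 < n" "x \<noteq> 0"
  obtains z :: 'a where "z ^ n = x" "z \<noteq> 0"
  using nth_root_exists[OF assms(1), of x] assms by (metis zero_power)

section \<open>The configurations of leading monomials, one by one\<close>

lemma classified_6:
  assumes "T 1 = 1" "T 2 = 2" "T 3 = 3"
  shows "classified d m \<zeta> F G"
proof -
  have nz: "cf F d 0 0 \<noteq> 0" "cf F 0 d 0 \<noteq> 0" "cf F 0 0 d \<noteq> 0" using assms cf_power by auto
  \<comment> \<open>With this scaling the coefficient of \<open>Y^d\<close> becomes that of
    \<open>X^d\<close>; the overall factor then makes both 1.\<close>
  obtain y where y: "y ^ d = cf F d 0 0 / cf F 0 d 0" "y \<noteq> 0"
    using nth_root[of d "cf F d 0 0 / cf F 0 d 0"] nz d4 by auto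
  obtain z where z: "z ^ d = cf F d 0 0 / cf F 0 0 d" "z \<noteq> 0"
    using nth_root[of d "cf F d 0 0 / cf F 0 0 d"] nz d4 by auto
  obtain N H where N: "invertible N" "weighted_curve_X d m a b 0 H" "defined_by (lin_subst F N) H"
    "of_type \<zeta> a b (conj_by N G)" "ref_points_on (lin_subst F N) = {i. T i \<noteq> i}"
    and H: "\<And>i j k. cf H i j k = y ^ j * z ^ k * cf F i j k / cf F d 0 0"
    using normalise_X[OF assms(1) y(2) z(2)] by blast
  interpret weighted_curve_X d m a b 0 H by (rule N(2))
  define B where "B = \<beta>"
  have "cf H 0 d 0 = 1" "cf H 0 0 d = 1" using y z nz by (simp_all add: H)
  note eq = equation_6[OF this, folded B_def]
  have "{i. T i \<noteq> i} = {}" using assms by (simp add: not_fixed_points)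
  then have card: "card (ref_points_on (lin_subst F N)) = 0" using N(5) by simp
  have da: "[d * a = 0] (mod m)" "[d * b = 0] (mod m)"
    using weights_X[OF assms(1) nz(2)] weights_X[OF assms(1) nz(3)] by (simp_all add: mult.commute)
  then have "m dvd d" using coprime_ab by (auto simp: cong_0_iff intro: dvd_of_dvd_mult_coprime)
  then have "type_6 d m \<zeta> (lin_subst F N) (conj_by N G)"
    unfolding type_6_def
    using N(3)[unfolded eq] N(4) gamma da card by blast
  then show ?thesis using classifiedI[OF N(1)] by blast
qed

lemma classified_5:
  assumes "T 1 = 1" "T 2 = 2" "T 3 = 1"
  shows "classified d m \<zeta> F G"
proof -
  have nz: "cf F d 0 0 \<noteq> 0" "cf F 0 d 0 \<noteq> 0" "cf F 1 0 (d - 1) \<noteq> 0" and z: "cf F 0 0 d = 0"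
    using assms cf_power cf_T by auto
  obtain y where y: "y ^ d = cf F d 0 0 / cf F 0 d 0" "y \<noteq> 0"
    using nth_root[of d "cf F d 0 0 / cf F 0 d 0"] nz d4 by auto
  obtain N H where N: "invertible N" "weighted_curve_X d m a b 0 H" "defined_by (lin_subst F N) H"
    "of_type \<zeta> a b (conj_by N G)" "ref_points_on (lin_subst F N) = {i. T i \<noteq> i}"
    and H: "\<And>i j k. cf H i j k = y ^ j * 1 ^ k * cf F i j k / cf F d 0 0"
    using normalise_X[OF assms(1) y(2) one_neq_zero] by blast
  interpret weighted_curve_X d m a b 0 H by (rule N(2))
  define B where "B = \<beta>"
  define \<alpha> where "\<alpha> = cf H 1 0 (d - 1)"
  have "\<alpha> \<noteq> 0" using nz by (simp add: \<alpha>_def H)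
  have "cf H 0 d 0 = 1" "cf H 0 0 d = 0" "cf H 1 0 (d - 1) = \<alpha>" using y z nz by (simp_all add: H \<alpha>_def)
  note eq = equation_5[OF this, folded B_def]
  have "{i. T i \<noteq> i} = {3}" using assms by (auto simp: not_fixed_points)
  then have card: "card (ref_points_on (lin_subst F N)) = 1" using N(5) by simp
  have da: "[d * a = 0] (mod m)" "[(d - 1) * b = 0] (mod m)"
    using weights_X[OF assms(1) nz(2)] weights_X[OF assms(1) nz(3)] by (simp_all add: mult.commute)
  \<comment> \<open>Multiply the first congruence by \<open>d - 1\<close> and the second by
    \<open>d\<close>, to get the same factor in front of \<open>a\<close> and
    \<open>b\<close>.\<close>
  then have "m dvd d * (d - 1) * a" "m dvd d * (d - 1) * b"
    using dvd_mult[of m "d * a" "d - 1"] dvd_mult[of m "(d - 1) * b" d]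
    by (simp_all add: cong_0_iff mult_ac)
  then have "m dvd d * (d - 1)" using coprime_ab by (rule dvd_of_dvd_mult_coprime)
  then have "type_5 d m \<zeta> (lin_subst F N) (conj_by N G)"
    unfolding type_5_def
    using N(3)[unfolded eq] N(4) gamma da card \<open>\<alpha> \<noteq> 0\<close> by blast
  then show ?thesis using classifiedI[OF N(1)] by blast
qed

lemma classified_4_1:
  assumes "T 1 = 1" "T 2 = 3" "T 3 = 2"
  shows "classified d m \<zeta> F G"
proof -
  have nz: "cf F d 0 0 \<noteq> 0" "cf F 0 (d - 1) 1 \<noteq> 0" "cf F 0 1 (d - 1) \<noteq> 0"
    and z: "cf F 0 d 0 = 0" "cf F 0 0 d = 0"
    using assms cf_power cf_T by auto
  \<comment> \<open>The monomial \<open>Y^(d-1) * Z\<close> is linear in \<open>Z\<close>, so its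
    coefficient is normalised by a quotient instead of a root.\<close>
  have z1: "cf F d 0 0 / cf F 0 (d - 1) 1 \<noteq> 0" using nz by simp
  obtain N H where N: "invertible N" "weighted_curve_X d m a b 0 H" "defined_by (lin_subst F N) H"
    "of_type \<zeta> a b (conj_by N G)" "ref_points_on (lin_subst F N) = {i. T i \<noteq> i}"
    and H: "\<And>i j k. cf H i j k = 1 ^ j * (cf F d 0 0 / cf F 0 (d - 1) 1) ^ k * cf F i j k / cf F d 0 0"
    using normalise_X[OF assms(1) one_neq_zero z1] by blast
  interpret weighted_curve_X d m a b 0 H by (rule N(2))
  define B where "B = \<beta>"
  define \<alpha> where "\<alpha> = cf H 0 1 (d - 1)"
  have "\<alpha> \<noteq> 0" using nz by (simp add: \<alpha>_def H)
  have "cf H 0 d 0 = 0" "cf H 0 0 d = 0" "cf H 0 (d - 1) 1 = 1" "cf H 0 1 (d - 1) = \<alpha>"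
    using z nz by (simp_all add: H \<alpha>_def)
  note eq = equation_4_1[OF this, folded B_def]
  have "{i. T i \<noteq> i} = {2, 3}" using assms by (auto simp: not_fixed_points)
  then have card: "card (ref_points_on (lin_subst F N)) = 2" using N(5) by simp
  have da: "[(d - 1) * a + b = 0] (mod m)" "[a + (d - 1) * b = 0] (mod m)"
    using weights_X[OF assms(1) nz(2)] weights_X[OF assms(1) nz(3)] by (simp_all add: mult.commute)
  obtain n where n: "d = n + 2" using d4 by (metis add.commute le_Suc_ex numeral_Bit0 add.assoc)
  from da have dvd: "m dvd (n + 1) * a + b" "m dvd a + (n + 1) * b" by (simp_all add: cong_0_iff n)
  \<comment> \<open>Elimination: \<open>d - 1\<close> times one congruence minus the other has the
    coefficient \<open>(d - 1)^2 - 1 = d * (d - 2)\<close>. It is written as a sum to avoid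
    subtraction.\<close>
  have "m dvd d * (d - 2) * a + (a + (n + 1) * b)" "m dvd d * (d - 2) * b + ((n + 1) * a + b)"
    using dvd_mult[OF dvd(1), of "n + 1"] dvd_mult[OF dvd(2), of "n + 1"]
    by (simp_all add: n algebra_simps)
  then have "m dvd d * (d - 2) * a" "m dvd d * (d - 2) * b"
    using dvd by (simp_all only: dvd_add_left_iff)
  then have "m dvd d * (d - 2)" using coprime_ab by (rule dvd_of_dvd_mult_coprime)
  then have "type_4_1 d m \<zeta> (lin_subst F N) (conj_by N G)"
    unfolding type_4_1_def
    using N(3)[unfolded eq] N(4) gamma da card \<open>\<alpha> \<noteq> 0\<close> by blast
  then show ?thesis using classifiedI[OF N(1)] by blast
qed

lemma classified_4_2:
  assumes "T 1 = 1" "T 2 = 3" "T 3 = 1"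
  shows "classified d m \<zeta> F G"
proof -
  have nz: "cf F d 0 0 \<noteq> 0" "cf F 0 (d - 1) 1 \<noteq> 0" "cf F 1 0 (d - 1) \<noteq> 0"
    and z: "cf F 0 d 0 = 0" "cf F 0 0 d = 0" "cf F 0 1 (d - 1) = 0"
    using assms cf_power cf_T by auto
  have z1: "cf F d 0 0 / cf F 0 (d - 1) 1 \<noteq> 0" using nz by simp
  obtain N H where N: "invertible N" "weighted_curve_X d m a b 0 H" "defined_by (lin_subst F N) H"
    "of_type \<zeta> a b (conj_by N G)" "ref_points_on (lin_subst F N) = {i. T i \<noteq> i}"
    and H: "\<And>i j k. cf H i j k = 1 ^ j * (cf F d 0 0 / cf F 0 (d - 1) 1) ^ k * cf F i j k / cf F d 0 0"
    using normalise_X[OF assms(1) one_neq_zero z1] by blast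
  interpret weighted_curve_X d m a b 0 H by (rule N(2))
  define B where "B = \<beta>"
  define \<alpha> where "\<alpha> = cf H 1 0 (d - 1)"
  have "\<alpha> \<noteq> 0" using nz by (simp add: \<alpha>_def H)
  have "cf H 0 d 0 = 0" "cf H 0 0 d = 0" "cf H 0 (d - 1) 1 = 1" "cf H 0 1 (d - 1) = 0" "cf H 1 0 (d - 1) = \<alpha>"
    using z nz by (simp_all add: H \<alpha>_def)
  note eq = equation_4_2[OF this, folded B_def]
  have "{i. T i \<noteq> i} = {2, 3}" using assms by (auto simp: not_fixed_points)
  then have card: "card (ref_points_on (lin_subst F N)) = 2" using N(5) by simp
  have da: "[(d - 1) * a + b = 0] (mod m)" "[(d - 1) * b = 0] (mod m)"
    using weights_X[OF assms(1) nz(2)] weights_X[OF assms(1) nz(3)] by (simp_all add: mult.commute)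
  from da have dvd: "m dvd (d - 1) * a + b" "m dvd (d - 1) * b" by (simp_all add: cong_0_iff)
  have b: "m dvd (d - 1)^2 * b" using dvd_mult[OF dvd(2), of "d - 1"] by (simp add: power2_eq_square mult.assoc)
  \<comment> \<open>The first relation times \<open>d - 1\<close>; its second summand is a multiple
    of \<open>m\<close> by the other relation.\<close>
  have "m dvd (d - 1)^2 * a + (d - 1) * b"
    using dvd_mult[OF dvd(1), of "d - 1"] by (simp add: power2_eq_square algebra_simps)
  then have "m dvd (d - 1)^2 * a" using dvd(2) by (simp only: dvd_add_left_iff)
  then have "m dvd (d - 1)^2" using b coprime_ab by (rule dvd_of_dvd_mult_coprime)
  then have "type_4_2 d m \<zeta> (lin_subst F N) (conj_by N G)"
    unfolding type_4_2_def
    using N(3)[unfolded eq] N(4) gamma da card \<open>\<alpha> \<noteq> 0\<close> by blast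
  then show ?thesis using classifiedI[OF N(1)] by blast
qed

lemma classified_4_3:
  assumes "T 1 = 1" "T 2 = 1" "T 3 = 1"
  shows "classified d m \<zeta> F G"
proof -
  have nz: "cf F d 0 0 \<noteq> 0" "cf F 1 (d - 1) 0 \<noteq> 0" "cf F 1 0 (d - 1) \<noteq> 0"
    and z0: "cf F 0 d 0 = 0" "cf F 0 0 d = 0" "cf F 0 (d - 1) 1 = 0" "cf F 0 1 (d - 1) = 0"
    using assms cf_power cf_T by auto
  obtain z where z: "z ^ (d - 1) = cf F d 0 0 / cf F 1 0 (d - 1)" "z \<noteq> 0"
    using nth_root[of "d - 1" "cf F d 0 0 / cf F 1 0 (d - 1)"] nz d4 by auto
  obtain N H where N: "invertible N" "weighted_curve_X d m a b 0 H" "defined_by (lin_subst F N) H"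
    "of_type \<zeta> a b (conj_by N G)" "ref_points_on (lin_subst F N) = {i. T i \<noteq> i}"
    and H: "\<And>i j k. cf H i j k = 1 ^ j * z ^ k * cf F i j k / cf F d 0 0"
    using normalise_X[OF assms(1) one_neq_zero z(2)] by blast
  interpret weighted_curve_X d m a b 0 H by (rule N(2))
  define B where "B = \<beta>"
  define \<alpha> where "\<alpha> = cf H 1 (d - 1) 0"
  have "\<alpha> \<noteq> 0" using nz by (simp add: \<alpha>_def H)
  have "cf H 0 d 0 = 0" "cf H 0 0 d = 0" "cf H 0 (d - 1) 1 = 0" "cf H 0 1 (d - 1) = 0"
    "cf H 1 0 (d - 1) = 1" "cf H 1 (d - 1) 0 = \<alpha>"
    using z0 z nz unfolding \<alpha>_def by (simp_all add: H)
  note eq = equation_4_3[OF this, folded B_def]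
  have "{i. T i \<noteq> i} = {2, 3}" using assms by (auto simp: not_fixed_points)
  then have card: "card (ref_points_on (lin_subst F N)) = 2" using N(5) by simp
  have da: "[(d - 1) * b = 0] (mod m)" "[(d - 1) * a = 0] (mod m)"
    using weights_X[OF assms(1) nz(2)] weights_X[OF assms(1) nz(3)] by (simp_all add: mult.commute)
  then have "m dvd d - 1" using coprime_ab by (auto simp: cong_0_iff intro: dvd_of_dvd_mult_coprime)
  then have "type_4_3 d m \<zeta> (lin_subst F N) (conj_by N G)"
    unfolding type_4_3_def
    using N(3)[unfolded eq] N(4) gamma da card \<open>\<alpha> \<noteq> 0\<close> by blast
  then show ?thesis using classifiedI[OF N(1)] by blast
qed

text \<open>The leading monomials have weights \<open>a\<close>, \<open>(d - 1) * a + b\<close> and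
  \<open>(d - 1) * b\<close>. With \<open>n = d - 2\<close> their congruence is the linear system
  \<open>n * a + b = 0\<close>, \<open>(n + 1) * b - a = 0\<close> modulo \<open>m\<close>, whose
  determinant \<open>n^2 + n + 1\<close> equals \<open>d^2 - 3 * d + 3\<close>. As in Cramer's rule,
  \<open>m\<close> divides the determinant times \<open>a\<close> and times
  \<open>b\<close>.\<close>

lemma classified_3:
  assumes "T 1 = 2" "T 2 = 3" "T 3 = 1"
  shows "classified d m \<zeta> F G"
proof -
  have nz: "cf F (d - 1) 1 0 \<noteq> 0" "cf F 0 (d - 1) 1 \<noteq> 0" "cf F 1 0 (d - 1) \<noteq> 0"
    and z: "cf F d 0 0 = 0" "cf F 0 d 0 = 0" "cf F 0 0 d = 0"
      "cf F (d - 1) 0 1 = 0" "cf F 1 (d - 1) 0 = 0" "cf F 0 1 (d - 1) = 0"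
    using assms cf_power cf_T by auto
  obtain c where c: "\<And>i j k. cf F i j k \<noteq> 0 \<Longrightarrow> [a * j + b * k = c] (mod m)" using weights by blast
  \<comment> \<open>Scaling \<open>Z\<close> by this quotient equalises the first two leading
    coefficients, and the overall factor makes them 1; the third remains as
    \<open>\<alpha>\<close>.\<close>
  let ?z = "cf F (d - 1) 1 0 / cf F 0 (d - 1) 1"
  have z1: "?z \<noteq> 0" using nz by simp
  have c': "\<forall>i j k. cf F i j k \<noteq> 0 \<longrightarrow> [a * j + b * k = c] (mod m)" using c by blast
  obtain N H where N: "invertible N" "weighted_curve d m a b c H" "defined_by (lin_subst F N) H"
    "of_type \<zeta> a b (conj_by N G)" "ref_points_on (lin_subst F N) = {i. T i \<noteq> i}"
    and H: "\<And>i j k. cf H i j k = 1 ^ j * ?z ^ k * cf F i j k / cf F (d - 1) 1 0"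
    using normalise[OF one_neq_zero z1 nz(1) c'] by blast
  define \<alpha> where "\<alpha> = cf H 1 0 (d - 1)"
  have "\<alpha> \<noteq> 0" using nz by (simp add: \<alpha>_def H)
  have "cf H d 0 0 = 0" "cf H 0 d 0 = 0" "cf H 0 0 d = 0" "cf H (d - 1) 1 0 = 1" "cf H (d - 1) 0 1 = 0"
    "cf H 0 (d - 1) 1 = 1" "cf H 1 (d - 1) 0 = 0" "cf H 1 0 (d - 1) = \<alpha>" "cf H 0 1 (d - 1) = 0"
    using z nz unfolding \<alpha>_def by (simp_all add: H)
  note eq = weighted_curve.equation_3[OF N(2) this]
  have "{i. T i \<noteq> i} = {1, 2, 3}" using assms by (auto simp: not_fixed_points)
  then have card: "card (ref_points_on (lin_subst F N)) = 3" using N(5) by simp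
  have w: "[a = c] (mod m)" "[(d - 1) * a + b = c] (mod m)" "[(d - 1) * b = c] (mod m)"
    using c[OF nz(1)] c[OF nz(2)] c[OF nz(3)] by (simp_all add: mult.commute)
  then have da: "[a = (d - 1) * a + b] (mod m)" "[(d - 1) * a + b = (d - 1) * b] (mod m)"
    by (metis cong_sym cong_trans)+
  obtain n where n: "d = n + 2" using d4 by (metis add.commute le_Suc_ex numeral_Bit0 add.assoc)
  \<comment> \<open>The subtraction on the left is not truncated, since
    \<open>3 * d \<le> d^2\<close>.\<close>
  have d2: "d^2 - 3 * d + 3 = n^2 + n + 1"
  proof -
    have "d^2 + 3 = n^2 + n + 1 + 3 * d" by (simp add: n power2_eq_square algebra_simps)
    moreover have "3 * d \<le> d^2" using d4 by (simp add: power2_eq_square)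
    ultimately show ?thesis by linarith
  qed
  have "[a + n * a + b = a + 0] (mod m)"
    using cong_sym[OF da(1)] by (simp add: n algebra_simps)
  then have 1: "m dvd n * a + b"
    using cong_add_lcancel_nat[of a "n * a + b" 0 m] by (simp add: add.assoc cong_0_iff)
  have "[(n + 1) * b = a] (mod m)" using w(1,3) by (metis cong_sym cong_trans n add_diff_cancel_right' add_2_eq_Suc' diff_Suc_1 Suc_eq_plus1)
  then have "[n * a + (n + 1) * b = n * a + a] (mod m)" by (intro cong_add cong_refl)
  then have "[(n * a + b) + n * b = (n + 1) * a] (mod m)" by (simp add: algebra_simps)
  moreover have "[(n * a + b) + n * b = 0 + n * b] (mod m)"
    using 1 by (intro cong_add cong_refl) (simp add: cong_0_iff)
  ultimately have 2: "[n * b = (n + 1) * a] (mod m)" by (metis add_0 cong_sym cong_trans)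
  have "[(n^2 + n + 1) * a + n * b = 0 + n * b] (mod m)"
  proof -
    have "[n * (n * a + b) + (n + 1) * a = 0 + n * b] (mod m)"
      using 1 by (intro cong_add cong_sym[OF 2]) (simp add: cong_0_iff)
    then show ?thesis by (simp add: power2_eq_square algebra_simps)
  qed
  then have da2: "m dvd (n^2 + n + 1) * a" by (simp only: cong_add_rcancel_nat cong_0_iff)
  have "[(n^2 + n + 1) * b + n * a = 0 + n * a] (mod m)"
  proof -
    have "[n * ((n + 1) * b) + (b + n * a) = n * a + 0] (mod m)"
      using \<open>[(n + 1) * b = a] (mod m)\<close> 1
      by (intro cong_add cong_mult cong_refl) (simp_all add: cong_0_iff add.commute)
    then show ?thesis by (simp add: power2_eq_square algebra_simps)
  qed
  then have "m dvd (n^2 + n + 1) * b" by (simp only: cong_add_rcancel_nat cong_0_iff)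
  with da2 have "m dvd d^2 - 3 * d + 3" unfolding d2 using coprime_ab by (rule dvd_of_dvd_mult_coprime)
  moreover have "\<exists>\<alpha> \<beta> \<alpha>' \<gamma>. \<alpha> \<noteq> 0 \<and>
        defined_by (lin_subst F N)
          (VX^(d-1) * VY + VY^(d-1) * VZ + Const \<alpha> * VZ^(d-1) * VX
           + (\<Sum>j=2..(2*d) div 3.
                VX^(d-j) * (\<Sum>i\<in>S1_X j m a b. Const (\<beta> j i) * VY^i * VZ^(j-i))
              + VY^(d-j) * (\<Sum>i\<in>S_Y d j m a b. Const (\<alpha>' j i) * VZ^i * VX^(j-i))
              + VZ^(d-j) * (\<Sum>i\<in>S_Z d j m a b. Const (\<gamma> j i) * VX^(j-i) * VY^i)))"
    using eq N(3) \<open>\<alpha> \<noteq> 0\<close> by (elim exE) (hypsubst, intro exI conjI, assumption+)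
  ultimately have "type_3 d m \<zeta> (lin_subst F N) (conj_by N G)"
    unfolding type_3_def using N(4) gamma da card by blast
  then show ?thesis using classifiedI[OF N(1)] by blast
qed

text \<open>In the remaining configuration \<open>F\<close> would be divisible by \<open>X\<close>.\<close>

lemma no_two_cycle: "\<not> (T 1 = 2 \<and> T 2 = 1 \<and> T 3 = 1)"
proof
  assume "T 1 = 2 \<and> T 2 = 1 \<and> T 3 = 1"
  then have nz: "cf F (d - 1) 1 0 \<noteq> 0" "cf F 1 (d - 1) 0 \<noteq> 0" "cf F 1 0 (d - 1) \<noteq> 0"
    using cf_T by auto
  obtain c where c: "\<And>i j k. cf F i j k \<noteq> 0 \<Longrightarrow> [a * j + b * k = c] (mod m)" using weights by blast
  obtain n where n: "d = n + 1" using d4 by (metis add.commute le_Suc_ex Suc_eq_plus1 numeral_eq_Suc add_Suc)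
  have w: "[a = c] (mod m)" "[a * n = c] (mod m)" "[b * n = c] (mod m)"
    using c[OF nz(1)] c[OF nz(2)] c[OF nz(3)] by (simp_all add: n)
  obtain e where e: "e \<in> Poly_Mapping.keys F" "Poly_Mapping.lookup e 1 = 0"
    using nonsingular_not_divisible_by_Var[OF nonsing homog, of 1] d4 by auto
  define j k where "j = Poly_Mapping.lookup e 2" and "k = Poly_Mapping.lookup e 3"
  have "e = Poly_Mapping.single 1 0 + Poly_Mapping.single 2 j + Poly_Mapping.single 3 k"
  proof (rule poly_mapping_eqI)
    fix x show "Poly_Mapping.lookup e x =
        Poly_Mapping.lookup (Poly_Mapping.single 1 0 + Poly_Mapping.single 2 j + Poly_Mapping.single 3 k) x"
      using exhaust_3[of x] e(2) by (auto simp: lookup_add lookup_single j_def k_def)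
  qed
  then have "cf F 0 j k \<noteq> 0" using e(1) by (simp add: cf_def in_keys_iff)
  then have jk: "[a * j + b * k = c] (mod m)" by (rule c)
  have sum: "j + k = n + 1" using homogeneousD[OF homog e(1)] e(2) by (simp add: sum_3 j_def k_def n)
  \<comment> \<open>For a monomial free of \<open>X\<close>, both \<open>a * n\<close> and
    \<open>b * n\<close> can be replaced by \<open>c\<close>. As \<open>j + k = n + 1\<close>, this
    gives \<open>n * c = (n + 1) * c\<close> modulo \<open>m\<close>. So \<open>c\<close>, and with
    it \<open>a\<close>, is 0 modulo \<open>m\<close>.\<close>
  have "[n * c = n * (a * j + b * k)] (mod m)" by (rule cong_mult[OF cong_refl cong_sym[OF jk]])
  also have "n * (a * j + b * k) = j * (a * n) + k * (b * n)" by (simp add: algebra_simps)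
  also have "[\<dots> = j * c + k * c] (mod m)" using w by (intro cong_add cong_mult cong_refl)
  also have "j * c + k * c = n * c + c" unfolding distrib_right[symmetric] sum by simp
  finally have "[0 = c] (mod m)" using cong_add_lcancel_nat[of "n * c" 0 c m] by simp
  then have "[a = 0] (mod m)" using w(1) by (metis cong_sym cong_trans)
  moreover have "0 < a" "a < m" using gamma by (auto simp: Gamma_pairs_def)
  ultimately show False by (simp add: cong_def)
qed

end

section \<open>Reduction to standard position\<close>

text \<open>If there is a fixed point, it is taken as \<open>u\<close>, and the images of the other
  two points give five shapes up to relabelling. Otherwise \<open>v = T u\<close> differs from
  \<open>u\<close>, and what remains is a 3-cycle or a 2-cycle with a tail.\<close>

lemma map_3_configurations:
  fixes T :: "3 \<Rightarrow> 3"
  obtains u v t where "u \<noteq> v" "v \<noteq> t" "u \<noteq> t"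
    "(T u, T v, T t) \<in> {(u, v, t), (u, v, u), (u, t, v), (u, t, u), (u, u, u), (v, t, u), (v, u, u)}"
proof (cases "\<exists>u. T u = u")
  case True
  then obtain u where u: "T u = u" by blast
  obtain v t where uvt: "u \<noteq> v" "v \<noteq> t" "u \<noteq> t" by (rule other_indices_3)
  have "x = u \<or> x = v \<or> x = t" for x using UNIV_3_distinct[OF uvt] by auto
  from this[of "T v"] this[of "T t"] show thesis
    by (elim disjE)
      (use u uvt that[of u v t] that[of v u t] that[of u t v] that[of t u v] in simp_all)
next
  case False
  define u v where "u = (1::3)" and "v = T u"
  have "u \<noteq> v" using False unfolding v_def by metis
  obtain t where uvt: "u \<noteq> v" "v \<noteq> t" "u \<noteq> t"
    by (rule third_index_3[OF \<open>u \<noteq> v\<close>])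
  have uv: "T u = v" by (simp add: v_def)
  have "x = u \<or> x = v \<or> x = t" for x using UNIV_3_distinct[OF uvt] by auto
  from this[of "T v"] this[of "T t"] show thesis
    by (elim disjE)
      (use uv False uvt that[of u v t] that[of v u t] that[of v t u] in auto)
qed

lemma classified_distinct_weights:
  fixes F :: "'a::{alg_closed_field,field_char_0} poly3"
  assumes d4: "4 \<le> d" and prim: "primitive_root_of_unity m \<zeta>" and act: "diagonal_action d m \<zeta> F G w"
    and w: "\<And>i j. i \<noteq> j \<Longrightarrow> \<not> [w i = w j] (mod m)"
  shows "classified d m \<zeta> F G"
proof -
  let ?lead = "\<lambda>F i k. Poly_Mapping.lookup F (Poly_Mapping.single i (d - 1) + Poly_Mapping.single (k::3) 1)"
  have hom: "homogeneous d F" and ns: "nonsingular F" using act by (auto simp: diagonal_action_def)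
  obtain c where c: "\<And>e. e \<in> Poly_Mapping.keys F \<Longrightarrow> [(\<Sum>i\<in>UNIV. w i * Poly_Mapping.lookup e i) = c] (mod m)"
    using act by (auto simp: diagonal_action_def)
  have lead: "[w i * (d - 1) + w k = c] (mod m)" if "?lead F i k \<noteq> 0" for i k
  proof -
    have "w x * Poly_Mapping.lookup (Poly_Mapping.single i (d - 1) + Poly_Mapping.single k 1) x =
        (if x = i then w i * (d - 1) else 0) + (if x = k then w k else 0)" for x
      by (simp add: lookup_add lookup_single when_def)
    then have "(\<Sum>x\<in>UNIV. w x * Poly_Mapping.lookup (Poly_Mapping.single i (d - 1) + Poly_Mapping.single k 1) x) = w i * (d - 1) + w k"
      by (simp add: sum.distrib)
    then show ?thesis using c[of "Poly_Mapping.single i (d - 1) + Poly_Mapping.single k 1"] that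
      by (metis in_keys_iff)
  qed
  have "\<exists>k. \<forall>l. ?lead F i l \<noteq> 0 \<longleftrightarrow> l = k" for i
  proof -
    obtain k where k: "?lead F i k \<noteq> 0"
      using nonsingular_monomial_at_ref_point[OF ns hom, of i] d4 by auto
    have "l = k" if "?lead F i l \<noteq> 0" for l
    proof (rule ccontr)
      assume "l \<noteq> k"
      have "[w i * (d - 1) + w l = w i * (d - 1) + w k] (mod m)"
        using lead[OF k] lead[OF that] by (metis cong_sym cong_trans)
      then have "[w l = w k] (mod m)" by (simp add: cong_add_lcancel_nat)
      with w \<open>l \<noteq> k\<close> show False by blast
    qed
    with k show ?thesis by metis
  qed
  then obtain T where T: "\<And>i k. ?lead F i k \<noteq> 0 \<longleftrightarrow> k = T i" by metis
  obtain u v t where uvt: "u \<noteq> v" "v \<noteq> t" "u \<noteq> t"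
    and conf: "(T u, T v, T t) \<in> {(u, v, t), (u, v, u), (u, t, v), (u, t, u), (u, u, u), (v, t, u), (v, u, u)}"
    by (rule map_3_configurations)
  obtain Q \<tau> where Q: "invertible Q" and "inj \<tau>" and \<tau>: "\<tau> u = 1" "\<tau> v = 2" "\<tau> t = 3"
    and act1: "diagonal_action d m \<zeta> (lin_subst F Q) (conj_by Q G) (\<lambda>i. if i = 1 then w u else if i = 2 then w v else w t)"
    and look: "\<And>i k p q. Poly_Mapping.lookup (lin_subst F Q) (Poly_Mapping.single (\<tau> i) p + Poly_Mapping.single (\<tau> k) q) =
        Poly_Mapping.lookup F (Poly_Mapping.single i p + Poly_Mapping.single k q)"
    using diagonal_action_reorder[OF prim act uvt] by blast
  have distinct1: "\<not> [(if i = 1 then w u else if i = 2 then w v else w t) = (if j = 1 then w u else if j = 2 then w v else w t)] (mod m)"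
    if "i \<noteq> j" for i j :: 3
    using that exhaust_3[of i] exhaust_3[of j] uvt w by auto
  obtain a b where ab: "(a, b) \<in> Gamma_pairs m"
    "diagonal_action d m \<zeta> (lin_subst F Q) (conj_by Q G) (standard_weights a b)"
    using diagonal_action_weights_Gamma[OF prim act1 distinct1] by blast
  have bij: "bij \<tau>" using \<open>inj \<tau>\<close> by (simp add: finite_UNIV_inj_surj bij_def)
  \<comment> \<open>The map \<open>T\<close> in the new labels, conjugated by
    \<open>\<tau>\<close>.\<close>
  define T' where "T' i = \<tau> (T (inv_into UNIV \<tau> i))" for i
  have inv: "inv_into UNIV \<tau> (\<tau> i) = i" "\<tau> (inv_into UNIV \<tau> i) = i" for i
    using bij by (simp_all add: bij_is_inj bij_is_surj surj_f_inv_f)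
  have T'_eq: "T' (\<tau> i) = \<tau> (T i)" for i by (simp add: T'_def inv)
  have "?lead (lin_subst F Q) i k \<noteq> 0 \<longleftrightarrow> k = T' i" for i k
  proof -
    have "?lead (lin_subst F Q) (\<tau> i') (\<tau> k') \<noteq> 0 \<longleftrightarrow> \<tau> k' = T' (\<tau> i')" for i' k'
      unfolding look T T'_eq using \<open>inj \<tau>\<close> by (auto simp: inj_eq)
    then show ?thesis using inv(2) by metis
  qed
  then interpret standard_position d m a b \<zeta> "lin_subst F Q" "conj_by Q G" T'
    using d4 prim ab by unfold_locales auto
  have "T' 1 = \<tau> (T u)" "T' 2 = \<tau> (T v)" "T' 3 = \<tau> (T t)" using T'_eq[of u] T'_eq[of v] T'_eq[of t] \<tau> by simp_all
  with conf have "(T' 1, T' 2, T' 3) \<in> {(1, 2, 3), (1, 2, 1), (1, 3, 2), (1, 3, 1), (1, 1, 1), (2, 3, 1), (2, 1, 1)}"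
    by (elim insertE emptyE) (simp_all add: \<tau>)
  then have "classified d m \<zeta> (lin_subst F Q) (conj_by Q G)"
    using classified_6 classified_5 classified_4_1 classified_4_2 classified_4_3 classified_3 no_two_cycle
    by auto
  then show ?thesis
    by (rule classified_transport[OF diagonal_action_carrier[OF assms(2,3)] Q])
qed

section \<open>Homologies\<close>

text \<open>With weights 0, 0, 1 the weight of a monomial is its exponent of \<open>Z\<close>. Since
  \<open>F\<close> is not divisible by \<open>Z\<close>, the common weight is 0, so \<open>m\<close>
  divides every exponent of \<open>Z\<close> that occurs.\<close>

lemma classified_homology:
  fixes F :: "'a::{alg_closed_field,field_char_0} poly3"
  assumes d4: "4 \<le> d" and prim: "primitive_root_of_unity m \<zeta>"
    and act: "diagonal_action d m \<zeta> F G (standard_weights 0 1)"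
  shows "classified d m \<zeta> F G"
proof -
  have hom: "homogeneous d F" and ns: "nonsingular F" using act by (auto simp: diagonal_action_def)
  obtain c where c: "\<And>e. e \<in> Poly_Mapping.keys F \<Longrightarrow>
      [(\<Sum>i\<in>UNIV. standard_weights 0 1 i * Poly_Mapping.lookup e i) = c] (mod m)"
    using act by (auto simp: diagonal_action_def)
  then have c: "[Poly_Mapping.lookup e 3 = c] (mod m)" if "e \<in> Poly_Mapping.keys F" for e
    using that by (simp add: sum_3)
  obtain e where "e \<in> Poly_Mapping.keys F" "Poly_Mapping.lookup e 3 = 0"
    using nonsingular_not_divisible_by_Var[OF ns hom, of 3] d4 by auto
  then have c0: "[Poly_Mapping.lookup e 3 = 0] (mod m)" if "e \<in> Poly_Mapping.keys F" for e
    using c[OF that] c by (metis cong_sym cong_trans)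
  let ?e = "\<lambda>j i. Poly_Mapping.single (3::3) (d - j) + Poly_Mapping.single 1 i + Poly_Mapping.single 2 (j - i)"
  \<comment> \<open>The default 1 lets one expansion serve both types: \<open>L 0\<close> becomes 1
    if \<open>Z^d\<close> occurs and 0 otherwise.\<close>
  define \<kappa> where "\<kappa> = (if Poly_Mapping.lookup F (Poly_Mapping.single 3 d) = 0 then 1
    else Poly_Mapping.lookup F (Poly_Mapping.single 3 d))"
  have "\<kappa> \<noteq> 0" by (simp add: \<kappa>_def)
  define L where "L j = (\<Sum>i\<le>j. Const (Poly_Mapping.lookup F (?e j i) / \<kappa>) * VX ^ i * VY ^ (j - i))" for j
  have L_single: "Const x * VX ^ i * VY ^ k = Poly_Mapping.single (Poly_Mapping.single 1 i + Poly_Mapping.single 2 k) x"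
    for x :: 'a and i k by (simp add: Var_power Const_def mult_single)
  have homL: "homogeneous j (L j)" for j
    unfolding L_def L_single
    by (rule homogeneous_sum) (auto simp: homogeneous_def sum_3 lookup_add lookup_single)
  have notL: "not_involving 3 (L j)" for j
    unfolding not_involving_def
  proof
    fix f assume "f \<in> Poly_Mapping.keys (L j)"
    then have "Poly_Mapping.lookup (L j) f \<noteq> 0" by (simp add: in_keys_iff)
    then obtain i where "Poly_Mapping.lookup (Poly_Mapping.single (Poly_Mapping.single 1 i + Poly_Mapping.single 2 (j - i))
        (Poly_Mapping.lookup F (?e j i) / \<kappa>)) f \<noteq> 0"
      unfolding L_def L_single lookup_sum by (meson sum.not_neutral_contains_not_neutral)
    then have "f = Poly_Mapping.single 1 i + Poly_Mapping.single 2 (j - i)"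
      by (auto simp: lookup_single when_def split: if_splits)
    then show "Poly_Mapping.lookup f 3 = 0" by (simp add: lookup_add lookup_single)
  qed
  have "F = (\<Sum>j\<le>d. VZ ^ (d - j) * (\<Sum>i\<le>j. Const (Poly_Mapping.lookup F (?e j i)) * VX ^ i * VY ^ (j - i)))"
    by (rule homogeneous_expansion[OF hom]) auto
  also have "\<dots> = (\<Sum>j\<le>d. VZ ^ (d - j) * (Const \<kappa> * L j))"
    using \<open>\<kappa> \<noteq> 0\<close> by (simp add: L_def sum_distrib_left mult.assoc[symmetric] Const_mult[symmetric])
  also have "\<dots> = Const \<kappa> * (\<Sum>j\<le>d. VZ ^ (d - j) * L j)"
    by (simp add: sum_distrib_left mult_ac)
  finally have def: "defined_by F (\<Sum>j\<le>d. VZ ^ (d - j) * L j)"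
    using \<open>\<kappa> \<noteq> 0\<close> by (auto simp: defined_by_def)
  have L_dvd: "[d - j = 0] (mod m)" if "L j \<noteq> 0" for j
  proof (rule ccontr)
    assume "\<not> [d - j = 0] (mod m)"
    then have "?e j i \<notin> Poly_Mapping.keys F" for i
      using c0[of "?e j i"] by (auto simp: lookup_add lookup_single)
    then have "L j = 0" by (simp add: L_def in_keys_iff)
    with that show False by blast
  qed
  have "{..d} = insert 0 (insert d {1..d-1})" using d4 by auto
  then have "(\<Sum>j\<le>d. VZ ^ (d - j) * L j) = VZ ^ d * L 0 + (L d + (\<Sum>j=1..d-1. VZ ^ (d - j) * L j))"
    using d4 by (simp only:) (subst sum.insert, simp, force, simp)
  also have "(\<Sum>j=1..d-1. VZ ^ (d - j) * L j) = (\<Sum>j\<in>S_hom 1 d m. VZ ^ (d - j) * L j)"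
  proof (rule sum.mono_neutral_right)
    show "\<forall>j\<in>{1..d-1} - S_hom 1 d m. VZ ^ (d - j) * L j = 0"
      using L_dvd by (fastforce simp: S_hom_def)
  qed (auto simp: S_hom_def)
  finally have def1: "defined_by F (VZ ^ d * L 0 + (\<Sum>j\<in>S_hom 1 d m. VZ ^ (d - j) * L j) + L d)"
    using def by (simp add: add_ac)
  have L0: "L 0 = Const (Poly_Mapping.lookup F (Poly_Mapping.single 3 d) / \<kappa>)" by (simp add: L_def)
  have type: "of_type \<zeta> 0 1 G"
    using act diag3_eq_diagonal_matrix[of "\<lambda>i. \<zeta> ^ standard_weights 0 1 i"]
    by (simp add: of_type_def diagonal_action_def)
  have "type_1 d m \<zeta> F G \<or> type_2 d m \<zeta> F G"
  proof (cases "Poly_Mapping.lookup F (Poly_Mapping.single 3 d) = 0")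
    case False
    then have "L 0 = 1" by (simp add: L0 \<kappa>_def)
    with def1 have "defined_by F (VZ ^ d + (\<Sum>j\<in>S_hom 1 d m. VZ ^ (d - j) * L j) + L d)" by simp
    moreover have "m dvd d"
      using c0[of "Poly_Mapping.single 3 d"] False by (simp add: in_keys_iff cong_0_iff)
    ultimately have "type_2 d m \<zeta> F G"
      unfolding type_2_def using homL notL type by blast
    then show ?thesis ..
  next
    case True
    then have "L 0 = 0" by (simp add: L0)
    \<comment> \<open>Without \<open>Z^d\<close>, nonsingularity at the third reference point
      supplies a monomial with \<open>Z\<close>-exponent exactly \<open>d - 1\<close>, so
      \<open>m\<close> divides \<open>d - 1\<close>.\<close>
    obtain k where k: "Poly_Mapping.lookup F (Poly_Mapping.single 3 (d - 1) + Poly_Mapping.single k 1) \<noteq> 0"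
      using nonsingular_monomial_at_ref_point[OF ns hom, of 3] d4 by auto
    have "k \<noteq> 3"
    proof
      assume "k = 3"
      then have "Poly_Mapping.lookup F (Poly_Mapping.single 3 d) \<noteq> 0"
        using k d4 by (simp flip: single_add)
      with True show False by blast
    qed
    then have "m dvd d - 1"
      using c0[of "Poly_Mapping.single 3 (d - 1) + Poly_Mapping.single k 1"] k
      by (simp add: in_keys_iff cong_0_iff lookup_add lookup_single)
    \<comment> \<open>Divisibility of \<open>d - 1\<close> puts \<open>j = 1\<close> into the index
      set; its term is the separate summand with \<open>L 1\<close>.\<close>
    then have "S_hom 1 d m = insert 1 (S_hom 2 d m)" "1 \<notin> S_hom 2 d m"
      using d4 by (auto simp: S_hom_def cong_0_iff le_eq_less_or_eq)
    moreover have "finite (S_hom 2 d m)" by (rule finite_subset[of _ "{..d}"]) (auto simp: S_hom_def)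
    ultimately have "defined_by F (VZ ^ (d - 1) * L 1 + (\<Sum>j\<in>S_hom 2 d m. VZ ^ (d - j) * L j) + L d)"
      using def1 \<open>L 0 = 0\<close> by simp
    then have "type_1 d m \<zeta> F G"
      unfolding type_1_def using homL notL type \<open>m dvd d - 1\<close> by blast
    then show ?thesis ..
  qed
  moreover have "lin_subst F (mat 1) = F"
  proof (rule poly_mapping_eqI)
    fix e show "Poly_Mapping.lookup (lin_subst F (mat 1)) e = Poly_Mapping.lookup F e"
      using lookup_lin_subst_monomial_matrix[of "\<lambda>i. i" F "\<lambda>_. 1" e]
      by (simp add: mat_eq_diagonal_matrix map_key_id)
  qed
  moreover have "conj_by (mat 1) G = G"
  proof -
    interpret group "PGL3 :: ('a^3^3) set monoid" by (rule group_PGL3)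
    have "inv\<^bsub>PGL3\<^esub> pgl (mat 1) \<otimes>\<^bsub>PGL3\<^esub> g \<otimes>\<^bsub>PGL3\<^esub> pgl (mat 1) = g" if "g \<in> G" for g
      using that diagonal_action_carrier[OF prim act] by (auto simp: pgl_mat_1)
    then show ?thesis by (simp add: conj_by_def)
  qed
  ultimately show ?thesis
    unfolding classified_def using invertible_mat[of "1::'a"] by (intro exI[of _ "mat 1"]) auto
qed

theorem theorem30:
  fixes F :: "'a::{alg_closed_field,field_char_0} poly3"
    and G :: "('a^3^3) set set"
    and \<zeta> :: 'a
    and d m :: nat
  assumes "4 \<le> d"
    and "homogeneous d F"
    and "nonsingular F"
    and "subgroup G PGL3"
    and "G \<subseteq> Aut_curve F"
    and "cyclic_group (PGL3\<lparr>carrier := G\<rparr>)"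
    and "finite G"
    and "card G = m"
    and "G \<noteq> {\<one>\<^bsub>PGL3\<^esub>}"
    and "primitive_root_of_unity m \<zeta>"
  shows "\<exists>P F' G'. invertible P \<and> F' = lin_subst F P \<and> G' = conj_by P G \<and>
    \<comment> \<open>(1)\<close>
    ((m dvd d - 1 \<and> of_type \<zeta> 0 1 G' \<and>
      (\<exists>L. (\<forall>j. homogeneous j (L j) \<and> not_involving 3 (L j)) \<and>
        defined_by F'
          (VZ^(d-1) * L 1 + (\<Sum>j\<in>S_hom 2 d m. VZ^(d-j) * L j) + L d)))
    \<or>
    \<comment> \<open>(2)\<close>
    (m dvd d \<and> of_type \<zeta> 0 1 G' \<and>
      (\<exists>L. (\<forall>j. homogeneous j (L j) \<and> not_involving 3 (L j)) \<and>
        defined_by F'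
          (VZ^d + (\<Sum>j\<in>S_hom 1 d m. VZ^(d-j) * L j) + L d)))
    \<or>
    \<comment> \<open>(3)\<close>
    (card (ref_points_on F') = 3 \<and> m dvd d^2 - 3*d + 3 \<and>
      (\<exists>a b. (a, b) \<in> Gamma_pairs m \<and> of_type \<zeta> a b G' \<and>
        [a = (d-1)*a + b] (mod m) \<and> [(d-1)*a + b = (d-1)*b] (mod m) \<and>
        (\<exists>\<alpha> \<beta> \<alpha>' \<gamma>. \<alpha> \<noteq> 0 \<and>
          defined_by F'
            (VX^(d-1) * VY + VY^(d-1) * VZ + Const \<alpha> * VZ^(d-1) * VX
             + (\<Sum>j=2..(2*d) div 3.
                  VX^(d-j) * (\<Sum>i\<in>S1_X j m a b. Const (\<beta> j i) * VY^i * VZ^(j-i))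
                + VY^(d-j) * (\<Sum>i\<in>S_Y d j m a b. Const (\<alpha>' j i) * VZ^i * VX^(j-i))
                + VZ^(d-j) * (\<Sum>i\<in>S_Z d j m a b. Const (\<gamma> j i) * VX^(j-i) * VY^i))))))
    \<or>
    \<comment> \<open>(4.1)\<close>
    (card (ref_points_on F') = 2 \<and> m dvd d * (d-2) \<and>
      (\<exists>a b. (a, b) \<in> Gamma_pairs m \<and> of_type \<zeta> a b G' \<and>
        [(d-1)*a + b = 0] (mod m) \<and> [a + (d-1)*b = 0] (mod m) \<and>
        (\<exists>\<alpha> \<beta>. \<alpha> \<noteq> 0 \<and>
          defined_by F'
            (VX^d
             + (\<Sum>j=2..d-1. VX^(d-j) * (\<Sum>i\<in>S2_X j m a b. Const (\<beta> j i) * VY^i * VZ^(j-i)))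
             + VY^(d-1) * VZ + Const \<alpha> * VY * VZ^(d-1)
             + (\<Sum>i\<in>S_d_X 2 d m a b. Const (\<beta> d i) * VY^i * VZ^(d-i))))))
    \<or>
    \<comment> \<open>(4.2)\<close>
    (card (ref_points_on F') = 2 \<and> m dvd (d-1)^2 \<and>
      (\<exists>a b. (a, b) \<in> Gamma_pairs m \<and> of_type \<zeta> a b G' \<and>
        [(d-1)*a + b = 0] (mod m) \<and> [(d-1)*b = 0] (mod m) \<and>
        (\<exists>\<alpha> \<beta>. \<alpha> \<noteq> 0 \<and>
          defined_by F'
            (VX^d
             + (\<Sum>j=2..d-2. VX^(d-j) * (\<Sum>i\<in>S2_X j m a b. Const (\<beta> j i) * VY^i * VZ^(j-i)))
             + VX * (Const \<alpha> * VZ^(d-1)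
                + (\<Sum>i\<in>S_d1_X 1 d m a b. Const (\<beta> (d-1) i) * VY^i * VZ^(d-1-i)))
             + VY^(d-1) * VZ
             + (\<Sum>i\<in>S_d_X 2 d m a b. Const (\<beta> d i) * VY^i * VZ^(d-i))))))
    \<or>
    \<comment> \<open>(4.3)\<close>
    (card (ref_points_on F') = 2 \<and> m dvd d - 1 \<and>
      (\<exists>a b. (a, b) \<in> Gamma_pairs m \<and> of_type \<zeta> a b G' \<and>
        [(d-1)*b = 0] (mod m) \<and> [(d-1)*a = 0] (mod m) \<and>
        (\<exists>\<alpha> \<beta>. \<alpha> \<noteq> 0 \<and>
          defined_by F'
            (VX^d
             + (\<Sum>j=2..d-2. VX^(d-j) * (\<Sum>i\<in>S2_X j m a b. Const (\<beta> j i) * VY^i * VZ^(j-i)))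
             + (\<Sum>i\<in>S_d_X 2 d m a b. Const (\<beta> d i) * VY^i * VZ^(d-i))
             + VX * (VZ^(d-1) + Const \<alpha> * VY^(d-1)
                + (\<Sum>i\<in>S_d1_X 2 d m a b. Const (\<beta> (d-1) i) * VY^i * VZ^(d-1-i)))))))
    \<or>
    \<comment> \<open>(5)\<close>
    (card (ref_points_on F') = 1 \<and> m dvd d * (d-1) \<and>
      (\<exists>a b. (a, b) \<in> Gamma_pairs m \<and> of_type \<zeta> a b G' \<and>
        [d*a = 0] (mod m) \<and> [(d-1)*b = 0] (mod m) \<and>
        (\<exists>\<alpha> \<beta>. \<alpha> \<noteq> 0 \<and>
          defined_by F'
            (VX^d + VY^d
             + (\<Sum>j=2..d-2. VX^(d-j) * (\<Sum>i\<in>S2_X j m a b. Const (\<beta> j i) * VY^i * VZ^(j-i)))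
             + (\<Sum>i\<in>S_d_X 1 d m a b. Const (\<beta> d i) * VY^i * VZ^(d-i))
             + VX * (Const \<alpha> * VZ^(d-1)
                + (\<Sum>i\<in>S_d1_X 1 d m a b. Const (\<beta> (d-1) i) * VY^i * VZ^(d-1-i)))))))
    \<or>
    \<comment> \<open>(6)\<close>
    (card (ref_points_on F') = 0 \<and> m dvd d \<and>
      (\<exists>a b. (a, b) \<in> Gamma_pairs m \<and> of_type \<zeta> a b G' \<and>
        [d*a = 0] (mod m) \<and> [d*b = 0] (mod m) \<and>
        (\<exists>\<beta>.
          defined_by F'
            (VX^d + VY^d + VZ^d
             + (\<Sum>j=2..d-1. VX^(d-j) * (\<Sum>i\<in>S2_X j m a b. Const (\<beta> j i) * VY^i * VZ^(j-i)))
             + (\<Sum>i\<in>S_d_X 1 d m a b. Const (\<beta> d i) * VY^i * VZ^(d-i)))))))"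
proof -
  obtain P w where P: "invertible P" and act: "diagonal_action d m \<zeta> (lin_subst F P) (conj_by P G) w"
    using diagonal_action_exists[OF assms(2-8,10)] by blast
  have "classified d m \<zeta> (lin_subst F P) (conj_by P G)"
  proof (cases "\<exists>i j. i \<noteq> j \<and> [w i = w j] (mod m)")
    case False
    then show ?thesis using classified_distinct_weights[OF assms(1,10) act] by blast
  next
    case True
    then obtain i j where ij: "i \<noteq> j" "[w i = w j] (mod m)" by blast
    \<comment> \<open>The two congruent weights are moved to the positions of \<open>X\<close> and
      \<open>Y\<close>, leaving \<open>Z\<close> as the coordinate on which the homology
      acts.\<close>
    obtain t where t: "j \<noteq> t" "i \<noteq> t" by (rule third_index_3[OF ij(1)])
    obtain Q where Q: "invertible Q" and
      act1: "diagonal_action d m \<zeta> (lin_subst (lin_subst F P) Q) (conj_by Q (conj_by P G))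
        (\<lambda>l. if l = 1 then w i else if l = 2 then w j else w t)"
      by (rule diagonal_action_reorder[OF assms(10) act ij(1) t]) (rule that)
    have "classified d m \<zeta> (lin_subst (lin_subst F P) Q) (conj_by Q (conj_by P G))"
      by (rule classified_homology[OF assms(1,10) diagonal_action_weights_homology[OF assms(10) act1]])
        (use ij in simp)
    then show ?thesis by (rule classified_transport[OF diagonal_action_carrier[OF assms(10) act] Q])
  qed
  then have "classified d m \<zeta> F G"
    by (rule classified_transport[OF subgroup.subset[OF assms(4)] P])
  then have "\<exists>P F' G'. invertible P \<and> F' = lin_subst F P \<and> G' = conj_by P G \<and>
    (type_1 d m \<zeta> F' G' \<or> type_2 d m \<zeta> F' G' \<or> type_3 d m \<zeta> F' G' \<or> type_4_1 d m \<zeta> F' G' \<or>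
     type_4_2 d m \<zeta> F' G' \<or> type_4_3 d m \<zeta> F' G' \<or> type_5 d m \<zeta> F' G' \<or> type_6 d m \<zeta> F' G')"
    unfolding classified_def by blast
  then show ?thesis
    unfolding type_1_def type_2_def type_3_def type_4_1_def type_4_2_def type_4_3_def type_5_def type_6_def .
qed

end
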